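(* There is an algorithm that, given a weighted game graph $(G,w)$ and an integer $M$ which is an upper bound on the finite minimal energy of $(G,w)$ (i.e., for every node $v$, $e^*_{G,w}(v)<\infty$ implies $e^*_{G,w}(v)\le M$), computes the minimal energies $e^*_{G,w}(v)$ of all nodes $v$ in time \[ O\left( mn \left(\log\frac{M}{n}\right)\left(\log\frac{M}{n\lceil P(G,w)\rceil}\right) + m\frac{M}{\lceil P(G,w)\rceil}\right). \] The algorithm does not need to know $P(G,w)$.
   Context: A weighted game graph $(G,w)$ consists of a finite directed graph $G=(V,E)$ in which every node has out-degree at least $1$, a partition $V=V_A\cup V_B$ of the nodes into nodes of Alice ($V_A$) and of Bob ($V_B$), and integer edge weights $w:E\to\mathbb{Z}$. Let $n=|V|$, $m=|E|$. A (positional) strategy $\sigma$ of Alice maps each $u\in V_A$ to a node $\sigma(u)$ with $(u,\sigma(u))\in E$; a strategy $\tau$ of Bob maps each $u\in V_B$ to $\tau(u)$ with $(u,\tau(u))\in E$. $G(\sigma,\tau)$ is the subgraph of $G$ with edge set $\{(u,\sigma(u)):u\in V_A\}\cup\{(u,\tau(u)):u\in V_B\}$; in it every node has exactly one out-edge, so from any node $s$ there is a unique cycle $C$ reachable from $s$. For a path or cycle $P$, $w(P)$ is the sum of its edge weights. Define $e^*_{G(\sigma,\tau),w}(s)=\infty$ if $w(C)<0$, and otherwise $e^*_{G(\sigma,\tau),w}(s)=\max\{0,-\min_P w(P)\}$, the minimum over all simple paths $P$ in $G(\sigma,\tau)$ starting at $s$. The minimal energy is $e^*_{G,w}(s)=\min_\sigma\max_\tau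 e^*_{G(\sigma,\tau),w}(s)$ over positional strategies. A strategy $\tau^*$ of Bob is optimal (for start node $s$) if $e^*_{G(\sigma,\tau^* ),w}(s)\ge e^*_{G,w}(s)$ for every strategy $\sigma$ of Alice. Penalty: for a real $D\ge 0$, node $s$ has penalty at least $D$ if there is an optimal strategy $\tau^*$ of Bob such that for every strategy $\sigma$ of Alice, the unique cycle $C$ reachable from $s$ in $G(\sigma,\tau^* )$ satisfies: if $w(C)<0$ then $w(C)/|C|\le -D$. $P_{G,w}(s)$ is the supremum of all such $D$, and $P(G,w)=\min_{s\in V}P_{G,w}(s)$. *)

theory Defs
  imports
    "HOL-Analysis.Analysis"
    "HOL-Library.Extended_Nat"
    "HOL-Library.Extended_Real"
    "HOL-Library.FuncSet"
    "Graph_Theory.Graph_Theory"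
begin

section \<open>Weighted game graphs, minimal energy and penalty\<close>

record 'v game =
  game_graph :: "'v pair_pre_digraph"
  alice :: "'v set"
  bob :: "'v set"
  weight :: "'v \<times> 'v \<Rightarrow> int"

abbreviation nodes :: "'v game \<Rightarrow> 'v set" where
  "nodes \<Gamma> \<equiv> pverts (game_graph \<Gamma>)"

abbreviation edges :: "'v game \<Rightarrow> ('v \<times> 'v) set" where
  "edges \<Gamma> \<equiv> parcs (game_graph \<Gamma>)"

text \<open>Loops are allowed. There is at least one node, since the penalty of a game is a minimum
  over all nodes.\<close>

definition weighted_game_graph :: "'v game \<Rightarrow> bool" where
  "weighted_game_graph \<Gamma> \<longleftrightarrow>
     pair_fin_digraph (game_graph \<Gamma>) \<and> nodes \<Gamma> \<noteq> {} \<and>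
     alice \<Gamma> \<union> bob \<Gamma> = nodes \<Gamma> \<and> alice \<Gamma> \<inter> bob \<Gamma> = {} \<and>
     (\<forall>u \<in> nodes \<Gamma>. \<exists>v. (u, v) \<in> edges \<Gamma>)"

text \<open>A positional strategy of the player owning the nodes \<open>U\<close>. The extensional function space
  makes the set of strategies finite.\<close>

definition strategies :: "'v game \<Rightarrow> 'v set \<Rightarrow> ('v \<Rightarrow> 'v) set" where
  "strategies \<Gamma> U = (\<Pi>\<^sub>E u \<in> U. {v. (u, v) \<in> edges \<Gamma>})"

definition play_graph :: "'v game \<Rightarrow> ('v \<Rightarrow> 'v) \<Rightarrow> ('v \<Rightarrow> 'v) \<Rightarrow> 'v pair_pre_digraph" where
  "play_graph \<Gamma> \<sigma> \<tau> =
     \<lparr> pverts = nodes \<Gamma>,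
       parcs = {(u, \<sigma> u) | u. u \<in> alice \<Gamma>} \<union> {(u, \<tau> u) | u. u \<in> bob \<Gamma>} \<rparr>"

text \<open>Paths and cycles are lists of edges, so the length of the list is the length of the path.\<close>

definition path_weight :: "'v game \<Rightarrow> ('v \<times> 'v) list \<Rightarrow> int" where
  "path_weight \<Gamma> p = sum_list (map (weight \<Gamma>) p)"

definition reachable_cycle :: "'v pair_pre_digraph \<Rightarrow> 'v \<Rightarrow> ('v \<times> 'v) list \<Rightarrow> bool" where
  "reachable_cycle H s C \<longleftrightarrow>
     pre_digraph.cycle (with_proj H) C \<and> reachable (with_proj H) s (fst (hd C))"

text \<open>In a play graph every node has exactly one out-edge, so the cycle reachable from \<open>s\<close> exists
  and is unique up to rotation of the list. Rotation changes neither weight nor length, hence it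
  does not matter whether the cycle is quantified existentially (as here) or universally (as in
  the penalty below).\<close>

definition play_energy :: "'v game \<Rightarrow> ('v \<Rightarrow> 'v) \<Rightarrow> ('v \<Rightarrow> 'v) \<Rightarrow> 'v \<Rightarrow> enat" where
  "play_energy \<Gamma> \<sigma> \<tau> s =
     (if \<exists>C. reachable_cycle (play_graph \<Gamma> \<sigma> \<tau>) s C \<and> path_weight \<Gamma> C < 0 then \<infinity>
      else enat (nat (max 0 (- Min {path_weight \<Gamma> p | p v.
        pre_digraph.apath (with_proj (play_graph \<Gamma> \<sigma> \<tau>)) s p v}))))"

definition minimal_energy :: "'v game \<Rightarrow> 'v \<Rightarrow> enat" where
  "minimal_energy \<Gamma> s =
     (MIN \<sigma> \<in> strategies \<Gamma> (alice \<Gamma>). MAX \<tau> \<in> strategies \<Gamma> (bob \<Gamma>). play_energy \<Gamma> \<sigma> \<tau> s)"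

definition optimal_for_bob :: "'v game \<Rightarrow> 'v \<Rightarrow> ('v \<Rightarrow> 'v) \<Rightarrow> bool" where
  "optimal_for_bob \<Gamma> s \<tau> \<longleftrightarrow>
     \<tau> \<in> strategies \<Gamma> (bob \<Gamma>) \<and>
     (\<forall>\<sigma> \<in> strategies \<Gamma> (alice \<Gamma>). play_energy \<Gamma> \<sigma> \<tau> s \<ge> minimal_energy \<Gamma> s)"

definition penalty_at_least :: "'v game \<Rightarrow> 'v \<Rightarrow> real \<Rightarrow> bool" where
  "penalty_at_least \<Gamma> s D \<longleftrightarrow>
     (\<exists>\<tau>. optimal_for_bob \<Gamma> s \<tau> \<and>
       (\<forall>\<sigma> \<in> strategies \<Gamma> (alice \<Gamma>). \<forall>C. reachable_cycle (play_graph \<Gamma> \<sigma> \<tau>) s C \<longrightarrow>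
          path_weight \<Gamma> C < 0 \<longrightarrow> real_of_int (path_weight \<Gamma> C) / real (length C) \<le> - D))"

text \<open>The penalty is \<open>\<infinity>\<close> if some optimal strategy of Bob never admits a negative cycle.\<close>

definition node_penalty :: "'v game \<Rightarrow> 'v \<Rightarrow> ereal" where
  "node_penalty \<Gamma> s = Sup {ereal D | D. 0 \<le> D \<and> penalty_at_least \<Gamma> s D}"

definition penalty :: "'v game \<Rightarrow> ereal" where
  "penalty \<Gamma> = (MIN s \<in> nodes \<Gamma>. node_penalty \<Gamma> s)"

definition energy_upper_bound :: "'v game \<Rightarrow> int \<Rightarrow> bool" where
  "energy_upper_bound \<Gamma> M \<longleftrightarrow> (\<forall>v \<in> nodes \<Gamma>. \<forall>k. minimal_energy \<Gamma> v = enat k \<longrightarrow> int k \<le> M)"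


section \<open>The machine model\<close>

text \<open>
  Algorithms are programs of a deterministic random-access machine with integer words, given in
  structured form: finitely many variables and arrays, arithmetic, comparisons, assignments,
  branching and loops. Every executed assignment, test or no-op costs one step; expressions
  are not charged by size, as the size is a constant of the program.
  A word holds integers of absolute value at most \<open>B\<close>; a step that would store a larger value,
  or store at an address outside \<open>{0..B}\<close>, has no successor, so such a run has no final state.
  Expressions have a fixed depth, so intermediate values take at most a constant
  number of words. Division rounds down.
\<close>

type_synonym vname = string

datatype aexp =
    Const int
  | Var vname
  | Read vname aexp
  | Add aexp aexp
  | Sub aexp aexp
  | Mul aexp aexp
  | Quot aexp aexp

datatype bexp =
    Less aexp aexp
  | Neg bexp
  | Conj bexp bexp

datatype com =
    Skip
  | Assign vname aexp
  | Write vname aexp aexp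
  | Seq com com
  | Cond bexp com com
  | Loop bexp com

record state =
  vars :: "vname \<Rightarrow> int"
  arrays :: "vname \<Rightarrow> int \<Rightarrow> int"

fun aval :: "aexp \<Rightarrow> state \<Rightarrow> int" where
  "aval (Const k) s = k"
| "aval (Var x) s = vars s x"
| "aval (Read A i) s = arrays s A (aval i s)"
| "aval (Add a b) s = aval a s + aval b s"
| "aval (Sub a b) s = aval a s - aval b s"
| "aval (Mul a b) s = aval a s * aval b s"
| "aval (Quot a b) s = aval a s div aval b s"

fun bval :: "bexp \<Rightarrow> state \<Rightarrow> bool" where
  "bval (Less a b) s \<longleftrightarrow> aval a s < aval b s"
| "bval (Neg b) s \<longleftrightarrow> \<not> bval b s"
| "bval (Conj b c) s \<longleftrightarrow> bval b s \<and> bval c s"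

definition set_var :: "vname \<Rightarrow> int \<Rightarrow> state \<Rightarrow> state" where
  "set_var x v s = s\<lparr>vars := (vars s)(x := v)\<rparr>"

definition set_array :: "vname \<Rightarrow> int \<Rightarrow> int \<Rightarrow> state \<Rightarrow> state" where
  "set_array A i v s = s\<lparr>arrays := (arrays s)(A := (arrays s A)(i := v))\<rparr>"

text \<open>\<open>run B c s t s'\<close>: on words bounded by \<open>B\<close>, program \<open>c\<close> started in \<open>s\<close> halts in \<open>s'\<close>
  after \<open>t\<close> steps.\<close>

inductive run :: "int \<Rightarrow> com \<Rightarrow> state \<Rightarrow> nat \<Rightarrow> state \<Rightarrow> bool" for B :: int where
  run_Skip: "run B Skip s 1 s"
| run_Assign: "\<bar>aval a s\<bar> \<le> B \<Longrightarrow> run B (Assign x a) s 1 (set_var x (aval a s) s)"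
| run_Write: "0 \<le> aval i s \<Longrightarrow> aval i s \<le> B \<Longrightarrow> \<bar>aval a s\<bar> \<le> B \<Longrightarrow>
    run B (Write A i a) s 1 (set_array A (aval i s) (aval a s) s)"
| run_Seq: "run B c s t s' \<Longrightarrow> run B d s' t' s'' \<Longrightarrow> run B (Seq c d) s (t + t') s''"
| run_Cond_True: "bval b s \<Longrightarrow> run B c s t s' \<Longrightarrow> run B (Cond b c d) s (Suc t) s'"
| run_Cond_False: "\<not> bval b s \<Longrightarrow> run B d s t s' \<Longrightarrow> run B (Cond b c d) s (Suc t) s'"
| run_Loop_False: "\<not> bval b s \<Longrightarrow> run B (Loop b c) s 1 s"
| run_Loop_True: "bval b s \<Longrightarrow> run B c s t s' \<Longrightarrow> run B (Loop b c) s' t' s'' \<Longrightarrow>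
    run B (Loop b c) s (Suc (t + t')) s''"

inductive_cases run_SkipE: "run B Skip s t s'"
inductive_cases run_AssignE: "run B (Assign x a) s t s'"
inductive_cases run_WriteE: "run B (Write A i a) s t s'"
inductive_cases run_SeqE: "run B (Seq c d) s t s'"
inductive_cases run_CondE: "run B (Cond b c d) s t s'"
inductive_cases run_LoopE: "run B (Loop b c) s t s'"

lemma run_deterministic:
  assumes "run B c s t s'" and "run B c s u s''"
  shows "t = u \<and> s' = s''"
  using assms
proof (induction arbitrary: u s'' rule: run.induct)
  case run_Skip
  then show ?case by (auto elim: run_SkipE)
next
  case run_Assign
  then show ?case by (auto elim: run_AssignE)
next
  case run_Write
  then show ?case by (auto elim: run_WriteE)
next
  case run_Seq
  from run_Seq.prems show ?case by (rule run_SeqE) (use run_Seq.IH in blast)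
next
  case run_Cond_True
  from run_Cond_True.prems show ?case
    by (rule run_CondE) (use run_Cond_True.IH run_Cond_True.hyps in blast)+
next
  case run_Cond_False
  from run_Cond_False.prems show ?case
    by (rule run_CondE) (use run_Cond_False.IH run_Cond_False.hyps in blast)+
next
  case run_Loop_False
  then show ?case by (auto elim: run_LoopE)
next
  case run_Loop_True
  from run_Loop_True.prems show ?case
    by (rule run_LoopE) (use run_Loop_True.IH run_Loop_True.hyps in blast)+
qed


section \<open>Input, output and running time\<close>

text \<open>The input is a game on the nodes \<open>0, \<dots>, n - 1\<close>, presented as a list of its edges in
  arbitrary order.\<close>

definition presents :: "(nat \<times> nat) list \<Rightarrow> nat game \<Rightarrow> bool" where
  "presents es \<Gamma> \<longleftrightarrow>
     nodes \<Gamma> = {..<card (nodes \<Gamma>)} \<and> distinct es \<and> set es = edges \<Gamma>"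

definition array_of :: "int list \<Rightarrow> int \<Rightarrow> int" where
  "array_of xs i = (if 0 \<le> i \<and> i < int (length xs) then xs ! nat i else 0)"

definition input_state :: "nat game \<Rightarrow> (nat \<times> nat) list \<Rightarrow> int \<Rightarrow> state" where
  "input_state \<Gamma> es M =
     \<lparr> vars = (\<lambda>_. 0)
         (''n'' := int (card (nodes \<Gamma>)),
          ''m'' := int (length es),
          ''M'' := M),
       arrays = (\<lambda>_ _. 0)
         (''alice'' := array_of (map (\<lambda>v. of_bool (v \<in> alice \<Gamma>)) [0..<card (nodes \<Gamma>)]),
          ''source'' := array_of (map (\<lambda>e. int (fst e)) es),
          ''target'' := array_of (map (\<lambda>e. int (snd e)) es),
          ''weight'' := array_of (map (weight \<Gamma>) es)) \<rparr>"

text \<open>In the output, \<open>-1\<close> stands for \<open>\<infinity>\<close>.\<close>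

definition encode_energy :: "enat \<Rightarrow> int" where
  "encode_energy e = (case e of enat k \<Rightarrow> int k | \<infinity> \<Rightarrow> - 1)"

definition outputs_minimal_energies :: "nat game \<Rightarrow> state \<Rightarrow> bool" where
  "outputs_minimal_energies \<Gamma> s \<longleftrightarrow>
     (\<forall>v \<in> nodes \<Gamma>. arrays s ''energy'' (int v) = encode_energy (minimal_energy \<Gamma> v))"

text \<open>For a constant \<open>k\<close>, integers below this bound have \<open>O(log (n + m + W + M))\<close> bits, where
  \<open>W\<close> is the largest absolute edge weight.\<close>

definition word_bound :: "nat \<Rightarrow> 'v game \<Rightarrow> int \<Rightarrow> int" where
  "word_bound k \<Gamma> M =
     (2 + int (card (nodes \<Gamma>)) + int (card (edges \<Gamma>)) + \<bar>M\<bar>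
        + (MAX e \<in> edges \<Gamma>. \<bar>weight \<Gamma> e\<bar>)) ^ k"

text \<open>Logarithms in a running time are at least \<open>1\<close>. Without this convention the bound would
  be \<open>0\<close>, negative or undefined when \<open>M / n\<close> or \<open>M / (n \<lceil>P\<rceil>)\<close> is at most \<open>1\<close>, which in the
  latter case includes \<open>P = \<infinity>\<close>.\<close>

definition lg :: "real \<Rightarrow> real" where
  "lg x = (if x \<le> 2 then 1 else log 2 x)"

text \<open>\<open>M / \<lceil>P\<rceil>\<close>, which is \<open>0\<close> if \<open>P = \<infinity>\<close>. The denominator is not \<open>0\<close> if \<open>P\<close> is the finite
  penalty of a game: a negative cycle has mean weight at most \<open>-1/n\<close>, so \<open>P \<ge> 1/n\<close>.\<close>

definition per_penalty :: "real \<Rightarrow> ereal \<Rightarrow> real" where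
  "per_penalty M P = (if P = \<infinity> then 0 else M / real_of_int \<lceil>real_of_ereal P\<rceil>)"

text \<open>A negative \<open>M\<close> is an admissible upper bound if all minimal energies are infinite; it counts
  as \<open>0\<close> in the running time.\<close>

definition time_bound :: "'v game \<Rightarrow> int \<Rightarrow> real" where
  "time_bound \<Gamma> M =
     (let n = real (card (nodes \<Gamma>)); m = real (card (edges \<Gamma>)); N = real_of_int (max 0 M);
          Q = per_penalty N (penalty \<Gamma>)
      in m * n * lg (N / n) * lg (Q / n) + m * Q)"

end

(*
  The minimal energies are the least fixpoint of the one-step equations, and Bob has one
  positional strategy that is optimal from every node: among all his strategies take one whose
  own least fixpoint is maximal; switching it along an edge that violates Bob's equation would
  make the fixpoint larger.

  The algorithm runs value iteration from below for weights rounded up to multiples of b. A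
  fixpoint for the multiples of 2b, counted in units of b, is at most 2n units below the minimal
  energy of every node if 2b is smaller than the penalty, because a negative cycle that Bob can
  force stays negative after rounding. So halving b costs only O(mn) once the infinite nodes have
  been found in the first phase, which costs O(mM/g) if it starts with b = g. As the penalty is
  unknown, g is tried from M/n downwards; an attempt is given up when a phase exceeds the number
  of steps it would need if g were below the penalty. The last phase has b = 1 and is therefore
  exact, whatever the earlier guesses were.
*)
theory Submission
  imports Defs
begin

section \<open>Minimal energies as a least fixpoint\<close>

text \<open>What makes guessing safe is an asymmetry. Rounding weights up only lowers energies, so
  for every guess the values stay below the true energies, and a fixpoint for unit 1 is exact; the
  penalty enters only through the number of raises. To bound it, Alice's strategy is read off the
  rounded fixpoint and Bob's is a witness of the penalty. In their play a finite value excludes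
  reachable cycles of negative rounded weight, so a true cycle has mean at least \<open>- b\<close>;
  a negative one would have mean at most \<open>- D < - b\<close>, hence there is none, and a simple
  path loses less than \<open>b\<close> on each of its fewer than \<open>n\<close> edges. As Bob's
  witness is optimal, this single play bounds the minimal energy. Guesses much above
  \<open>M / n\<close> would save nothing, since then mM/g is below the O(mn) of any later phase.
  The guess 1 cannot be refuted: its only phase is the first, where \<open>M + 1\<close> raises take
  any node to infinity. Successive guesses are halved, so the terms mM/g form a geometric series
  dominated by its last guess, and that one is at least half the penalty unless it is the first
  guess.\<close>

definition enat_diff :: "enat \<Rightarrow> int \<Rightarrow> enat" where
  "enat_diff x k = (case x of enat a \<Rightarrow> enat (nat (int a - k)) | \<infinity> \<Rightarrow> \<infinity>)"

lemma enat_diff_simps [simp]: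
  "enat_diff (enat a) k = enat (nat (int a - k))" "enat_diff \<infinity> k = \<infinity>"
  by (auto simp: enat_diff_def)

lemma enat_diff_mono: "x \<le> y \<Longrightarrow> enat_diff x k \<le> enat_diff y k"
  by (cases x; cases y) auto

lemma enat_diff_add_le: "enat_diff (x + enat d) k \<le> enat_diff x k + enat d"
  by (cases x) auto

lemma enat_diff_le_iff:
  "enat_diff y k \<le> x \<longleftrightarrow> (\<forall>a. x = enat a \<longrightarrow> (\<exists>b. y = enat b \<and> int b \<le> int a + k))"
  by (cases x; cases y) auto

text \<open>The Bellman operator of the energy game: \<open>enat_diff\<close> is subtraction
  truncated at 0, which supplies the \<open>max 0\<close>. The successor map \<open>X\<close> is a
  parameter so that fixing a strategy only shrinks \<open>X\<close>. On an empty successor set the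
  value is \<infinity> for a node in \<open>A\<close> and 0 for any other.\<close>

definition energy_step ::
    "'v set \<Rightarrow> ('v \<times> 'v \<Rightarrow> int) \<Rightarrow> ('v \<Rightarrow> 'v set) \<Rightarrow> ('v \<Rightarrow> enat) \<Rightarrow> 'v \<Rightarrow> enat" where
  "energy_step A w X f u =
     (if u \<in> A then (INF v\<in>X u. enat_diff (f v) (w (u, v)))
      else (SUP v\<in>X u. enat_diff (f v) (w (u, v))))"

lemma energy_step_mono: "f \<le> g \<Longrightarrow> energy_step A w X f u \<le> energy_step A w X g u"
  unfolding energy_step_def
  by (auto intro!: INF_mono' SUP_mono' enat_diff_mono simp: le_fun_def)

lemma mono_energy_step: "mono (energy_step A w X)"
  by (auto intro!: monoI simp: le_fun_def energy_step_mono)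

lemma energy_step_cong: "X u = Y u \<Longrightarrow> energy_step A w X f u = energy_step A w Y f u"
  by (simp add: energy_step_def)

text \<open>Truncated subtraction, minimum and supremum are nonexpansive under upward shifts by a
  constant. Hence a shifted fixpoint is still a prefixpoint, which the comparison in
  \<open>energy_lfp_improve\<close> needs.\<close>

lemma energy_step_add_le:
  "energy_step A w X (\<lambda>x. f x + enat d) u \<le> energy_step A w X f u + enat d"
proof (cases "u \<in> A")
  case True
  show ?thesis
  proof (cases "X u = {}")
    case False
    let ?S = "(\<lambda>v. enat_diff (f v) (w (u, v))) ` X u"
    have "Inf ?S \<in> ?S" using False by (meson wellorder_InfI all_not_in_conv imageI)
    then obtain v where v: "v \<in> X u" "Inf ?S = enat_diff (f v) (w (u, v))" by auto
    have "energy_step A w X (\<lambda>x. f x + enat d) u \<le> enat_diff (f v + enat d) (w (u, v))"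
      using True v(1) by (auto simp: energy_step_def intro: INF_lower)
    also have "\<dots> \<le> enat_diff (f v) (w (u, v)) + enat d" by (rule enat_diff_add_le)
    also have "\<dots> = energy_step A w X f u + enat d" using True v by (simp add: energy_step_def)
    finally show ?thesis .
  qed (simp add: energy_step_def True top_enat_def)
next
  case False
  then show ?thesis
    by (auto simp: energy_step_def
        intro!: SUP_least order_trans[OF enat_diff_add_le] add_right_mono SUP_upper)
qed

definition energy_lfp ::
    "'v set \<Rightarrow> ('v \<times> 'v \<Rightarrow> int) \<Rightarrow> ('v \<Rightarrow> 'v set) \<Rightarrow> 'v \<Rightarrow> enat" where
  "energy_lfp A w X = lfp (energy_step A w X)"

lemma energy_lfp_unfold: "energy_step A w X (energy_lfp A w X) u = energy_lfp A w X u"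
  unfolding energy_lfp_def by (metis lfp_unfold[OF mono_energy_step])

lemma energy_lfp_least: "(\<And>u. energy_step A w X f u \<le> f u) \<Longrightarrow> energy_lfp A w X \<le> f"
  unfolding energy_lfp_def by (rule lfp_lowerbound) (simp add: le_fun_def)

text \<open>The meet of \<open>k\<close> with the least fixpoint is a prefixpoint: at
  \<open>u\<close> the hypothesis makes it equal to the fixpoint, elsewhere monotonicity applies.
  The lemma compares fixpoints of two operators that differ at \<open>u\<close> only.\<close>

lemma energy_lfp_least_except:
  assumes "energy_lfp A w X u \<le> k u" and "\<And>x. x \<noteq> u \<Longrightarrow> energy_step A w X k x \<le> k x"
  shows "energy_lfp A w X \<le> k"
proof -
  let ?h = "energy_lfp A w X" let ?k = "inf k ?h"
  have "?h \<le> ?k"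
  proof (rule energy_lfp_least)
    fix x
    have 1: "energy_step A w X ?k x \<le> ?h x"
      using energy_step_mono[of ?k ?h A w X x] by (simp add: energy_lfp_unfold)
    moreover have "energy_step A w X ?k x \<le> k x"
    proof (cases "x = u")
      case False
      have "energy_step A w X ?k x \<le> energy_step A w X k x" by (rule energy_step_mono) simp
      then show ?thesis using assms(2)[OF False] by simp
    qed (use 1 assms(1) in auto)
    ultimately show "energy_step A w X ?k x \<le> ?k x" by simp
  qed
  then show ?thesis by simp
qed

section \<open>Improving a positional strategy of Bob by switching one edge\<close>

definition follow :: "'v set \<Rightarrow> ('v \<Rightarrow> 'v) \<Rightarrow> ('v \<Rightarrow> 'v set) \<Rightarrow> 'v \<Rightarrow> 'v set" where
  "follow U \<tau> X u = (if u \<in> U then {\<tau> u} else X u)"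

text \<open>The value at \<open>u\<close> cannot fall. Otherwise the new fixpoint, lifted by the
  loss at \<open>u\<close>, is a prefixpoint of the old equations except at \<open>u\<close>, where
  it has the old value. So it dominates the old fixpoint, in particular at \<open>v\<close>, and the
  new equation at \<open>u\<close> then contradicts the assumed violation. Once the value at
  \<open>u\<close> does not fall, it falls nowhere, and the violation makes the growth at
  \<open>u\<close> strict.\<close>

lemma energy_lfp_improve:
  assumes u: "u \<in> U" "u \<notin> A"
    and lt: "energy_lfp A w (follow U \<tau> X) u < enat_diff (energy_lfp A w (follow U \<tau> X) v) (w (u, v))"
  shows "energy_lfp A w (follow U \<tau> X) < energy_lfp A w (follow U (\<tau>(u := v)) X)"
proof -
  let ?Y = "follow U \<tau> X" and ?Y' = "follow U (\<tau>(u := v)) X"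
  let ?h = "energy_lfp A w ?Y" and ?h' = "energy_lfp A w ?Y'"
  have same: "energy_step A w ?Y f x = energy_step A w ?Y' f x" if "x \<noteq> u" for f x
    using that by (intro energy_step_cong) (simp add: follow_def)
  have h'u: "?h' u = enat_diff (?h' v) (w (u, v))"
    using energy_lfp_unfold[of A w ?Y' u] u by (simp add: energy_step_def follow_def)
  have "?h u \<le> ?h' u"
  proof (rule ccontr)
    assume *: "\<not> ?h u \<le> ?h' u"
    obtain a where a: "?h u = enat a" using lt by (cases "?h u") auto
    obtain a' where a': "?h' u = enat a'" using * by (cases "?h' u") auto
    have "a' < a" using * a a' by simp
    \<comment> \<open>The shift is exactly the loss at \<open>u\<close>, so
      \<open>?k u = ?h u\<close>.\<close>
    let ?k = "\<lambda>x. ?h' x + enat (a - a')"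
    have "?h \<le> ?k"
    proof (rule energy_lfp_least_except)
      show "?h u \<le> ?k u" using a a' by simp
    next
      fix x assume "x \<noteq> u"
      then have "energy_step A w ?Y ?k x = energy_step A w ?Y' ?k x" by (rule same)
      also have "\<dots> \<le> energy_step A w ?Y' ?h' x + enat (a - a')" by (rule energy_step_add_le)
      finally show "energy_step A w ?Y ?k x \<le> ?k x" by (simp add: energy_lfp_unfold)
    qed
    then have "?h v \<le> ?h' v + enat (a - a')" by (simp add: le_fun_def)
    then have "enat_diff (?h v) (w (u, v)) \<le> enat_diff (?h' v + enat (a - a')) (w (u, v))"
      by (rule enat_diff_mono)
    also have "\<dots> \<le> enat_diff (?h' v) (w (u, v)) + enat (a - a')" by (rule enat_diff_add_le)
    also have "\<dots> = ?h u" using a a' \<open>a' < a\<close> h'u by simp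
    finally show False using lt by simp
  qed
  then have le: "?h \<le> ?h'"
    by (rule energy_lfp_least_except) (metis same energy_lfp_unfold order_refl)
  have "?h u < ?h' u"
    using lt enat_diff_mono[of "?h v" "?h' v" "w (u, v)"] le h'u by (auto simp: le_fun_def)
  then show ?thesis using le by (auto simp: less_le)
qed

text \<open>Fixpoints are ordered only pointwise, so a maximal strategy is taken rather than a
  greatest one. Since no switch improves it, its fixpoint satisfies the inequality on all edges of
  Bob, not only on the chosen ones, and is therefore a prefixpoint of the unrestricted
  operator.\<close>

lemma optimal_strategy_exists:
  assumes fin: "finite (\<Pi>\<^sub>E u\<in>U. X u)" and ne: "\<And>u. u \<in> U \<Longrightarrow> X u \<noteq> {}" and disj: "U \<inter> A = {}"
  shows "\<exists>\<tau> \<in> (\<Pi>\<^sub>E u\<in>U. X u). energy_lfp A w X \<le> energy_lfp A w (follow U \<tau> X)"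
proof -
  let ?L = "\<lambda>\<tau>. energy_lfp A w (follow U \<tau> X)"
  have "(\<Pi>\<^sub>E u\<in>U. X u) \<noteq> {}" using ne by (simp add: PiE_eq_empty_iff)
  then obtain \<tau> where \<tau>: "\<tau> \<in> (\<Pi>\<^sub>E u\<in>U. X u)"
    and max: "\<And>\<tau>'. \<tau>' \<in> (\<Pi>\<^sub>E u\<in>U. X u) \<Longrightarrow> \<not> ?L \<tau> < ?L \<tau>'"
    using finite_has_maximal[of "?L ` (\<Pi>\<^sub>E u\<in>U. X u)"] fin
    by (auto simp: less_le)
  have "energy_lfp A w X \<le> ?L \<tau>"
  proof (rule energy_lfp_least)
    fix u
    show "energy_step A w X (?L \<tau>) u \<le> ?L \<tau> u"
    proof (cases "u \<in> U")
      case True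
      then have uA: "u \<notin> A" using disj by auto
      have "enat_diff (?L \<tau> v) (w (u, v)) \<le> ?L \<tau> u" if v: "v \<in> X u" for v
      proof (rule ccontr)
        assume "\<not> ?thesis"
        then have "?L \<tau> < ?L (\<tau>(u := v))"
          using True uA by (intro energy_lfp_improve) auto
        moreover have "\<tau>(u := v) \<in> (\<Pi>\<^sub>E u\<in>U. X u)" using \<tau> True v
          by (auto simp: PiE_iff extensional_def)
        ultimately show False using max by blast
      qed
      then show ?thesis using uA by (auto simp: energy_step_def intro: SUP_least)
    next
      case False
      then have "energy_step A w X (?L \<tau>) u = energy_step A w (follow U \<tau> X) (?L \<tau>) u"
        by (intro energy_step_cong) (simp add: follow_def)
      then show ?thesis by (simp add: energy_lfp_unfold)
    qed
  qed
  then show ?thesis using \<tau> by blast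
qed

section \<open>Games and the energy of the play of two fixed strategies\<close>

abbreviation successors :: "'v game \<Rightarrow> 'v \<Rightarrow> 'v set" where
  "successors \<Gamma> u \<equiv> {v. (u, v) \<in> edges \<Gamma>}"

locale weighted_game =
  fixes \<Gamma> :: "'v game"
  assumes weighted_game_graph: "weighted_game_graph \<Gamma>"
begin

lemma finite_nodes: "finite (nodes \<Gamma>)" and finite_edges: "finite (edges \<Gamma>)"
  and nodes_nonempty: "nodes \<Gamma> \<noteq> {}"
  and nodes_eq: "nodes \<Gamma> = alice \<Gamma> \<union> bob \<Gamma>" and disjoint: "alice \<Gamma> \<inter> bob \<Gamma> = {}"
  and successor_exists: "u \<in> nodes \<Gamma> \<Longrightarrow> \<exists>v. (u, v) \<in> edges \<Gamma>"
  and edge_nodes: "(u, v) \<in> edges \<Gamma> \<Longrightarrow> u \<in> nodes \<Gamma> \<and> v \<in> nodes \<Gamma>"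
  using weighted_game_graph unfolding weighted_game_graph_def
  by (auto simp: pair_fin_digraph_def pair_fin_digraph_axioms_def
      dest: pair_wf_digraph.wellformed')

lemma finite_successors: "finite (successors \<Gamma> u)"
  by (rule finite_subset[OF _ finite_nodes]) (auto dest: edge_nodes)

lemma finite_strategies: "U \<subseteq> nodes \<Gamma> \<Longrightarrow> finite (strategies \<Gamma> U)"
  unfolding strategies_def
  by (intro finite_PiE finite_successors) (auto intro: finite_subset[OF _ finite_nodes])

lemma strategies_nonempty: "U \<subseteq> nodes \<Gamma> \<Longrightarrow> strategies \<Gamma> U \<noteq> {}"
  unfolding strategies_def using successor_exists by (auto simp: PiE_eq_empty_iff)

lemma players: "alice \<Gamma> \<subseteq> nodes \<Gamma>" "bob \<Gamma> \<subseteq> nodes \<Gamma>"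
  using nodes_eq by auto

end

locale game_play = weighted_game +
  fixes \<sigma> \<tau> :: "'a \<Rightarrow> 'a"
  assumes alice_strategy: "\<sigma> \<in> strategies \<Gamma> (alice \<Gamma>)" and bob_strategy: "\<tau> \<in> strategies \<Gamma> (bob \<Gamma>)"
begin

definition next_node :: "'a \<Rightarrow> 'a" where
  "next_node u = (if u \<in> alice \<Gamma> then \<sigma> u else \<tau> u)"

abbreviation "H \<equiv> play_graph \<Gamma> \<sigma> \<tau>"

lemma pverts_H: "pverts H = nodes \<Gamma>"
  by (simp add: play_graph_def)

lemma parcs_H: "parcs H = {(u, next_node u) | u. u \<in> nodes \<Gamma>}"
  using nodes_eq disjoint by (auto simp: play_graph_def next_node_def)

lemma next_node_edge: "u \<in> nodes \<Gamma> \<Longrightarrow> (u, next_node u) \<in> edges \<Gamma>"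
  using alice_strategy bob_strategy nodes_eq by (auto simp: strategies_def next_node_def PiE_iff)

lemma next_node_in: "u \<in> nodes \<Gamma> \<Longrightarrow> next_node u \<in> nodes \<Gamma>"
  using next_node_edge edge_nodes by blast

sublocale play: pair_fin_digraph "play_graph \<Gamma> \<sigma> \<tau>"
proof
  show "finite (parcs H)" unfolding parcs_H using finite_nodes by simp
qed (auto simp: pverts_H parcs_H finite_nodes next_node_in)

text \<open>The edge inequalities telescope along the walk, and finiteness is carried from its start
  to its end. The weights \<open>w\<close> are arbitrary because the lemma also serves rounded
  weights.\<close>

lemma potential_awalk:
  assumes pot: "\<And>u. u \<in> nodes \<Gamma> \<Longrightarrow> enat_diff (f (next_node u)) (w (u, next_node u)) \<le> f u"
    and "play.awalk u p v" "f u = enat a"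
  shows "\<exists>b. f v = enat b \<and> int b \<le> int a + sum_list (map w p)"
  using assms(2,3)
proof (induction p arbitrary: u a)
  case Nil
  then show ?case by (auto simp: play.awalk_Nil_iff)
next
  case (Cons e p)
  then have "e \<in> parcs H" "fst e = u" and p: "play.awalk (snd e) p v"
    by (auto simp: play.awalk_Cons_iff)
  then have e: "e = (u, next_node u)" "u \<in> nodes \<Gamma>" by (auto simp: parcs_H)
  then obtain c where c: "f (next_node u) = enat c" "int c \<le> int a + w e"
    using pot[of u] Cons.prems(2) by (auto simp: enat_diff_le_iff)
  then show ?case using Cons.IH[OF p, of c] e by fastforce
qed

lemma finite_apath_weights: "finite {path_weight \<Gamma> p | p v. play.apath s p v}"
proof -
  have "finite {(u, p, v). play.apath u p v}" by (rule play.apaths_finite_triple)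
  then have "finite ((\<lambda>(u, p, v). path_weight \<Gamma> p) ` {(u, p, v). play.apath u p v})" by simp
  then show ?thesis by (rule rev_finite_subset) force
qed

lemma apath_Nil: "s \<in> nodes \<Gamma> \<Longrightarrow> play.apath s [] s"
  by (simp add: play.apath_Nil_iff pverts_H)

abbreviation "no_negative_cycle s \<equiv>
  \<forall>C. reachable_cycle H s C \<longrightarrow> 0 \<le> path_weight \<Gamma> C"

lemma play_energy_infinite: "\<not> no_negative_cycle s \<Longrightarrow> play_energy \<Gamma> \<sigma> \<tau> s = \<infinity>"
  by (auto simp: play_energy_def not_le)

text \<open>The empty path is among the simple paths, so the minimum over the finitely many path
  weights is at most 0 and is attained by a path of nonpositive weight.\<close>

lemma play_energy_finite:
  assumes "s \<in> nodes \<Gamma>" "no_negative_cycle s"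
  shows "\<exists>p v. play.apath s p v \<and> play_energy \<Gamma> \<sigma> \<tau> s = enat (nat (- path_weight \<Gamma> p)) \<and>
     path_weight \<Gamma> p \<le> 0"
    and "play.apath s p v \<Longrightarrow> enat (nat (- path_weight \<Gamma> p)) \<le> play_energy \<Gamma> \<sigma> \<tau> s"
proof -
  let ?S = "{path_weight \<Gamma> p | p v. play.apath s p v}"
  have 0: "0 \<in> ?S" using apath_Nil[OF assms(1)] by (force simp: path_weight_def)
  have E: "play_energy \<Gamma> \<sigma> \<tau> s = enat (nat (max 0 (- Min ?S)))"
    using assms(2) unfolding play_energy_def not_le[symmetric] by (subst if_not_P) auto
  have "Min ?S \<in> ?S" using 0 by (intro Min_in finite_apath_weights) auto
  moreover have le: "x \<in> ?S \<Longrightarrow> Min ?S \<le> x" for x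
    by (rule Min_le[OF finite_apath_weights])
  ultimately show "\<exists>p v. play.apath s p v \<and> play_energy \<Gamma> \<sigma> \<tau> s = enat (nat (- path_weight \<Gamma> p)) \<and>
     path_weight \<Gamma> p \<le> 0"
    using le[OF 0] E by (smt (verit) mem_Collect_eq)
  show "enat (nat (- path_weight \<Gamma> p)) \<le> play_energy \<Gamma> \<sigma> \<tau> s" if "play.apath s p v"
  proof -
    have "path_weight \<Gamma> p \<in> ?S" using that by blast
    then have "- path_weight \<Gamma> p \<le> max 0 (- Min ?S)" using le by force
    then show ?thesis unfolding E enat_ord_simps by (rule nat_mono)
  qed
qed

lemma reachable_cycle_awalk:
  assumes "reachable_cycle H s C"
  shows "\<exists>u q. play.awalk s q u \<and> play.awalk u C u"
proof -
  obtain u where u: "play.awalk u C u" "C \<noteq> []"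
    using assms unfolding reachable_cycle_def play.cycle_def by auto
  then have "fst (hd C) = u" by (cases C) (auto simp: play.awalk_Cons_iff)
  then show ?thesis using assms u(1) unfolding reachable_cycle_def play.reachable_awalk by auto
qed

text \<open>Potentials dominate the energy: telescoping once around a reachable cycle shows that its
  weight is nonnegative, and telescoping along a worst simple path bounds the energy spent on
  it.\<close>

lemma play_energy_le:
  assumes s: "s \<in> nodes \<Gamma>"
    and pot: "\<And>u. u \<in> nodes \<Gamma> \<Longrightarrow> enat_diff (f (next_node u)) (weight \<Gamma> (u, next_node u)) \<le> f u"
  shows "play_energy \<Gamma> \<sigma> \<tau> s \<le> f s"
proof (cases "f s")
  case (enat a)
  have "no_negative_cycle s"
  proof (intro allI impI)
    fix C assume "reachable_cycle H s C"
    then obtain u q where u: "play.awalk s q u" "play.awalk u C u"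
      using reachable_cycle_awalk by blast
    from potential_awalk[OF pot u(1) enat] obtain b where b: "f u = enat b" by auto
    from potential_awalk[OF pot u(2) b] b show "0 \<le> path_weight \<Gamma> C" by (auto simp: path_weight_def)
  qed
  from play_energy_finite(1)[OF s this] obtain p v where p: "play.apath s p v"
    "play_energy \<Gamma> \<sigma> \<tau> s = enat (nat (- path_weight \<Gamma> p))" by blast
  have "- path_weight \<Gamma> p \<le> int a"
    using potential_awalk[OF pot play.awalkI_apath[OF p(1)] enat] by (auto simp: path_weight_def)
  then show ?thesis using p enat by auto
qed simp

text \<open>The energy of the play is itself a potential. A worst path from the successor is
  extended backwards by the edge. If it already visits \<open>u\<close>, the part up to
  \<open>u\<close> closes to a cycle with the edge; this cycle is nonnegative, so what remains after
  dropping it is a simple path from \<open>u\<close> that is no heavier than the extended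
  one.\<close>

lemma play_energy_step:
  assumes u: "u \<in> nodes \<Gamma>"
  shows "enat_diff (play_energy \<Gamma> \<sigma> \<tau> (next_node u)) (weight \<Gamma> (u, next_node u)) \<le> play_energy \<Gamma> \<sigma> \<tau> u"
proof (cases "no_negative_cycle u")
  case True
  let ?v = "next_node u" and ?e = "(u, next_node u)"
  have e: "?e \<in> parcs H" using u by (auto simp: parcs_H)
  have v: "?v \<in> nodes \<Gamma>" using u next_node_edge edge_nodes by blast
  have "no_negative_cycle ?v"
  proof (intro allI impI)
    fix C assume "reachable_cycle H ?v C"
    then have "reachable_cycle H u C"
      using e unfolding reachable_cycle_def by (auto intro: play.adj_reachable_trans)
    then show "0 \<le> path_weight \<Gamma> C" using True by blast
  qed
  from play_energy_finite(1)[OF v this] obtain p x where p: "play.apath ?v p x"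
    "play_energy \<Gamma> \<sigma> \<tau> ?v = enat (nat (- path_weight \<Gamma> p))" "path_weight \<Gamma> p \<le> 0" by blast
  have "\<exists>q y. play.apath u q y \<and> path_weight \<Gamma> q \<le> path_weight \<Gamma> p + weight \<Gamma> ?e"
  proof (cases "u \<in> set (pawalk_verts ?v p)")
    case False
    then have "play.apath u (?e # p) x" using p(1) e by (auto simp: play.apath_Cons_iff)
    then show ?thesis by (intro exI[of _ "?e # p"] exI[of _ x]) (auto simp: path_weight_def)
  next
    case True
    then obtain q r where qr: "p = q @ r" "play.awalk ?v q u" "play.awalk u r x"
      using play.awalk_decomp[OF play.awalkI_apath[OF p(1)]] by blast
    \<comment> \<open>The vertex list is split in two ways: without the last vertex of
      \<open>q\<close> it shows that \<open>r\<close> is simple, without the first vertex of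
      \<open>r\<close> that the vertices of \<open>q\<close> are distinct, as a cycle
      requires.\<close>
    have "pawalk_verts ?v p = butlast (pawalk_verts ?v q) @ pawalk_verts u r"
      using play.awalk_verts_append2[of ?v q r x] qr play.awalkI_apath[OF p(1)] by auto
    moreover have dp: "distinct (pawalk_verts ?v p)" using p(1) by (auto simp: play.apath_def)
    ultimately have r: "play.apath u r x" using qr by (auto simp: play.apath_def)
    have "pawalk_verts ?v p = pawalk_verts ?v q @ tl (pawalk_verts u r)"
      using play.awalk_verts_append[of ?v q r x] qr play.awalkI_apath[OF p(1)] by auto
    then have "distinct (pawalk_verts ?v q)" using dp by auto
    then have "play.cycle (?e # q)"
      unfolding play.cycle_def using qr(2) e by (intro exI[of _ u]) (auto simp: play.awalk_Cons_iff)
    then have "reachable_cycle H u (?e # q)"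
      unfolding reachable_cycle_def using u by (auto simp: pverts_H)
    then have "0 \<le> path_weight \<Gamma> (?e # q)" using \<open>no_negative_cycle u\<close> by blast
    then show ?thesis using r qr(1) by (intro exI[of _ r] exI[of _ x]) (auto simp: path_weight_def)
  qed
  then obtain q y where q: "play.apath u q y" "path_weight \<Gamma> q \<le> path_weight \<Gamma> p + weight \<Gamma> ?e" by blast
  have "enat_diff (play_energy \<Gamma> \<sigma> \<tau> ?v) (weight \<Gamma> ?e) \<le> enat (nat (- path_weight \<Gamma> q))"
    using p q by auto
  also have "\<dots> \<le> play_energy \<Gamma> \<sigma> \<tau> u" by (rule play_energy_finite(2)[OF u True q(1)])
  finally show ?thesis .
qed (simp add: play_energy_infinite)

text \<open>With both strategies fixed each node has one successor, so prefixpoints on the nodes are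
  just potentials of the play. Outside the nodes there is no successor and the operator yields 0,
  the supremum of the empty set.\<close>

lemma play_energy_eq_lfp:
  assumes s: "s \<in> nodes \<Gamma>"
  shows "play_energy \<Gamma> \<sigma> \<tau> s =
    energy_lfp (alice \<Gamma>) (weight \<Gamma>) (follow (alice \<Gamma>) \<sigma> (follow (bob \<Gamma>) \<tau> (successors \<Gamma>))) s"
proof -
  let ?X = "follow (alice \<Gamma>) \<sigma> (follow (bob \<Gamma>) \<tau> (successors \<Gamma>))"
  let ?S = "energy_step (alice \<Gamma>) (weight \<Gamma>) ?X" and ?h = "energy_lfp (alice \<Gamma>) (weight \<Gamma>) ?X"
  have X: "?X u = (if u \<in> nodes \<Gamma> then {next_node u} else {})" for u
    using nodes_eq edge_nodes by (auto simp: follow_def next_node_def)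
  have step: "?S f u = (if u \<in> nodes \<Gamma> then enat_diff (f (next_node u)) (weight \<Gamma> (u, next_node u)) else 0)"
    for f u using nodes_eq by (auto simp: energy_step_def X bot_enat_def sup.absorb1)
  show ?thesis
  proof (rule antisym)
    show "play_energy \<Gamma> \<sigma> \<tau> s \<le> ?h s"
    proof (rule play_energy_le[OF s])
      fix u assume "u \<in> nodes \<Gamma>"
      then show "enat_diff (?h (next_node u)) (weight \<Gamma> (u, next_node u)) \<le> ?h u"
        using energy_lfp_unfold[of "alice \<Gamma>" "weight \<Gamma>" ?X u] step[of ?h u] by auto
    qed
    have le: "?h \<le> (\<lambda>u. if u \<in> nodes \<Gamma> then play_energy \<Gamma> \<sigma> \<tau> u else 0)"
      using play_energy_step next_node_in
      by (intro energy_lfp_least) (auto simp: step split: if_splits)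
    show "?h s \<le> play_energy \<Gamma> \<sigma> \<tau> s" using le_funD[OF le, of s] s by (simp only: if_True)
  qed
qed

end

section \<open>Positional determinacy of the minimal energy, penalty and rounding\<close>

context weighted_game
begin

abbreviation "E \<equiv> energy_lfp (alice \<Gamma>) (weight \<Gamma>) (successors \<Gamma>)"

lemma energy_lfp_follow_alice:
  assumes "\<sigma> \<in> strategies \<Gamma> (alice \<Gamma>)" "X = successors \<Gamma> \<or> X = follow (bob \<Gamma>) \<tau> (successors \<Gamma>)"
  shows "energy_lfp (alice \<Gamma>) (weight \<Gamma>) X \<le> energy_lfp (alice \<Gamma>) (weight \<Gamma>) (follow (alice \<Gamma>) \<sigma> X)"
    (is "?L \<le> ?R")
proof (rule energy_lfp_least)
  fix u
  have "energy_step (alice \<Gamma>) (weight \<Gamma>) X ?R u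
     \<le> energy_step (alice \<Gamma>) (weight \<Gamma>) (follow (alice \<Gamma>) \<sigma> X) ?R u"
  proof (cases "u \<in> alice \<Gamma>")
    case True
    then have "\<sigma> u \<in> X u" using assms disjoint by (auto simp: strategies_def PiE_iff follow_def)
    then show ?thesis using True by (auto simp: energy_step_def follow_def intro: INF_lower)
  qed (simp add: energy_step_def follow_def)
  then show "energy_step (alice \<Gamma>) (weight \<Gamma>) X ?R u \<le> ?R u" by (simp add: energy_lfp_unfold)
qed

lemma alice_choice:
  assumes "\<And>u. u \<in> alice \<Gamma> \<Longrightarrow> \<exists>v. (u, v) \<in> edges \<Gamma> \<and> P u v"
  shows "\<exists>\<sigma> \<in> strategies \<Gamma> (alice \<Gamma>). \<forall>u \<in> alice \<Gamma>. P u (\<sigma> u)"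
proof -
  obtain s where s: "\<And>u. u \<in> alice \<Gamma> \<Longrightarrow> (u, s u) \<in> edges \<Gamma> \<and> P u (s u)" using assms by metis
  then show ?thesis
    by (intro bexI[of _ "restrict s (alice \<Gamma>)"]) (auto simp: strategies_def)
qed

lemma energy_alice:
  assumes "u \<in> alice \<Gamma>"
  shows "\<exists>v. (u, v) \<in> edges \<Gamma> \<and> enat_diff (E v) (weight \<Gamma> (u, v)) \<le> E u"
proof -
  let ?S = "(\<lambda>v. enat_diff (E v) (weight \<Gamma> (u, v))) ` successors \<Gamma> u"
  have "?S \<noteq> {}" using successor_exists assms nodes_eq by auto
  then have "Inf ?S \<in> ?S" by (meson wellorder_InfI all_not_in_conv)
  moreover have "Inf ?S = E u"
    using energy_lfp_unfold[of "alice \<Gamma>" "weight \<Gamma>" "successors \<Gamma>" u] assms by (simp add: energy_step_def)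
  ultimately show ?thesis by (metis (no_types, lifting) imageE mem_Collect_eq order_refl)
qed

lemma energy_bob:
  assumes "u \<in> bob \<Gamma>" "(u, v) \<in> edges \<Gamma>"
  shows "enat_diff (E v) (weight \<Gamma> (u, v)) \<le> E u"
proof -
  have "u \<notin> alice \<Gamma>" using assms disjoint by auto
  then have "(SUP v\<in>successors \<Gamma> u. enat_diff (E v) (weight \<Gamma> (u, v))) = E u"
    using energy_lfp_unfold[of "alice \<Gamma>" "weight \<Gamma>" "successors \<Gamma>" u] by (simp add: energy_step_def)
  then show ?thesis using assms(2) by (metis (mono_tags, lifting) SUP_upper mem_Collect_eq)
qed

text \<open>The strategy is chosen before the start node and before Alice's strategy. This order of
  quantifiers gives the lower bound on the minimum over Alice's strategies and optimality from all
  nodes at once.\<close>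

lemma bob_optimal:
  "\<exists>\<tau> \<in> strategies \<Gamma> (bob \<Gamma>). \<forall>s \<in> nodes \<Gamma>. \<forall>\<sigma> \<in> strategies \<Gamma> (alice \<Gamma>). E s \<le> play_energy \<Gamma> \<sigma> \<tau> s"
proof -
  obtain \<tau> where \<tau>: "\<tau> \<in> strategies \<Gamma> (bob \<Gamma>)"
    "E \<le> energy_lfp (alice \<Gamma>) (weight \<Gamma>) (follow (bob \<Gamma>) \<tau> (successors \<Gamma>))"
  proof -
    have ne: "u \<in> bob \<Gamma> \<Longrightarrow> successors \<Gamma> u \<noteq> {}" for u
      using successor_exists players(2) by blast
    have "bob \<Gamma> \<inter> alice \<Gamma> = {}" using disjoint by blast
    from optimal_strategy_exists[OF finite_strategies[OF players(2), unfolded strategies_def] ne this]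
    show ?thesis using that unfolding strategies_def by blast
  qed
  show ?thesis
  proof (intro bexI[OF _ \<tau>(1)] ballI)
    fix s \<sigma> assume s: "s \<in> nodes \<Gamma>" and \<sigma>: "\<sigma> \<in> strategies \<Gamma> (alice \<Gamma>)"
    interpret game_play \<Gamma> \<sigma> \<tau> using \<sigma> \<tau>(1) by unfold_locales
    show "E s \<le> play_energy \<Gamma> \<sigma> \<tau> s"
      using order_trans[OF \<tau>(2) energy_lfp_follow_alice[OF \<sigma> disjI2[OF refl]]]
      unfolding play_energy_eq_lfp[OF s] by (rule le_funD)
  qed
qed

text \<open>Alice plays at each of her nodes an edge on which \<open>f\<close> satisfies the
  inequality; then \<open>f\<close> is a potential of the play against every strategy of
  Bob.\<close>

lemma minimal_energy_le:
  assumes s: "s \<in> nodes \<Gamma>"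
    and A: "\<And>u. u \<in> alice \<Gamma> \<Longrightarrow> \<exists>v. (u, v) \<in> edges \<Gamma> \<and> enat_diff (f v) (weight \<Gamma> (u, v)) \<le> f u"
    and B: "\<And>u v. u \<in> bob \<Gamma> \<Longrightarrow> (u, v) \<in> edges \<Gamma> \<Longrightarrow> enat_diff (f v) (weight \<Gamma> (u, v)) \<le> f u"
  shows "minimal_energy \<Gamma> s \<le> f s"
proof -
  obtain \<sigma> where \<sigma>: "\<sigma> \<in> strategies \<Gamma> (alice \<Gamma>)"
    "\<And>u. u \<in> alice \<Gamma> \<Longrightarrow> enat_diff (f (\<sigma> u)) (weight \<Gamma> (u, \<sigma> u)) \<le> f u"
    using alice_choice[of "\<lambda>u v. enat_diff (f v) (weight \<Gamma> (u, v)) \<le> f u", OF A] by blast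
  have "play_energy \<Gamma> \<sigma> \<tau> s \<le> f s" if \<tau>: "\<tau> \<in> strategies \<Gamma> (bob \<Gamma>)" for \<tau>
  proof -
    interpret game_play \<Gamma> \<sigma> \<tau> using \<sigma> \<tau> by unfold_locales
    show ?thesis
    proof (rule play_energy_le[OF s])
      fix u assume "u \<in> nodes \<Gamma>"
      then show "enat_diff (f (next_node u)) (weight \<Gamma> (u, next_node u)) \<le> f u"
        using \<sigma>(2) B[of u] \<tau> nodes_eq by (auto simp: next_node_def strategies_def PiE_iff)
    qed
  qed
  then have "(MAX \<tau> \<in> strategies \<Gamma> (bob \<Gamma>). play_energy \<Gamma> \<sigma> \<tau> s) \<le> f s"
    using finite_strategies strategies_nonempty players by (subst Max_le_iff) auto
  then show ?thesis unfolding minimal_energy_def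
    using \<sigma>(1) finite_strategies players by (subst Min_le_iff) (auto intro: bexI[of _ \<sigma>])
qed

text \<open>In the definition Bob answers to Alice's strategy. From below it is enough that one
  fixed strategy of Bob already forces the fixpoint value.\<close>

lemma minimal_energy_eq:
  assumes s: "s \<in> nodes \<Gamma>"
  shows "minimal_energy \<Gamma> s = E s"
proof (rule antisym)
  show "minimal_energy \<Gamma> s \<le> E s"
    using energy_alice energy_bob by (intro minimal_energy_le[OF s])
  obtain \<tau> where \<tau>: "\<tau> \<in> strategies \<Gamma> (bob \<Gamma>)"
    "\<And>\<sigma>. \<sigma> \<in> strategies \<Gamma> (alice \<Gamma>) \<Longrightarrow> E s \<le> play_energy \<Gamma> \<sigma> \<tau> s"
    using bob_optimal s by blast
  have "E s \<le> (MAX \<tau> \<in> strategies \<Gamma> (bob \<Gamma>). play_energy \<Gamma> \<sigma> \<tau> s)" if "\<sigma> \<in> strategies \<Gamma> (alice \<Gamma>)" for \<sigma>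
    using \<tau> that finite_strategies strategies_nonempty players by (subst Max_ge_iff) auto
  then show "E s \<le> minimal_energy \<Gamma> s" unfolding minimal_energy_def
    using finite_strategies strategies_nonempty players by (subst Min_ge_iff) auto
qed

lemma optimal_for_bob_exists: "\<exists>\<tau>. \<forall>s \<in> nodes \<Gamma>. optimal_for_bob \<Gamma> s \<tau>"
  using bob_optimal unfolding optimal_for_bob_def by (auto simp: minimal_energy_eq)

lemma minimal_energy_alice:
  assumes "u \<in> alice \<Gamma>"
  shows "\<exists>v. (u, v) \<in> edges \<Gamma> \<and>
    enat_diff (minimal_energy \<Gamma> v) (weight \<Gamma> (u, v)) \<le> minimal_energy \<Gamma> u"
  using energy_alice[OF assms] edge_nodes by (metis minimal_energy_eq)

lemma minimal_energy_bob:
  assumes "u \<in> bob \<Gamma>" "(u, v) \<in> edges \<Gamma>"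
  shows "enat_diff (minimal_energy \<Gamma> v) (weight \<Gamma> (u, v)) \<le> minimal_energy \<Gamma> u"
  using energy_bob[OF assms] edge_nodes[OF assms(2)] by (simp add: minimal_energy_eq)

text \<open>A negative integer weight is at most \<open>- 1\<close> and a cycle has at most
  \<open>n\<close> edges, so every negative cycle has mean at most \<open>- 1 / n\<close>. The
  existence of an optimal strategy of Bob keeps the supremum from ranging over the empty set.
  Positivity makes the ceiling of a finite penalty at least 1.\<close>

lemma penalty_pos: "0 < penalty \<Gamma>"
proof -
  let ?n = "card (nodes \<Gamma>)"
  have n: "0 < ?n" using finite_nodes nodes_nonempty by (simp add: card_gt_0_iff)
  obtain \<tau> where \<tau>: "\<And>s. s \<in> nodes \<Gamma> \<Longrightarrow> optimal_for_bob \<Gamma> s \<tau>" using optimal_for_bob_exists by blast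
  have "ereal (1 / ?n) \<le> node_penalty \<Gamma> s" if s: "s \<in> nodes \<Gamma>" for s
  proof -
    have "penalty_at_least \<Gamma> s (1 / ?n)"
      unfolding penalty_at_least_def
    proof (intro exI[of _ \<tau>] conjI ballI allI impI)
      show "optimal_for_bob \<Gamma> s \<tau>" using \<tau> s by blast
      fix \<sigma> C assume *: "\<sigma> \<in> strategies \<Gamma> (alice \<Gamma>)" "reachable_cycle (play_graph \<Gamma> \<sigma> \<tau>) s C"
        "path_weight \<Gamma> C < 0"
      interpret game_play \<Gamma> \<sigma> \<tau>
        using * \<tau>[OF s] by unfold_locales (auto simp: optimal_for_bob_def)
      obtain u where u: "play.awalk u C u" "distinct (tl (pawalk_verts u C))" "C \<noteq> []"
        using *(2) unfolding reachable_cycle_def play.cycle_def by auto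
      \<comment> \<open>The vertex list of a cycle contains its start node at both ends; its tail is
        distinct and as long as the list of edges.\<close>
      have "set (pawalk_verts u C) \<subseteq> nodes \<Gamma>"
        using u(1) unfolding play.awalk_conv pverts_H by blast
      then have "set (tl (pawalk_verts u C)) \<subseteq> nodes \<Gamma>"
        by (cases "pawalk_verts u C") auto
      then have "card (set (tl (pawalk_verts u C))) \<le> ?n" by (rule card_mono[OF finite_nodes])
      moreover have "length (tl (pawalk_verts u C)) = length C"
        using play.length_awalk_verts[of u C] by simp
      ultimately have "length C \<le> ?n" using distinct_card[OF u(2)] by simp
      moreover have "path_weight \<Gamma> C * int ?n \<le> -1 * int ?n"
        using *(3) by (intro mult_right_mono) auto
      ultimately have "path_weight \<Gamma> C * int ?n \<le> - int (length C)" by linarith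
      then have "real_of_int (path_weight \<Gamma> C * int ?n) \<le> real_of_int (- int (length C))"
        unfolding of_int_le_iff .
      then show "real_of_int (path_weight \<Gamma> C) / real (length C) \<le> - (1 / ?n)"
        using u(3) n by (simp add: field_simps)
    qed
    then show ?thesis unfolding node_penalty_def by (intro Sup_upper) (auto intro!: exI[of _ "1 / real ?n"])
  qed
  then have "ereal (1 / ?n) \<le> penalty \<Gamma>"
    unfolding penalty_def using finite_nodes nodes_nonempty by (subst Min_ge_iff) auto
  moreover have "(0::ereal) < ereal (1 / ?n)" using n by simp
  ultimately show ?thesis by (rule order.strict_trans2[rotated])
qed

text \<open>Rounding weights up to multiples of \<open>b\<close> loses less than \<open>b\<close> per edge. If \<open>b\<close> is below the
  penalty, then no negative cycle that Bob can force becomes nonnegative by the rounding.\<close>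

lemma rounded_energy_bound:
  fixes b :: int
  assumes s: "s \<in> nodes \<Gamma>" and b: "0 < b" "ereal (real_of_int b) < penalty \<Gamma>"
    and A: "\<And>u. u \<in> alice \<Gamma> \<Longrightarrow> \<exists>v. (u, v) \<in> edges \<Gamma> \<and> enat_diff (f v) (w' (u, v)) \<le> f u"
    and B: "\<And>u v. u \<in> bob \<Gamma> \<Longrightarrow> (u, v) \<in> edges \<Gamma> \<Longrightarrow> enat_diff (f v) (w' (u, v)) \<le> f u"
    and w': "\<And>e. b * w' e < weight \<Gamma> e + b"
    and k: "f s = enat k"
  shows "\<exists>l. minimal_energy \<Gamma> s = enat l \<and> int l \<le> b * (int k + int (card (nodes \<Gamma>)))"
proof -
  let ?n = "card (nodes \<Gamma>)"
  \<comment> \<open>Alice follows the rounded potential, while Bob will follow a witness of the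
    penalty; everything below concerns the play of these two.\<close>
  obtain \<sigma> where \<sigma>: "\<sigma> \<in> strategies \<Gamma> (alice \<Gamma>)"
    "\<And>u. u \<in> alice \<Gamma> \<Longrightarrow> enat_diff (f (\<sigma> u)) (w' (u, \<sigma> u)) \<le> f u"
    using alice_choice[of "\<lambda>u v. enat_diff (f v) (w' (u, v)) \<le> f u", OF A] by blast
  have "penalty \<Gamma> \<le> node_penalty \<Gamma> s"
    unfolding penalty_def using s finite_nodes by auto
  then have "ereal (real_of_int b) < node_penalty \<Gamma> s" using b(2) by auto
  \<comment> \<open>The penalty is a supremum, so the strict inequality is what yields a witnessed
    \<open>D\<close> above \<open>b\<close>.\<close>
  then obtain D where D: "real_of_int b < D" "penalty_at_least \<Gamma> s D"
    unfolding node_penalty_def less_Sup_iff by auto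
  then obtain \<tau> where \<tau>: "optimal_for_bob \<Gamma> s \<tau>"
    "\<And>C. reachable_cycle (play_graph \<Gamma> \<sigma> \<tau>) s C \<Longrightarrow> path_weight \<Gamma> C < 0 \<Longrightarrow>
       real_of_int (path_weight \<Gamma> C) / real (length C) \<le> - D"
    using \<sigma>(1) unfolding penalty_at_least_def by blast
  interpret game_play \<Gamma> \<sigma> \<tau>
    using \<sigma> \<tau> by unfold_locales (auto simp: optimal_for_bob_def)
  have pot: "enat_diff (f (next_node u)) (w' (u, next_node u)) \<le> f u" if "u \<in> nodes \<Gamma>" for u
    using that \<sigma>(2) B[of u] \<tau> nodes_eq
    by (auto simp: next_node_def strategies_def PiE_iff optimal_for_bob_def)
  have sum: "b * sum_list (map w' p) \<le> path_weight \<Gamma> p + b * int (length p)" for p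
  proof (induction p)
    case (Cons e p)
    then show ?case using w'[of e] by (simp add: path_weight_def algebra_simps)
  qed (simp add: path_weight_def)
  have "no_negative_cycle s"
  proof (rule allI, rule impI, rule ccontr)
    fix C assume C: "reachable_cycle H s C" and neg: "\<not> 0 \<le> path_weight \<Gamma> C"
    obtain u q where u: "play.awalk s q u" "play.awalk u C u"
      using reachable_cycle_awalk[OF C] by blast
    from potential_awalk[OF pot u(1) k] obtain c where c: "f u = enat c" by auto
    from potential_awalk[OF pot u(2) c] c have "0 \<le> sum_list (map w' C)" by auto
    then have "0 \<le> b * sum_list (map w' C)" using b(1) by simp
    then have "0 \<le> path_weight \<Gamma> C + b * int (length C)" using sum[of C] by linarith
    then have "real_of_int 0 \<le> real_of_int (path_weight \<Gamma> C + b * int (length C))"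
      unfolding of_int_le_iff .
    then have 1: "- (real_of_int b * real (length C)) \<le> real_of_int (path_weight \<Gamma> C)" by simp
    have len: "0 < length C" using C by (auto simp: reachable_cycle_def play.cycle_def)
    then have "real_of_int (path_weight \<Gamma> C) \<le> - D * real (length C)"
      using \<tau>(2)[OF C] neg by (simp add: field_simps)
    with 1 have "D * real (length C) \<le> real_of_int b * real (length C)" by simp
    with len D(1) show False by simp
  qed
  from play_energy_finite(1)[OF s this] obtain p v where p: "play.apath s p v"
    "play_energy \<Gamma> \<sigma> \<tau> s = enat (nat (- path_weight \<Gamma> p))" by blast
  have "- sum_list (map w' p) \<le> int k"
    using potential_awalk[OF pot play.awalkI_apath[OF p(1)] k] by auto
  then have "b * (- sum_list (map w' p)) \<le> b * int k" using b(1) by (intro mult_left_mono) auto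
  moreover have "length p \<le> ?n"
  proof -
    have "length (pawalk_verts s p) = card (set (pawalk_verts s p))"
      using p(1) by (simp add: play.apath_def distinct_card)
    also have "\<dots> \<le> ?n"
      using p(1) pverts_H by (intro card_mono finite_nodes) (auto simp: play.apath_def elim: play.awalkE')
    finally show ?thesis using play.length_awalk_verts[of s p] by simp
  qed
  then have "b * int (length p) \<le> b * int ?n" using b(1) by simp
  ultimately have "- path_weight \<Gamma> p \<le> b * (int k + int ?n)"
    using sum[of p] by (simp add: algebra_simps)
  moreover have "0 \<le> b * (int k + int ?n)" using b(1) by simp
  \<comment> \<open>Optimality of Bob's strategy turns the bound on this one play into a bound on
    the minimal energy.\<close>
  moreover have "minimal_energy \<Gamma> s \<le> play_energy \<Gamma> \<sigma> \<tau> s"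
    using \<tau>(1) \<sigma>(1) unfolding optimal_for_bob_def by blast
  ultimately show ?thesis
    using p(2) by (cases "minimal_energy \<Gamma> s") auto
qed

end

section \<open>Reasoning about runs\<close>

text \<open>Total correctness with the exact number of steps visible in the postcondition. The rules
  for loop-free commands are equivalences, so simplification computes weakest preconditions,
  including the conditions that no word overflows.\<close>

definition exec :: "int \<Rightarrow> com \<Rightarrow> state \<Rightarrow> (nat \<Rightarrow> state \<Rightarrow> bool) \<Rightarrow> bool" where
  "exec B c s Q \<longleftrightarrow> (\<exists>t s'. run B c s t s' \<and> Q t s')"

lemma exec_Skip: "exec B Skip s Q \<longleftrightarrow> Q 1 s"
  by (auto simp: exec_def elim: run_SkipE intro: run_Skip[simplified])

lemma exec_Assign:
  "exec B (Assign x a) s Q \<longleftrightarrow> \<bar>aval a s\<bar> \<le> B \<and> Q 1 (set_var x (aval a s) s)"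
  by (auto simp: exec_def elim: run_AssignE intro: run_Assign[simplified])

lemma exec_Write:
  "exec B (Write A i a) s Q \<longleftrightarrow>
     0 \<le> aval i s \<and> aval i s \<le> B \<and> \<bar>aval a s\<bar> \<le> B \<and> Q 1 (set_array A (aval i s) (aval a s) s)"
  by (auto simp: exec_def elim: run_WriteE intro: run_Write[simplified])

lemma exec_Seq:
  "exec B (Seq c d) s Q \<longleftrightarrow> exec B c s (\<lambda>t s'. exec B d s' (\<lambda>t'. Q (t + t')))"
  unfolding exec_def by (blast elim: run_SeqE intro: run_Seq)

lemma exec_Cond:
  "exec B (Cond b c d) s Q \<longleftrightarrow>
     (if bval b s then exec B c s (\<lambda>t. Q (Suc t)) else exec B d s (\<lambda>t. Q (Suc t)))"
  unfolding exec_def by (auto elim!: run_CondE intro: run_Cond_True run_Cond_False)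

lemma exec_mono: "exec B c s Q \<Longrightarrow> (\<And>t s'. Q t s' \<Longrightarrow> R t s') \<Longrightarrow> exec B c s R"
  unfolding exec_def by blast

text \<open>The index of the invariant is a budget that pays for the remaining running time, so that
  the rule proves termination as well.\<close>

lemma exec_Loop:
  assumes body: "\<And>k s. I k s \<Longrightarrow> bval b s \<Longrightarrow> exec B c s (\<lambda>t s'. \<exists>k'. I k' s' \<and> k' + t + 1 \<le> k)"
    and "I k s"
  shows "exec B (Loop b c) s (\<lambda>t s'. \<exists>k'. I k' s' \<and> \<not> bval b s' \<and> t + k' \<le> k + 1)"
  using assms(2)
proof (induction k arbitrary: s rule: less_induct)
  case (less k)
  show ?case
  proof (cases "bval b s")
    case True
    obtain t s' k' where 1: "run B c s t s'" "I k' s'" "k' + t + 1 \<le> k"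
      using body[OF less.prems True] unfolding exec_def by blast
    then obtain t' s'' k'' where "run B (Loop b c) s' t' s''" "I k'' s''" "\<not> bval b s''" "t' + k'' \<le> k' + 1"
      using less.IH[of k' s'] unfolding exec_def by auto
    with 1 True show ?thesis
      unfolding exec_def
      by (intro exI[of _ "Suc (t + t')"] exI[of _ s'']) (auto intro!: run_Loop_True exI[of _ k''])
  next
    case False
    then show ?thesis unfolding exec_def using less.prems
      by (intro exI[of _ 1] exI[of _ s]) (auto intro!: run_Loop_False[simplified] exI[of _ k])
  qed
qed

definition frame :: "vname set \<Rightarrow> vname set \<Rightarrow> state \<Rightarrow> state \<Rightarrow> bool" where
  "frame X Y s s' \<longleftrightarrow>
     (\<forall>x. x \<notin> X \<longrightarrow> vars s' x = vars s x) \<and> (\<forall>A. A \<notin> Y \<longrightarrow> arrays s' A = arrays s A)"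

lemma frame_var: "frame X Y s s' \<Longrightarrow> x \<notin> X \<Longrightarrow> vars s' x = vars s x"
  and frame_array: "frame X Y s s' \<Longrightarrow> A \<notin> Y \<Longrightarrow> arrays s' A = arrays s A"
  by (auto simp: frame_def)

lemma frame_refl: "frame X Y s s"
  by (simp add: frame_def)

lemma frame_trans: "frame X Y s s' \<Longrightarrow> frame X Y s' s'' \<Longrightarrow> frame X Y s s''"
  by (simp add: frame_def)

lemma frame_mono: "frame X Y s s' \<Longrightarrow> X \<subseteq> X' \<Longrightarrow> Y \<subseteq> Y' \<Longrightarrow> frame X' Y' s s'"
  by (auto simp: frame_def)

lemma frame_set_var: "frame X Y s (set_var x v s') \<longleftrightarrow> frame X Y s s'" if "x \<in> X"
  using that by (auto simp: frame_def set_var_def)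

lemma frame_set_array: "frame X Y s (set_array A i v s') \<longleftrightarrow> frame X Y s s'" if "A \<in> Y"
  using that by (auto simp: frame_def set_array_def)

lemma state_simps:
  "vars (set_var x v s) y = (if y = x then v else vars s y)"
  "arrays (set_var x v s) = arrays s"
  "vars (set_array A i v s) = vars s"
  "arrays (set_array A i v s) A' j = (if A' = A \<and> j = i then v else arrays s A' j)"
  by (auto simp: set_var_def set_array_def)

section \<open>Value iteration with rounded weights\<close>

lemma energy_upper_boundD:
  "energy_upper_bound \<Gamma> M \<Longrightarrow> v \<in> nodes \<Gamma> \<Longrightarrow> minimal_energy \<Gamma> v = enat k \<Longrightarrow> int k \<le> M"
  by (auto simp: energy_upper_bound_def)

text \<open>\<open>- (- x div b)\<close> is the ceiling of x/b, written with the floor division that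
  the machine offers.\<close>

lemma ceil_div_bounds:
  fixes x b :: int
  assumes "0 < b"
  shows "x \<le> b * - (- x div b)" "b * - (- x div b) < x + b"
proof -
  have "b * (- x div b) + (- x) mod b = - x" by simp
  moreover have "0 \<le> (- x) mod b" "(- x) mod b < b" using assms by auto
  ultimately show "x \<le> b * - (- x div b)" "b * - (- x div b) < x + b" by linarith+
qed

lemma le_div_iff_mult_le:
  fixes x y b :: int
  assumes "0 < b"
  shows "x \<le> y div b \<longleftrightarrow> b * x \<le> y"
proof
  assume "x \<le> y div b"
  then have "b * x \<le> b * (y div b)" using assms by simp
  also have "\<dots> \<le> y" using minus_mod_eq_mult_div[of y b, symmetric] pos_mod_sign[OF assms, of y] by linarith
  finally show "b * x \<le> y" .
next
  assume "b * x \<le> y"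
  then show "x \<le> y div b" using zdiv_mono1[of "b * x" y b] assms by simp
qed

section \<open>Lower bounds on the energies in units of the rounding parameter\<close>

locale energy_instance = weighted_game \<Gamma> for \<Gamma> :: "nat game" +
  fixes es :: "(nat \<times> nat) list" and M :: int
  assumes presents: "presents es \<Gamma>" and upper_bound: "energy_upper_bound \<Gamma> M"
begin

abbreviation "n \<equiv> card (nodes \<Gamma>)"
abbreviation "m \<equiv> length es"
abbreviation "N \<equiv> max 0 M"
abbreviation "src e \<equiv> fst (es ! e)"
abbreviation "tgt e \<equiv> snd (es ! e)"

text \<open>Outgoing edges are included besides incoming ones: raising \<open>u\<close> may create
  violations on edges into \<open>u\<close> and may remove them on edges out of \<open>u\<close>. A
  loop is listed once.\<close>

definition incident :: "nat \<Rightarrow> nat list" where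
  "incident u = filter (\<lambda>e. src e = u \<or> tgt e = u) [0..<m]"

definition deg :: "nat \<Rightarrow> nat" where
  "deg u = length (incident u)"

definition rounded :: "int \<Rightarrow> nat \<Rightarrow> int" where
  "rounded b e = - (- weight \<Gamma> (es ! e) div b)"

definition violated :: "int \<Rightarrow> (nat \<Rightarrow> int) \<Rightarrow> nat \<Rightarrow> bool" where
  "violated b F e \<longleftrightarrow> 0 \<le> F (src e) \<and> (F (tgt e) < 0 \<or> F (src e) + rounded b e < F (tgt e))"

lemma nodes_less: "u \<in> nodes \<Gamma> \<longleftrightarrow> u < n"
  using presents by (auto simp: presents_def)

lemma edge_index: "e < m \<Longrightarrow> (src e, tgt e) \<in> edges \<Gamma>"
  using presents nth_mem[of e es] by (simp add: presents_def)

lemma edge_index_ex: "(u, v) \<in> edges \<Gamma> \<Longrightarrow> \<exists>e<m. es ! e = (u, v)"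
  using presents by (auto simp: presents_def in_set_conv_nth)

lemma src_less: "e < m \<Longrightarrow> src e < n" and tgt_less: "e < m \<Longrightarrow> tgt e < n"
  using edge_index edge_nodes nodes_less by blast+

lemma n_pos: "0 < n"
  using finite_nodes nodes_nonempty by (simp add: card_gt_0_iff)

lemma out_edge_ex: "u < n \<Longrightarrow> \<exists>e<m. src e = u"
  using successor_exists edge_index_ex nodes_less by (metis fst_conv)

lemma m_pos: "0 < m"
  using out_edge_ex[OF n_pos] by (auto intro: le_less_trans)

lemma set_incident: "set (incident u) = {e. e < m \<and> (src e = u \<or> tgt e = u)}"
  by (auto simp: incident_def)

lemma incident_nth: "i < deg u \<Longrightarrow> incident u ! i < m"
  using nth_mem[of i "incident u"] by (simp add: deg_def set_incident del: nth_mem)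

lemma deg_le: "deg u \<le> m"
  unfolding deg_def incident_def by (rule order_trans[OF length_filter_le]) simp

text \<open>Double counting: an edge lies in the lists of its two endpoints. It is only an
  inequality because a loop is listed once.\<close>

lemma sum_deg_le: "(\<Sum>u<n. deg u) \<le> 2 * m"
proof -
  have d: "distinct (incident u)" for u by (simp add: incident_def)
  have "deg u \<le> (\<Sum>e<m. of_bool (src e = u) + of_bool (tgt e = u))" for u
  proof -
    have "deg u = card {e. e < m \<and> (src e = u \<or> tgt e = u)}"
      unfolding deg_def using distinct_card[OF d] set_incident by metis
    also have "\<dots> = (\<Sum>e | e < m \<and> (src e = u \<or> tgt e = u). 1)" by simp
    also have "\<dots> = (\<Sum>e<m. of_bool (src e = u \<or> tgt e = u))"
      by (intro sum.mono_neutral_cong_left) auto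
    also have "\<dots> \<le> (\<Sum>e<m. of_bool (src e = u) + of_bool (tgt e = u))"
      by (intro sum_mono) auto
    finally show ?thesis .
  qed
  then have "(\<Sum>u<n. deg u) \<le> (\<Sum>u<n. \<Sum>e<m. of_bool (src e = u) + of_bool (tgt e = u))"
    by (intro sum_mono)
  also have "\<dots> = (\<Sum>e<m. \<Sum>u<n. of_bool (src e = u) + of_bool (tgt e = u))" by (rule sum.swap)
  also have "\<dots> = (\<Sum>e<m. 2)"
    using src_less tgt_less by (intro sum.cong refl) (auto simp: sum.distrib of_bool_def)
  finally show ?thesis by simp
qed

text \<open>\<open>F u = - 1\<close> stands for \<open>\<infinity>\<close>, and the values of \<open>F\<close> are in units of \<open>b\<close>.\<close>

definition lower :: "int \<Rightarrow> (nat \<Rightarrow> int) \<Rightarrow> bool" where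
  "lower b F \<longleftrightarrow> (\<forall>u<n. - 1 \<le> F u \<and> F u \<le> N div b \<and>
     (\<forall>k. minimal_energy \<Gamma> u = enat k \<longrightarrow> 0 \<le> F u \<and> b * F u \<le> int k))"

lemma lowerD:
  assumes "lower b F" "u < n"
  shows "- 1 \<le> F u" "F u \<le> N div b"
    "minimal_energy \<Gamma> u = enat k \<Longrightarrow> 0 \<le> F u" "minimal_energy \<Gamma> u = enat k \<Longrightarrow> b * F u \<le> int k"
  using assms by (auto simp: lower_def)

text \<open>The true energies satisfy the edge inequality on some edge of Alice's node and on all
  edges of Bob's node, so in either case on a violated one. There the target needs at least
  \<open>b * F (tgt e)\<close>, and rounding up has not made the edge lighter. As values are
  integers, a violation means a gap of at least 1.\<close>

lemma raise_sound:
  assumes b: "0 < b" and low: "lower b F" and u: "u < n"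
    and ex: "u \<in> alice \<Gamma> \<and> (\<forall>e<m. src e = u \<longrightarrow> violated b F e) \<or>
             u \<in> bob \<Gamma> \<and> (\<exists>e<m. src e = u \<and> violated b F e)"
    and k: "minimal_energy \<Gamma> u = enat k"
  shows "b * (F u + 1) \<le> int k"
proof -
  have "\<exists>e<m. src e = u \<and> violated b F e \<and>
      enat_diff (minimal_energy \<Gamma> (tgt e)) (weight \<Gamma> (es ! e)) \<le> minimal_energy \<Gamma> u"
    using ex
  proof
    assume a: "u \<in> alice \<Gamma> \<and> (\<forall>e<m. src e = u \<longrightarrow> violated b F e)"
    then obtain v where v: "(u, v) \<in> edges \<Gamma>"
      "enat_diff (minimal_energy \<Gamma> v) (weight \<Gamma> (u, v)) \<le> minimal_energy \<Gamma> u"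
      using minimal_energy_alice by blast
    then obtain e where "e < m" "es ! e = (u, v)" using edge_index_ex by blast
    then show ?thesis using v a by (intro exI[of _ e]) auto
  next
    assume "u \<in> bob \<Gamma> \<and> (\<exists>e<m. src e = u \<and> violated b F e)"
    then obtain e where e: "e < m" "src e = u" "violated b F e" "u \<in> bob \<Gamma>" by blast
    then show ?thesis using minimal_energy_bob[of u "tgt e"] edge_index[of e]
      by (metis prod.collapse)
  qed
  then obtain e where e: "e < m" "src e = u" "violated b F e"
    "enat_diff (minimal_energy \<Gamma> (tgt e)) (weight \<Gamma> (es ! e)) \<le> enat k" unfolding k by blast
  then obtain l where l: "minimal_energy \<Gamma> (tgt e) = enat l" "int l \<le> int k + weight \<Gamma> (es ! e)"
    by (auto simp: enat_diff_le_iff)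
  \<comment> \<open>Finite energy at the target rules out the value \<open>- 1\<close> there, so the
    violation is the arithmetic one.\<close>
  have F: "0 \<le> F (tgt e)" "b * F (tgt e) \<le> int l" using lowerD(3,4)[OF low tgt_less l(1)] e(1) by auto
  then have "F u + rounded b e + 1 \<le> F (tgt e)" using e by (auto simp: violated_def)
  then have "b * (F u + rounded b e + 1) \<le> b * F (tgt e)" using b by (intro mult_left_mono) auto
  moreover have "weight \<Gamma> (es ! e) \<le> b * rounded b e"
    unfolding rounded_def by (rule ceil_div_bounds(1)[OF b])
  ultimately show ?thesis using F l by (simp add: algebra_simps)
qed

text \<open>Finite energies are at most \<open>N\<close>, so a node that has to exceed
  \<open>N div b\<close> has infinite energy and receives the code \<open>- 1\<close>.\<close>

definition raised :: "int \<Rightarrow> int \<Rightarrow> int" where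
  "raised b x = (if x < N div b then x + 1 else - 1)"

lemma lower_raise:
  assumes b: "0 < b" and low: "lower b F" and u: "u < n" "0 \<le> F u"
    and ex: "u \<in> alice \<Gamma> \<and> (\<forall>e<m. src e = u \<longrightarrow> violated b F e) \<or>
             u \<in> bob \<Gamma> \<and> (\<exists>e<m. src e = u \<and> violated b F e)"
  shows "lower b (F(u := raised b (F u)))"
proof -
  have "0 \<le> raised b (F u) \<and> b * raised b (F u) \<le> int k" if k: "minimal_energy \<Gamma> u = enat k" for k
  proof -
    have 1: "b * (F u + 1) \<le> int k" by (rule raise_sound[OF b low u(1) ex k])
    moreover have "int k \<le> N"
      using energy_upper_boundD[OF upper_bound _ k] u(1) nodes_less by fastforce
    ultimately have "b * (F u + 1) \<le> N" by linarith
    then have "(F u + 1) \<le> N div b" using b by (simp add: le_div_iff_mult_le)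
    then show ?thesis using 1 u(2) by (simp add: raised_def)
  qed
  moreover have "- 1 \<le> raised b (F u) \<and> raised b (F u) \<le> N div b"
    using u(2) b by (simp add: raised_def pos_imp_zdiv_nonneg_iff order_trans[of "-1" 0])
  ultimately show ?thesis using low by (auto simp: lower_def)
qed

definition fixpoint :: "int \<Rightarrow> (nat \<Rightarrow> int) \<Rightarrow> bool" where
  "fixpoint b F \<longleftrightarrow> (\<forall>u<n. (u \<in> alice \<Gamma> \<longrightarrow> (\<exists>e<m. src e = u \<and> \<not> violated b F e)) \<and>
     (u \<in> bob \<Gamma> \<longrightarrow> (\<forall>e<m. src e = u \<longrightarrow> \<not> violated b F e)))"

definition to_enat :: "int \<Rightarrow> enat" where
  "to_enat x = (if x < 0 then \<infinity> else enat (nat x))"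

text \<open>Carries integer values over to the potentials of the abstract game. The weights
  \<open>w\<close> are constrained only on the edges because the lemma is used with the original
  weights for \<open>b = 1\<close> and with rounded weights for
  \<open>rounded_energy_bound\<close>.\<close>

lemma fixpoint_potential:
  assumes "fixpoint b F" and w: "\<And>e. e < m \<Longrightarrow> w (es ! e) = rounded b e"
  shows "u \<in> alice \<Gamma> \<Longrightarrow> \<exists>v. (u, v) \<in> edges \<Gamma> \<and> enat_diff (to_enat (F v)) (w (u, v)) \<le> to_enat (F u)"
    and "u \<in> bob \<Gamma> \<Longrightarrow> (u, v) \<in> edges \<Gamma> \<Longrightarrow> enat_diff (to_enat (F v)) (w (u, v)) \<le> to_enat (F u)"
proof -
  have ok: "enat_diff (to_enat (F (tgt e))) (w (es ! e)) \<le> to_enat (F (src e))"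
    if "e < m" "\<not> violated b F e" for e
    using that by (auto simp: violated_def to_enat_def w)
  show "\<exists>v. (u, v) \<in> edges \<Gamma> \<and> enat_diff (to_enat (F v)) (w (u, v)) \<le> to_enat (F u)" if a: "u \<in> alice \<Gamma>"
  proof -
    have "u < n" using that players nodes_less by blast
    then obtain e where e: "e < m" "src e = u" "\<not> violated b F e"
      using assms(1) a by (auto simp: fixpoint_def)
    then show ?thesis using ok[OF e(1,3)] edge_index[OF e(1)]
      by (intro exI[of _ "tgt e"]) (auto simp: prod.collapse)
  qed
  show "enat_diff (to_enat (F v)) (w (u, v)) \<le> to_enat (F u)" if uv: "u \<in> bob \<Gamma>" "(u, v) \<in> edges \<Gamma>"
  proof -
    have "u < n" using uv players nodes_less by blast
    moreover obtain e where e: "e < m" "es ! e = (u, v)" using edge_index_ex[OF uv(2)] by blast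
    ultimately have "\<not> violated b F e" using assms(1) uv by (auto simp: fixpoint_def)
    then show ?thesis using ok[OF e(1)] e(2) by simp
  qed
qed

text \<open>Rounding to multiples of 1 changes no weight, so the values are at once a potential,
  hence an upper bound, and a lower bound.\<close>

lemma fixpoint_exact:
  assumes "fixpoint 1 F" "lower 1 F" "u < n"
  shows "F u = encode_energy (minimal_energy \<Gamma> u)"
proof -
  have w: "weight \<Gamma> (es ! e) = rounded 1 e" for e by (simp add: rounded_def)
  have le: "minimal_energy \<Gamma> u \<le> to_enat (F u)"
    by (rule minimal_energy_le[OF _ fixpoint_potential[OF assms(1) w]]) (simp_all add: nodes_less assms)
  show ?thesis
  proof (cases "minimal_energy \<Gamma> u")
    case (enat k)
    then have "0 \<le> F u" "F u \<le> int k" using lowerD(3,4)[OF assms(2,3) enat] by auto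
    then show ?thesis using le enat by (auto simp: to_enat_def encode_energy_def)
  next
    case infinity
    then show ?thesis using le lowerD(1)[OF assms(2,3)]
      by (auto simp: to_enat_def encode_energy_def split: if_splits)
  qed
qed

text \<open>The guess 1 counts as good for every penalty: its attempt consists of the first phase
  alone, whose bound on the raises comes from \<open>N\<close>. Thus the search for a guess always
  ends.\<close>

definition good :: "int \<Rightarrow> bool" where
  "good g \<longleftrightarrow> g = 1 \<or> ereal (real_of_int g) < penalty \<Gamma>"

text \<open>The last clause says that, for a good guess \<open>g\<close>, no node is raised more than \<open>l\<close> times in the
  phase that starts from \<open>F\<close>; its second disjunct covers the first phase, where even infinite
  nodes are reached after \<open>N div b + 1\<close> raises.\<close>

definition ready :: "int \<Rightarrow> int \<Rightarrow> (nat \<Rightarrow> int) \<Rightarrow> int \<Rightarrow> bool" where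
  "ready g b F l \<longleftrightarrow> 0 < b \<and> 0 \<le> l \<and> lower b F \<and> (good g \<longrightarrow>
     (\<forall>u<n. F u < 0 \<or> N div b + 1 \<le> F u + l \<or>
        (\<exists>k. minimal_energy \<Gamma> u = enat k \<and> int k \<le> b * (F u + l))))"

lemma ready_initial:
  assumes "0 < g" shows "ready g g (\<lambda>_. 0) (N div g + 1)"
  using assms by (auto simp: ready_def lower_def pos_imp_zdiv_nonneg_iff)

text \<open>In the unit \<open>2 * b\<close> the energy of a node with finite value is at most
  \<open>2 * b * (F u + n)\<close>, which is \<open>b * (2 * F u + 2 * n)\<close>; this is the
  origin of \<open>2 * n\<close>. In particular, for a good guess every infinite node already
  carries \<open>- 1\<close>.\<close>

lemma ready_next:
  assumes b: "0 < b" and g: "2 * b \<le> g" and low: "lower (2 * b) F" and fp: "fixpoint (2 * b) F"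
    and F': "\<And>u. u < n \<Longrightarrow> F' u = (if 0 < F u then 2 * F u else F u)"
  shows "ready g b F' (2 * int n)"
proof -
  have half: "2 * (N div (2 * b)) \<le> N div b"
  proof -
    have "b * (2 * (N div (2 * b))) \<le> N"
      using b le_div_iff_mult_le[of "2 * b" "N div (2 * b)" N] by (simp add: mult.assoc mult.left_commute)
    then show ?thesis using b by (simp add: le_div_iff_mult_le)
  qed
  have "lower b F'"
    unfolding lower_def
  proof (intro allI impI conjI)
    fix u assume u: "u < n"
    note l = lowerD[OF low u]
    show "- 1 \<le> F' u" using l(1) F'[OF u] by auto
    have "0 \<le> N div b" using b by (simp add: pos_imp_zdiv_nonneg_iff)
    then show "F' u \<le> N div b" using l(2) F'[OF u] half by auto
    fix k assume k: "minimal_energy \<Gamma> u = enat k"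
    show "0 \<le> F' u" "b * F' u \<le> int k" using l(3,4)[OF k] F'[OF u] by (auto simp: algebra_simps)
  qed
  moreover have "F' u < 0 \<or> (\<exists>k. minimal_energy \<Gamma> u = enat k \<and> int k \<le> b * (F' u + 2 * int n))"
    if "good g" and u: "u < n" for u
  proof (cases "F u < 0")
    case False
    \<comment> \<open>Since \<open>2 * b\<close> is at least 2, the guess is not 1, and a good guess
      lies strictly below the penalty.\<close>
    have "2 * b < g \<or> 2 * b = g" using g by auto
    then have P: "ereal (real_of_int (2 * b)) < penalty \<Gamma>"
      using \<open>good g\<close> g b unfolding good_def
      by (smt (verit, ccfv_SIG) ereal_less_eq(3) le_less_trans of_int_le_iff)
    let ?w = "\<lambda>x. - (- weight \<Gamma> x div (2 * b))"
    have w: "?w (es ! e) = rounded (2 * b) e" for e by (simp add: rounded_def)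
    have "\<exists>l. minimal_energy \<Gamma> u = enat l \<and> int l \<le> 2 * b * (int (nat (F u)) + int n)"
    proof (rule rounded_energy_bound[OF _ _ P fixpoint_potential[OF fp w]])
      show "2 * b * ?w e < weight \<Gamma> e + 2 * b" for e using ceil_div_bounds(2)[of "2 * b"] b by auto
    qed (use b u False in \<open>auto simp: nodes_less to_enat_def\<close>)
    then show ?thesis using False F'[OF u] by (auto simp: algebra_simps)
  qed (use F'[OF u] in auto)
  ultimately show ?thesis using b by (auto simp: ready_def)
qed

section \<open>The queue of edges that may be violated\<close>

definition height :: "int \<Rightarrow> int \<Rightarrow> int" where
  "height b x = (if x < 0 then N div b + 1 else x)"

text \<open>The queue \<open>Q\<close> holds edges at the positions \<open>h, \<dots>, t - 1\<close> and never reuses a position, so \<open>t\<close>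
  counts all insertions: each raise of \<open>u\<close> inserts \<open>deg u\<close> edges. An edge is \<open>bad\<close> if it was found
  violated for the present value at its source, a node of Alice, and \<open>cnt\<close> counts the outgoing
  edges that are not bad. Alice's node is raised when this count reaches \<open>0\<close>.\<close>

definition worklist ::
    "int \<Rightarrow> (nat \<Rightarrow> int) \<Rightarrow> (nat \<Rightarrow> int) \<Rightarrow> (nat \<Rightarrow> int) \<Rightarrow> (nat \<Rightarrow> int) \<Rightarrow> (nat \<Rightarrow> int) \<Rightarrow> nat \<Rightarrow> nat \<Rightarrow> bool" where
  "worklist b F0 F bad cnt Q h t \<longleftrightarrow> lower b F \<and>
     (\<forall>u<n. F0 u < 0 \<longrightarrow> F u < 0) \<and>
     (\<forall>e<m. violated b F e \<longrightarrow> bad e = 1 \<or> (\<exists>i\<ge>h. i < t \<and> Q i = int e)) \<and>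
     (\<forall>e<m. bad e = 0 \<or> bad e = 1 \<and> violated b F e \<and> src e \<in> alice \<Gamma>) \<and>
     (\<forall>u<n. cnt u = int (card {e. e < m \<and> src e = u \<and> bad e = 0}) \<and> 0 < cnt u) \<and>
     (\<forall>i<t. \<exists>e<m. Q i = int e) \<and> h \<le> t \<and>
     int t \<le> (\<Sum>u<n. int (deg u) * (1 + height b (F u) - height b (F0 u)))"

lemma worklistD:
  assumes "worklist b F0 F bad cnt Q h t"
  shows "lower b F" "u < n \<Longrightarrow> F0 u < 0 \<Longrightarrow> F u < 0"
    "e < m \<Longrightarrow> violated b F e \<Longrightarrow> bad e = 1 \<or> (\<exists>i\<ge>h. i < t \<and> Q i = int e)"
    "e < m \<Longrightarrow> bad e = 0 \<or> bad e = 1 \<and> violated b F e \<and> src e \<in> alice \<Gamma>"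
    "u < n \<Longrightarrow> cnt u = int (card {e. e < m \<and> src e = u \<and> bad e = 0})" "u < n \<Longrightarrow> 0 < cnt u"
    "i < t \<Longrightarrow> \<exists>e<m. Q i = int e" "h \<le> t"
    "int t \<le> (\<Sum>u<n. int (deg u) * (1 + height b (F u) - height b (F0 u)))"
  using assms unfolding worklist_def by blast+

lemma worklistI:
  assumes "lower b F" "\<And>u. u < n \<Longrightarrow> F0 u < 0 \<Longrightarrow> F u < 0"
    "\<And>e. e < m \<Longrightarrow> violated b F e \<Longrightarrow> bad e = 1 \<or> (\<exists>i\<ge>h. i < t \<and> Q i = int e)"
    "\<And>e. e < m \<Longrightarrow> bad e = 0 \<or> bad e = 1 \<and> violated b F e \<and> src e \<in> alice \<Gamma>"
    "\<And>u. u < n \<Longrightarrow> cnt u = int (card {e. e < m \<and> src e = u \<and> bad e = 0})"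
    "\<And>u. u < n \<Longrightarrow> 0 < cnt u"
    "\<And>i. i < t \<Longrightarrow> \<exists>e<m. Q i = int e" "h \<le> t"
    "int t \<le> (\<Sum>u<n. int (deg u) * (1 + height b (F u) - height b (F0 u)))"
  shows "worklist b F0 F bad cnt Q h t"
  using assms unfolding worklist_def by blast

lemma queue_head:
  assumes "worklist b F0 F bad cnt Q h t" "h < t" "Q h = int e"
  shows "e < m"
  using worklistD(7)[OF assms(1,2)] assms(3) by auto

lemma queue_advance:
  assumes "Q h = int e" "x \<noteq> e" "\<exists>i\<ge>h. i < t \<and> Q i = int x"
  shows "\<exists>i\<ge>Suc h. i < t \<and> Q i = int x"
proof -
  obtain i where i: "h \<le> i" "i < t" "Q i = int x" using assms(3) by blast
  moreover have "i \<noteq> h" using i assms by auto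
  ultimately show ?thesis by (intro exI[of _ i]) auto
qed

text \<open>With nothing left in the queue every violated edge is bad, and bad edges leave nodes of
  Alice, so Bob has no violated edge. A positive \<open>cnt\<close> leaves each node of Alice an
  edge that is not bad and hence not violated.\<close>

lemma worklist_fixpoint:
  assumes "worklist b F0 F bad cnt Q h h"
  shows "fixpoint b F"
  unfolding fixpoint_def
proof (intro allI impI conjI)
  fix u assume u: "u < n"
  note D = worklistD[OF assms]
  have viol: "bad e = 1 \<and> src e \<in> alice \<Gamma>" if "violated b F e" "e < m" for e
    using D(3,4)[OF that(2)] that(1) by auto
  have "{e. e < m \<and> src e = u \<and> bad e = 0} \<noteq> {}" using D(5,6)[OF u] by force
  then show "\<exists>e<m. src e = u \<and> \<not> violated b F e" using viol by force
  fix e assume "u \<in> bob \<Gamma>" "e < m" "src e = u"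
  then show "\<not> violated b F e" using viol disjoint by blast
qed

text \<open>Insertions are charged to the initial filling or to a raise of an endpoint; for a good
  guess each node is raised at most \<open>l\<close> times, and the degrees sum to at most
  \<open>2 * m\<close>. The program uses the contrapositive: too many insertions refute the
  guess.\<close>

lemma worklist_tail:
  assumes wl: "worklist b F0 F bad cnt Q h t" and r: "ready g b F0 l" and "good g"
  shows "int t \<le> 2 * int m * (l + 1)"
proof -
  have low: "lower b F" and b: "0 < b" and l: "0 \<le> l" using wl r by (auto simp: worklist_def ready_def)
  have h: "height b (F u) \<le> height b (F0 u) + l" if u: "u < n" for u
  proof -
    consider "F0 u < 0" | "0 \<le> F0 u" "N div b + 1 \<le> F0 u + l" |
      k where "0 \<le> F0 u" "minimal_energy \<Gamma> u = enat k" "int k \<le> b * (F0 u + l)"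
      using r \<open>good g\<close> u unfolding ready_def by (meson not_le)
    then show ?thesis
    proof cases
      case 1
      then have "F u < 0" using worklistD(2)[OF wl u] by simp
      then show ?thesis using 1 l by (simp add: height_def)
    next
      case 2
      then show ?thesis using lowerD(2)[OF low u] by (simp add: height_def)
    next
      case 3
      then have "0 \<le> F u" "b * F u \<le> b * (F0 u + l)" using lowerD(3,4)[OF low u 3(2)] by auto
      then show ?thesis using 3 b by (simp add: height_def)
    qed
  qed
  have "int t \<le> (\<Sum>u<n. int (deg u) * (1 + height b (F u) - height b (F0 u)))"
    using wl by (simp add: worklist_def)
  also have "\<dots> \<le> (\<Sum>u<n. int (deg u) * (l + 1))"
    using h by (intro sum_mono mult_left_mono) force+
  also have "\<dots> = int (\<Sum>u<n. deg u) * (l + 1)" by (simp add: sum_distrib_right)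
  also have "\<dots> \<le> int (2 * m) * (l + 1)"
    using sum_deg_le l by (intro mult_right_mono) (simp_all only: of_nat_le_iff)
  finally show ?thesis by simp
qed

lemma worklist_skip:
  assumes "worklist b F0 F bad cnt Q h t" "h < t" "Q h = int e" "\<not> violated b F e \<or> bad e = 1"
  shows "worklist b F0 F bad cnt Q (Suc h) t"
proof (rule worklistI)
  note wl = worklistD[OF assms(1)]
  show "bad x = 1 \<or> (\<exists>i\<ge>Suc h. i < t \<and> Q i = int x)" if "x < m" "violated b F x" for x
    using wl(3)[OF that] queue_advance[of Q h e x t, OF assms(3)] assms(4) that(2) by blast
  show "Suc h \<le> t" using assms(2) by simp
qed (rule worklistD[OF assms(1)]; assumption)+

text \<open>The case in which Alice's node keeps another edge not known to be violated: since
  \<open>cnt\<close> was positive and not 1, it stays positive after the decrement.\<close>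

lemma worklist_mark:
  assumes wl: "worklist b F0 F bad cnt Q h t" and h: "h < t" "Q h = int e"
    and e: "violated b F e" "bad e \<noteq> 1" "src e \<in> alice \<Gamma>" "cnt (src e) \<noteq> 1"
  shows "worklist b F0 F (bad(e := 1)) (cnt(src e := cnt (src e) - 1)) Q (Suc h) t"
proof -
  note D = worklistD[OF wl]
  have em: "e < m" by (rule queue_head[OF wl h])
  have bad: "bad e = 0" using D(4)[OF em] e by auto
  let ?bad = "bad(e := 1)" and ?cnt = "cnt(src e := cnt (src e) - 1)"
  show ?thesis
  proof (rule worklistI)
    show "?cnt u = int (card {x. x < m \<and> src x = u \<and> ?bad x = 0})" if u: "u < n" for u
    proof (cases "u = src e")
      case True
      let ?S = "{x. x < m \<and> src x = u \<and> bad x = 0}"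
      have "{x. x < m \<and> src x = u \<and> ?bad x = 0} = ?S - {e}" using True by auto
      moreover have "e \<in> ?S" "finite ?S" using True bad em by auto
      ultimately have "card {x. x < m \<and> src x = u \<and> ?bad x = 0} = card ?S - 1" "0 < card ?S"
        by (auto simp: card_gt_0_iff)
      then show ?thesis using D(5)[OF u] True by (simp add: of_nat_diff)
    next
      case False
      then have "{x. x < m \<and> src x = u \<and> ?bad x = 0} = {x. x < m \<and> src x = u \<and> bad x = 0}"
        by auto
      then show ?thesis using D(5)[OF u] False by simp
    qed
    show "0 < ?cnt u" if "u < n" for u using D(6)[OF that] e(4) by (cases "u = src e") auto
    show "?bad x = 1 \<or> (\<exists>i\<ge>Suc h. i < t \<and> Q i = int x)" if "x < m" "violated b F x" for x
      using D(3)[OF that] queue_advance[of Q h e x t, OF h(2)] by (cases "x = e") auto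
    show "?bad x = 0 \<or> ?bad x = 1 \<and> violated b F x \<and> src x \<in> alice \<Gamma>" if "x < m" for x
      using D(4)[OF that] e by auto
    show "Suc h \<le> t" using h by simp
  qed (rule D(1,2,7,9); assumption)+
qed

definition push :: "nat \<Rightarrow> (nat \<Rightarrow> int) \<Rightarrow> nat \<Rightarrow> nat \<Rightarrow> int" where
  "push u Q t i = (if t \<le> i \<and> i < t + deg u then int (incident u ! (i - t)) else Q i)"

text \<open>If Alice's count is 1, \<open>e\<close> is her last edge that is not bad; bad edges are
  violated for the present values, so all her edges are violated and the raise is sound. Bob's node
  is raised because of \<open>e\<close> alone. Afterwards only edges incident to \<open>u\<close>
  can have changed, and all of them are queued.\<close>

lemma worklist_raise:
  assumes b: "0 < b" and wl: "worklist b F0 F bad cnt Q h t" and h: "h < t" "Q h = int e"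
    and e: "violated b F e" "bad e \<noteq> 1" "src e = u" "u \<in> alice \<Gamma> \<Longrightarrow> cnt u = 1"
  shows "worklist b F0 (F(u := raised b (F u))) (\<lambda>x. if x < m \<and> src x = u then 0 else bad x)
     (cnt(u := int (card {x. x < m \<and> src x = u}))) (push u Q t) (Suc h) (t + deg u)"
    (is "worklist b F0 ?F ?bad ?cnt ?Q _ ?t")
proof -
  note D = worklistD[OF wl]
  have em: "e < m" by (rule queue_head[OF wl h])
  have u: "u < n" "0 \<le> F u" using src_less[OF em] e by (auto simp: violated_def)
  have low: "lower b F" using wl by (simp add: worklist_def)
  have bad0: "bad e = 0" using D(4)[OF em] e by auto
  have "u \<in> alice \<Gamma> \<and> (\<forall>x<m. src x = u \<longrightarrow> violated b F x) \<or>
      u \<in> bob \<Gamma> \<and> (\<exists>x<m. src x = u \<and> violated b F x)"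
  proof (cases "u \<in> alice \<Gamma>")
    case True
    define S where "S = {x. x < m \<and> src x = u \<and> bad x = 0}"
    have "card S = 1" unfolding S_def using D(5)[OF u(1)] e(4)[OF True] by simp
    then obtain y where y: "S = {y}" by (auto simp: card_1_singleton_iff)
    moreover have "e \<in> S" unfolding S_def using em e bad0 by auto
    ultimately have "S = {e}" by simp
    then have "x = e" if "x < m" "src x = u" "bad x = 0" for x
      using that by (simp add: S_def set_eq_iff) blast
    then have "violated b F x" if "x < m" "src x = u" for x using D(4)[OF that(1)] that e(1) by blast
    then show ?thesis using True by blast
  next
    case False
    then have "u \<in> bob \<Gamma>" using u nodes_less nodes_eq by blast
    then show ?thesis using em e by blast
  qed
  then have low': "lower b ?F" by (rule lower_raise[OF b low u])
  have up: "violated b ?F x \<longleftrightarrow> violated b F x" if "src x \<noteq> u" "tgt x \<noteq> u" for x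
    using that by (simp add: violated_def)
  \<comment> \<open>A larger or infinite value at the target cannot repair an edge. So bad marks on
    edges from other nodes stay valid and only those on edges out of \<open>u\<close> are
    cleared.\<close>
  have up2: "violated b ?F x" if "violated b F x" "src x \<noteq> u" for x
    using that u by (auto simp: violated_def raised_def)
  have inq: "\<exists>i\<ge>Suc h. i < ?t \<and> ?Q i = int x" if x: "x < m" "src x = u \<or> tgt x = u" for x
  proof -
    have "x \<in> set (incident u)" using x by (simp add: set_incident)
    then obtain i where "i < deg u" "incident u ! i = x" by (auto simp: in_set_conv_nth deg_def)
    then show ?thesis using h by (intro exI[of _ "t + i"]) (auto simp: push_def)
  qed
  have viol: "?bad x = 1 \<or> (\<exists>i\<ge>Suc h. i < ?t \<and> ?Q i = int x)" if x: "x < m" "violated b ?F x" for x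
  proof (cases "src x = u \<or> tgt x = u")
    case True
    then show ?thesis using inq x by blast
  next
    case False
    then have "violated b F x" using x up by blast
    moreover have "x \<noteq> e" using False e by blast
    ultimately have "bad x = 1 \<or> (\<exists>i\<ge>Suc h. i < t \<and> Q i = int x)"
      using D(3)[OF x(1)] queue_advance[of Q h e x t, OF h(2)] by blast
    then show ?thesis
    proof
      assume "\<exists>i\<ge>Suc h. i < t \<and> Q i = int x"
      then obtain i where "Suc h \<le> i" "i < t" "Q i = int x" by blast
      then show ?thesis by (intro disjI2 exI[of _ i]) (auto simp: push_def)
    qed (use False in auto)
  qed
  have bad: "?bad x = 0 \<or> ?bad x = 1 \<and> violated b ?F x \<and> src x \<in> alice \<Gamma>" if "x < m" for x
    using D(4)[OF that] up2[of x] that by auto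
  have cnt: "?cnt v = int (card {x. x < m \<and> src x = v \<and> ?bad x = 0}) \<and> 0 < ?cnt v" if v: "v < n" for v
  proof (cases "v = u")
    case True
    then have "{x. x < m \<and> src x = v \<and> ?bad x = 0} = {x. x < m \<and> src x = u}" by auto
    moreover have "0 < card {x. x < m \<and> src x = u}"
      using out_edge_ex[OF u(1)] by (auto simp: card_gt_0_iff)
    ultimately show ?thesis using True by simp
  next
    case False
    then have "{x. x < m \<and> src x = v \<and> ?bad x = 0} = {x. x < m \<and> src x = v \<and> bad x = 0}" by auto
    then show ?thesis using D(5,6)[OF v] False by simp
  qed
  have Q: "\<exists>x<m. ?Q i = int x" if i: "i < ?t" for i
  proof (cases "i < t")
    case True
    then show ?thesis using D(7)[OF True] by (simp add: push_def)
  next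
    case False
    then show ?thesis using i incident_nth[of "i - t" u] by (auto simp: push_def)
  qed
  \<comment> \<open>Placing infinity at \<open>N div b + 1\<close> makes the raise from the largest
    finite value to \<open>- 1\<close> count as one, like any other.\<close>
  have hr: "height b (raised b (F u)) = height b (F u) + 1"
    using u lowerD(2)[OF low u(1)] by (auto simp: height_def raised_def)
  have "(\<Sum>v<n. int (deg v) * (1 + height b (?F v) - height b (F0 v)))
      = (\<Sum>v<n. int (deg v) * (1 + height b (F v) - height b (F0 v)) + (if v = u then int (deg u) else 0))"
    by (intro sum.cong refl) (auto simp: hr algebra_simps)
  also have "\<dots> = (\<Sum>v<n. int (deg v) * (1 + height b (F v) - height b (F0 v))) + int (deg u)"
    using u(1) by (simp add: sum.distrib)
  finally have "int ?t \<le> (\<Sum>v<n. int (deg v) * (1 + height b (?F v) - height b (F0 v)))"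
    using D(9) by simp
  moreover have "?F v < 0" if "v < n" "F0 v < 0" for v
    using D(2)[OF that] u by auto
  moreover have "Suc h \<le> ?t" using h by simp
  ultimately show ?thesis using low' viol bad cnt Q by (intro worklistI) blast+
qed

text \<open>The queue is filled node by node with incident edges, so its length is the sum of the
  degrees; this accounts for the summand 1 next to the heights in \<open>worklist\<close>.\<close>

lemma worklist_initial:
  assumes "lower b F" "\<And>e. e < m \<Longrightarrow> bad e = 0"
    and "\<And>u. u < n \<Longrightarrow> cnt u = int (card {e. e < m \<and> src e = u})"
    and "\<And>e. e < m \<Longrightarrow> \<exists>i<t. Q i = int e" "\<And>i. i < t \<Longrightarrow> \<exists>e<m. Q i = int e"
    and "t = (\<Sum>u<n. deg u)"
  shows "worklist b F F bad cnt Q 0 t"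
proof -
  have eq: "{e. e < m \<and> src e = u \<and> bad e = 0} = {e. e < m \<and> src e = u}" for u
    using assms(2) by auto
  have "0 < card {e. e < m \<and> src e = u}" if u: "u < n" for u
    using out_edge_ex[OF u] by (auto simp: card_gt_0_iff)
  then show ?thesis using assms by (intro worklistI) (auto simp: eq)
qed

end

section \<open>The program\<close>

text \<open>The variable \<open>g\<close> is the guess below the penalty, \<open>b\<close> the present rounding unit (in the end \<open>0\<close>
  for success and \<open>- 1\<close> for a refuted guess), and \<open>l\<close> bounds the raises per node in a phase.
  The edges incident to \<open>u\<close> are stored in \<open>adj\<close> from address \<open>u m\<close> on.\<close>

fun block :: "com list \<Rightarrow> com" where
  "block [] = Skip"
| "block [c] = c"
| "block (c # d # cs) = Seq c (block (d # cs))"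

definition Equal :: "aexp \<Rightarrow> aexp \<Rightarrow> bexp" where
  "Equal a b = Conj (Neg (Less a b)) (Neg (Less b a))"

lemma bval_Equal: "bval (Equal a b) s \<longleftrightarrow> aval a s = aval b s"
  by (auto simp: Equal_def)

definition increment :: "vname \<Rightarrow> com" where
  "increment x = Assign x (Add (Var x) (Const 1))"

definition reset_node :: com where
  "reset_node = block
    [Assign ''c'' (Const 0),
     Assign ''i'' (Const 0),
     Loop (Less (Var ''i'') (Read ''deg'' (Var ''u''))) (block
       [Assign ''e'' (Read ''adj'' (Add (Mul (Var ''u'') (Var ''m'')) (Var ''i''))),
        Write ''queue'' (Var ''t'') (Var ''e''),
        increment ''t'',
        Cond (Equal (Read ''source'' (Var ''e'')) (Var ''u''))
          (block [Write ''bad'' (Var ''e'') (Const 0), increment ''c'']) Skip,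
        increment ''i'']),
     Write ''count'' (Var ''u'') (Var ''c'')]"

text \<open>Doubling passes from the unit \<open>2 * b\<close> to \<open>b\<close>. The first phase
  starts from values 0, which doubling preserves, and the test keeps the code \<open>- 1\<close>
  unchanged.\<close>

definition init_phase :: com where
  "init_phase = block
    [Assign ''t'' (Const 0),
     Assign ''u'' (Const 0),
     Loop (Less (Var ''u'') (Var ''n'')) (block
       [Cond (Less (Const 0) (Read ''energy'' (Var ''u'')))
          (Write ''energy'' (Var ''u'') (Mul (Const 2) (Read ''energy'' (Var ''u'')))) Skip,
        reset_node,
        increment ''u''])]"

text \<open>The nested negations express a disjunction, and subtracting the floor of
  \<open>- weight / b\<close> adds the rounded weight. At a node of Bob the bad mark and the
  decrement are only temporary, because \<open>reset_node\<close> overwrites both.\<close>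

definition process_edge :: com where
  "process_edge = block
    [Assign ''q'' (Read ''queue'' (Var ''h'')),
     increment ''h'',
     Assign ''u'' (Read ''source'' (Var ''q'')),
     Assign ''v'' (Read ''target'' (Var ''q'')),
     Cond (Conj (Less (Read ''bad'' (Var ''q'')) (Const 1))
        (Conj (Neg (Less (Read ''energy'' (Var ''u'')) (Const 0)))
          (Neg (Conj (Neg (Less (Read ''energy'' (Var ''v'')) (Const 0)))
            (Neg (Less
              (Sub (Read ''energy'' (Var ''u''))
                (Quot (Sub (Const 0) (Read ''weight'' (Var ''q''))) (Var ''b'')))
              (Read ''energy'' (Var ''v''))))))))
       (block
         [Write ''bad'' (Var ''q'') (Const 1),
          Write ''count'' (Var ''u'') (Sub (Read ''count'' (Var ''u'')) (Const 1)),
          Cond (Conj (Less (Const 0) (Read ''count'' (Var ''u'')))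
                 (Less (Const 0) (Read ''alice'' (Var ''u''))))
            Skip
            (block
              [Cond (Less (Read ''energy'' (Var ''u'')) (Quot (Var ''M'') (Var ''b'')))
                 (Write ''energy'' (Var ''u'') (Add (Read ''energy'' (Var ''u'')) (Const 1)))
                 (Write ''energy'' (Var ''u'') (Const (- 1))),
               reset_node])])
       Skip]"

text \<open>The second test gives up by the number of insertions instead of the elapsed steps. It
  thereby also bounds the addresses used in the queue.\<close>

definition worklist_loop :: com where
  "worklist_loop = block
    [Assign ''h'' (Const 0),
     Loop (Conj (Less (Var ''h'') (Var ''t''))
         (Neg (Less (Mul (Mul (Const 2) (Var ''m'')) (Add (Var ''l'') (Const 1))) (Var ''t''))))
       process_edge]"

definition phase :: com where
  "phase = block
    [init_phase,
     worklist_loop,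
     Cond (Less (Var ''h'') (Var ''t''))
       (Assign ''b'' (Const (- 1)))
       (block
         [Assign ''b'' (Quot (Var ''b'') (Const 2)),
          Assign ''l'' (Mul (Const 2) (Var ''n''))])]"

definition attempt :: com where
  "attempt = block
    [Assign ''u'' (Const 0),
     Loop (Less (Var ''u'') (Var ''n'')) (block
       [Write ''energy'' (Var ''u'') (Const 0),
        increment ''u'']),
     Assign ''b'' (Var ''g''),
     Assign ''l'' (Add (Quot (Var ''M'') (Var ''g'')) (Const 1)),
     Loop (Less (Const 0) (Var ''b'')) phase,
     Cond (Less (Var ''b'') (Const 0))
       (Assign ''g'' (Quot (Var ''g'') (Const 2)))
       (Assign ''g'' (Const 0))]"

definition collect_incident :: com where
  "collect_incident = block
    [Assign ''c'' (Const 0),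
     Assign ''e'' (Const 0),
     Loop (Less (Var ''e'') (Var ''m'')) (block
       [Cond (Neg (Conj (Neg (Equal (Read ''source'' (Var ''e'')) (Var ''u'')))
              (Neg (Equal (Read ''target'' (Var ''e'')) (Var ''u'')))))
          (block
            [Write ''adj'' (Add (Mul (Var ''u'') (Var ''m'')) (Var ''c'')) (Var ''e''),
             increment ''c''])
          Skip,
        increment ''e'']),
     Write ''deg'' (Var ''u'') (Var ''c'')]"

text \<open>The first guess is the least power of two with \<open>M <= g * n\<close>: from there on
  the cost mM/g is at most mn. Clamping \<open>M\<close> turns a negative bound into
  \<open>N = 0\<close>.\<close>

definition setup_program :: com where
  "setup_program = block
    [Cond (Less (Var ''M'') (Const 0)) (Assign ''M'' (Const 0)) Skip,
     Assign ''u'' (Const 0),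
     Loop (Less (Var ''u'') (Var ''n'')) (block [collect_incident, increment ''u'']),
     Assign ''g'' (Const 1),
     Loop (Less (Mul (Var ''g'') (Var ''n'')) (Var ''M''))
       (Assign ''g'' (Mul (Const 2) (Var ''g'')))]"

definition energy_program :: com where
  "energy_program = block
    [setup_program,
     Loop (Less (Const 0) (Var ''g'')) attempt]"

section \<open>Words and memory layout\<close>

definition arr :: "state \<Rightarrow> vname \<Rightarrow> nat \<Rightarrow> int" where
  "arr s A i = arrays s A (int i)"

lemma arr_set_var [simp]: "arr (set_var x v s) = arr s"
  by (auto simp: arr_def state_simps fun_eq_iff)

lemma arr_set_array [simp]:
  "0 \<le> j \<Longrightarrow> arr (set_array A j v s) A' = (if A' = A then (arr s A)(nat j := v) else arr s A')"
  by (auto simp: arr_def state_simps fun_eq_iff)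

lemma arr_frame: "frame X Y s s' \<Longrightarrow> A \<notin> Y \<Longrightarrow> arr s' A = arr s A"
  by (simp add: arr_def frame_array fun_eq_iff)

lemmas exec_simps = exec_Skip exec_Assign exec_Write exec_Seq exec_Cond bval_Equal increment_def
  state_simps frame_set_var frame_set_array

text \<open>The product with \<open>2 * int m\<close> covers queue positions: a phase has
  \<open>l\<close> at most \<open>N + 2 * n + 1\<close>, so at most
  \<open>2 * m * (l + 1) + m\<close> insertions. The term \<open>n * m\<close> covers the addresses
  of \<open>adj\<close>, and \<open>2 * N\<close> the doubled values and the largest guess.\<close>

locale energy_machine = energy_instance +
  fixes B :: int
  assumes word: "2 * int m * (N + 2 * int n + 4) + int n * int m + 2 * N + 2 * int n + 2 \<le> B"
begin

lemma word_bounds: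
  "1 \<le> B" "int n \<le> B" "int m \<le> B" "2 * N \<le> B" "2 * int n \<le> B" "N + 1 \<le> B" "int n * int m \<le> B"
proof -
  have "0 \<le> int m * N" "0 \<le> int m * int n" "0 \<le> N" by simp_all
  then show "1 \<le> B" "int n \<le> B" "int m \<le> B" "2 * N \<le> B" "2 * int n \<le> B" "N + 1 \<le> B" "int n * int m \<le> B"
    using word unfolding distrib_left mult.assoc[symmetric] mult.commute[of "int n" "int m"]
    by (linarith, linarith, linarith, linarith, linarith, linarith, linarith)
qed

definition input_layout :: "state \<Rightarrow> bool" where
  "input_layout s \<longleftrightarrow> vars s ''n'' = int n \<and> vars s ''m'' = int m \<and>
     (\<forall>u<n. arrays s ''alice'' (int u) = of_bool (u \<in> alice \<Gamma>)) \<and>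
     (\<forall>e<m. arrays s ''source'' (int e) = int (src e) \<and> arrays s ''target'' (int e) = int (tgt e) \<and>
        arrays s ''weight'' (int e) = weight \<Gamma> (es ! e))"

definition layout :: "state \<Rightarrow> bool" where
  "layout s \<longleftrightarrow> input_layout s \<and> vars s ''M'' = N \<and>
     (\<forall>u<n. arrays s ''deg'' (int u) = int (deg u) \<and>
        (\<forall>i<deg u. arrays s ''adj'' (int u * int m + int i) = int (incident u ! i)))"

lemma input_layout_frame:
  assumes "input_layout s" "frame X Y s s'" "X \<inter> {''n'', ''m''} = {}"
    "Y \<inter> {''alice'', ''source'', ''target'', ''weight''} = {}"
  shows "input_layout s'"
proof -
  have "''n'' \<notin> X" "''m'' \<notin> X" using assms(3) by simp_all
  then have "vars s' ''n'' = vars s ''n''" "vars s' ''m'' = vars s ''m''"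
    by (simp_all add: frame_var[OF assms(2)])
  moreover have "''alice'' \<notin> Y" "''source'' \<notin> Y" "''target'' \<notin> Y" "''weight'' \<notin> Y"
    using assms(4) by simp_all
  then have "arrays s' ''alice'' = arrays s ''alice''" "arrays s' ''source'' = arrays s ''source''"
    "arrays s' ''target'' = arrays s ''target''" "arrays s' ''weight'' = arrays s ''weight''"
    by (simp_all add: frame_array[OF assms(2)])
  ultimately show ?thesis using assms(1) by (simp add: input_layout_def)
qed

lemma layout_frame:
  assumes "layout s" "frame X Y s s'" "X \<inter> {''n'', ''m'', ''M''} = {}"
    "Y \<inter> {''alice'', ''source'', ''target'', ''weight'', ''deg'', ''adj''} = {}"
  shows "layout s'"
proof -
  have "''M'' \<notin> X" using assms(3) by simp
  then have "vars s' ''M'' = vars s ''M''" by (rule frame_var[OF assms(2)])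
  moreover have "''deg'' \<notin> Y" "''adj'' \<notin> Y" using assms(4) by simp_all
  then have "arrays s' ''deg'' = arrays s ''deg''" "arrays s' ''adj'' = arrays s ''adj''"
    by (simp_all add: frame_array[OF assms(2)])
  moreover have "input_layout s'"
  proof (rule input_layout_frame[OF _ assms(2)])
    show "input_layout s" using assms(1) by (simp add: layout_def)
    show "X \<inter> {''n'', ''m''} = {}" using assms(3) by simp
    show "Y \<inter> {''alice'', ''source'', ''target'', ''weight''} = {}" using assms(4) by simp
  qed
  ultimately show ?thesis using assms(1) by (simp add: layout_def)
qed

lemma layoutD:
  assumes "layout s"
  shows "vars s ''n'' = int n" "vars s ''m'' = int m" "vars s ''M'' = N"
    "u < n \<Longrightarrow> arrays s ''alice'' (int u) = of_bool (u \<in> alice \<Gamma>)"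
    "u < n \<Longrightarrow> arrays s ''deg'' (int u) = int (deg u)"
    "u < n \<Longrightarrow> i < deg u \<Longrightarrow> arrays s ''adj'' (int u * int m + int i) = int (incident u ! i)"
    "e < m \<Longrightarrow> arrays s ''source'' (int e) = int (src e)"
    "e < m \<Longrightarrow> arrays s ''target'' (int e) = int (tgt e)"
    "e < m \<Longrightarrow> arrays s ''weight'' (int e) = weight \<Gamma> (es ! e)"
  using assms by (auto simp: layout_def input_layout_def)

lemma out_degree: "length (filter (\<lambda>e. src e = u) (incident u)) = card {e. e < m \<and> src e = u}"
proof -
  have "distinct (filter (\<lambda>e. src e = u) (incident u))" by (simp add: incident_def)
  moreover have "set (filter (\<lambda>e. src e = u) (incident u)) = {e. e < m \<and> src e = u}"
    by (auto simp: set_incident)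
  ultimately show ?thesis using distinct_card by metis
qed

abbreviation "reset_vars \<equiv> {''c'', ''i'', ''e'', ''t''}"

text \<open>The factor 8 consists of at most seven steps of the loop body and one test per incident
  edge. The hypothesis on \<open>t\<close> leaves room for a full list of at most \<open>m\<close>
  insertions.\<close>

lemma exec_reset_node:
  assumes lay: "layout s" and u: "vars s ''u'' = int u" "u < n"
    and t: "vars s ''t'' = int t" "int t + int m \<le> B"
  shows "exec B reset_node s (\<lambda>\<tau> s'. frame reset_vars {''queue'', ''bad'', ''count''} s s' \<and>
     vars s' ''t'' = int (t + deg u) \<and>
     arr s' ''queue'' = push u (arr s ''queue'') t \<and>
     arr s' ''bad'' = (\<lambda>x. if x < m \<and> src x = u then 0 else arr s ''bad'' x) \<and>
     arr s' ''count'' = (arr s ''count'')(u := int (card {x. x < m \<and> src x = u})) \<and>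
     \<tau> \<le> 8 * deg u + 8)"
proof -
  let ?body = "block
       [Assign ''e'' (Read ''adj'' (Add (Mul (Var ''u'') (Var ''m'')) (Var ''i''))),
        Write ''queue'' (Var ''t'') (Var ''e''),
        increment ''t'',
        Cond (Equal (Read ''source'' (Var ''e'')) (Var ''u''))
          (block [Write ''bad'' (Var ''e'') (Const 0), increment ''c'']) Skip,
        increment ''i'']"
  let ?guard = "Less (Var ''i'') (Read ''deg'' (Var ''u''))"
  define I where "I k s' \<longleftrightarrow> (\<exists>i\<le>deg u. frame reset_vars {''queue'', ''bad''} s s' \<and>
      vars s' ''i'' = int i \<and> vars s' ''t'' = int (t + i) \<and>
      vars s' ''c'' = int (length (filter (\<lambda>e. src e = u) (take i (incident u)))) \<and>
      arr s' ''queue'' = (\<lambda>j. if t \<le> j \<and> j < t + i then int (incident u ! (j - t)) else arr s ''queue'' j) \<and>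
      arr s' ''bad'' = (\<lambda>x. if x \<in> set (take i (incident u)) \<and> src x = u then 0 else arr s ''bad'' x) \<and>
      k = 8 * (deg u - i))" for k :: nat and s'
  have loop: "exec B (Loop ?guard ?body) s0 (\<lambda>\<tau> s'. \<exists>k'. I k' s' \<and> \<not> bval ?guard s' \<and> \<tau> + k' \<le> k + 1)"
    if "I k s0" for k s0
  proof (rule exec_Loop[where I = I, OF _ that])
    fix k s' assume I: "I k s'" and g: "bval ?guard s'"
    then obtain i where i: "i \<le> deg u" and fr: "frame reset_vars {''queue'', ''bad''} s s'" and
      vi: "vars s' ''i'' = int i" "vars s' ''t'' = int (t + i)"
      "vars s' ''c'' = int (length (filter (\<lambda>e. src e = u) (take i (incident u))))" and
      Q: "arr s' ''queue'' = (\<lambda>j. if t \<le> j \<and> j < t + i then int (incident u ! (j - t)) else arr s ''queue'' j)" and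
      bad: "arr s' ''bad'' = (\<lambda>x. if x \<in> set (take i (incident u)) \<and> src x = u then 0 else arr s ''bad'' x)"
      and k: "k = 8 * (deg u - i)" unfolding I_def by blast
    have lay': "layout s'" by (rule layout_frame[OF lay fr]) auto
    have vu: "vars s' ''u'' = int u" using frame_var[OF fr, of "''u''"] u by simp
    have lt: "i < deg u" using g layoutD(5)[OF lay' u(2)] vi vu by simp
    let ?e = "incident u ! i"
    have em: "?e < m" by (rule incident_nth[OF lt])
    note look = layoutD(2)[OF lay'] layoutD(6)[OF lay' u(2) lt] layoutD(7)[OF lay' em]
    have tk: "take (Suc i) (incident u) = take i (incident u) @ [?e]"
      using lt by (simp add: deg_def take_Suc_conv_app_nth)
    have len: "length (filter (\<lambda>e. src e = u) (take i (incident u))) \<le> i"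
      using length_filter_le[of _ "take i (incident u)"] by (simp add: le_trans)
    have bnd: "int t + int i \<le> B - 1" "int ?e \<le> B" "int i \<le> B - 1"
      using t lt deg_le[of u] em word_bounds by linarith+
    have "exec B ?body s' (\<lambda>\<tau> s''. frame reset_vars {''queue'', ''bad''} s' s'' \<and>
        vars s'' ''i'' = int (Suc i) \<and> vars s'' ''t'' = int (t + Suc i) \<and>
        vars s'' ''c'' = vars s' ''c'' + of_bool (src ?e = u) \<and>
        arr s'' ''queue'' = (arr s' ''queue'')(t + i := int ?e) \<and>
        arr s'' ''bad'' = (if src ?e = u then (arr s' ''bad'')(?e := 0) else arr s' ''bad'') \<and> \<tau> \<le> 7)"
      using bnd len by (simp add: exec_simps vi vu look frame_refl nat_add_distrib)
    then show "exec B ?body s' (\<lambda>\<tau> s''. \<exists>k'. I k' s'' \<and> k' + \<tau> + 1 \<le> k)"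
    proof (rule exec_mono)
      fix \<tau> :: nat and s'' assume *: "frame reset_vars {''queue'', ''bad''} s' s'' \<and>
        vars s'' ''i'' = int (Suc i) \<and> vars s'' ''t'' = int (t + Suc i) \<and>
        vars s'' ''c'' = vars s' ''c'' + of_bool (src ?e = u) \<and>
        arr s'' ''queue'' = (arr s' ''queue'')(t + i := int ?e) \<and>
        arr s'' ''bad'' = (if src ?e = u then (arr s' ''bad'')(?e := 0) else arr s' ''bad'') \<and> \<tau> \<le> 7"
      have "I (8 * (deg u - Suc i)) s''"
        unfolding I_def
      proof (intro exI[of _ "Suc i"] conjI)
        show "frame reset_vars {''queue'', ''bad''} s s''" using frame_trans[OF fr] * by blast
        show "arr s'' ''queue'' = (\<lambda>j. if t \<le> j \<and> j < t + Suc i then int (incident u ! (j - t)) else arr s ''queue'' j)"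
          using * by (auto simp: Q fun_eq_iff)
        show "arr s'' ''bad'' = (\<lambda>x. if x \<in> set (take (Suc i) (incident u)) \<and> src x = u then 0 else arr s ''bad'' x)"
          using * by (auto simp: bad tk fun_eq_iff)
      qed (use * lt tk vi in auto)
      moreover have "\<tau> \<le> 7" using * by blast
      then have "8 * (deg u - Suc i) + \<tau> + 1 \<le> k" using lt k by linarith
      ultimately show "\<exists>k'. I k' s'' \<and> k' + \<tau> + 1 \<le> k" by blast
    qed
  qed
  let ?s0 = "set_var ''i'' 0 (set_var ''c'' 0 s)"
  have "I (8 * deg u) ?s0"
    unfolding I_def by (intro exI[of _ 0]) (auto simp: exec_simps frame_refl t)
  note L = loop[OF this]
  have "exec B (Loop ?guard ?body) ?s0 (\<lambda>\<tau> s'. exec B (Write ''count'' (Var ''u'') (Var ''c'')) s' (\<lambda>\<tau>' s''.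
     frame reset_vars {''queue'', ''bad'', ''count''} s s'' \<and>
     vars s'' ''t'' = int (t + deg u) \<and>
     arr s'' ''queue'' = push u (arr s ''queue'') t \<and>
     arr s'' ''bad'' = (\<lambda>x. if x < m \<and> src x = u then 0 else arr s ''bad'' x) \<and>
     arr s'' ''count'' = (arr s ''count'')(u := int (card {x. x < m \<and> src x = u})) \<and>
     2 + (\<tau> + \<tau>') \<le> 8 * deg u + 8))"
    using L
  proof (rule exec_mono)
    fix \<tau> :: nat and s' assume *: "\<exists>k'. I k' s' \<and> \<not> bval ?guard s' \<and> \<tau> + k' \<le> 8 * deg u + 1"
    then obtain k' i where g: "\<not> bval ?guard s'" and \<tau>: "\<tau> + k' \<le> 8 * deg u + 1" and i: "i \<le> deg u" and
      fr: "frame reset_vars {''queue'', ''bad''} s s'" and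
      vi: "vars s' ''i'' = int i" "vars s' ''t'' = int (t + i)"
      "vars s' ''c'' = int (length (filter (\<lambda>e. src e = u) (take i (incident u))))" and
      Q: "arr s' ''queue'' = (\<lambda>j. if t \<le> j \<and> j < t + i then int (incident u ! (j - t)) else arr s ''queue'' j)" and
      bad: "arr s' ''bad'' = (\<lambda>x. if x \<in> set (take i (incident u)) \<and> src x = u then 0 else arr s ''bad'' x)"
      unfolding I_def by blast
    have lay': "layout s'" by (rule layout_frame[OF lay fr]) auto
    have vu: "vars s' ''u'' = int u" using frame_var[OF fr, of "''u''"] u by simp
    have "i = deg u" using g i layoutD(5)[OF lay' u(2)] vi vu by simp
    then have tk: "take i (incident u) = incident u" by (simp add: deg_def)
    have c: "vars s' ''c'' = int (card {x. x < m \<and> src x = u})" using vi(3) tk out_degree by simp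
    have cB: "int (card {x. x < m \<and> src x = u}) \<le> B"
    proof -
      have "card {x. x < m \<and> src x = u} \<le> m"
        unfolding out_degree[symmetric] using deg_le[of u] length_filter_le[of _ "incident u"]
        unfolding deg_def by (rule order_trans[rotated])
      then show ?thesis using word_bounds(3) by linarith
    qed
    have fr': "frame reset_vars {''queue'', ''bad'', ''count''} s s'" by (rule frame_mono[OF fr]) auto
    have "arr s' ''queue'' = push u (arr s ''queue'') t"
      unfolding Q \<open>i = deg u\<close> by (auto simp: push_def fun_eq_iff)
    moreover have "arr s' ''bad'' = (\<lambda>x. if x < m \<and> src x = u then 0 else arr s ''bad'' x)"
      unfolding bad tk set_incident by auto
    moreover have "arr s' ''count'' = arr s ''count''" by (rule arr_frame[OF fr]) auto
    ultimately show "exec B (Write ''count'' (Var ''u'') (Var ''c'')) s' (\<lambda>\<tau>' s''.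
       frame reset_vars {''queue'', ''bad'', ''count''} s s'' \<and>
       vars s'' ''t'' = int (t + deg u) \<and>
       arr s'' ''queue'' = push u (arr s ''queue'') t \<and>
       arr s'' ''bad'' = (\<lambda>x. if x < m \<and> src x = u then 0 else arr s ''bad'' x) \<and>
       arr s'' ''count'' = (arr s ''count'')(u := int (card {x. x < m \<and> src x = u})) \<and>
       2 + (\<tau> + \<tau>') \<le> 8 * deg u + 8)"
      using u(2) word_bounds cB \<tau> \<open>i = deg u\<close> fr' by (simp add: exec_simps vu c vi)
  qed
  then show ?thesis
    using word_bounds unfolding reset_node_def by (simp add: exec_simps)
qed


definition doubled :: "int \<Rightarrow> int" where
  "doubled x = (if 0 < x then 2 * x else x)"

abbreviation "init_vars \<equiv> {''c'', ''i'', ''e'', ''t'', ''u''}"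
abbreviation "phase_arrays \<equiv> {''queue'', ''bad'', ''count'', ''energy''}"

text \<open>\<open>16 * m\<close> is 8 times the sum of the degrees; the 12 per node are the 8 of
  \<open>reset_node\<close>, two steps for doubling, one increment and one test.\<close>

lemma exec_init_phase:
  assumes lay: "layout s" and F: "\<And>u. u < n \<Longrightarrow> \<bar>2 * arr s ''energy'' u\<bar> \<le> B"
  shows "exec B init_phase s (\<lambda>\<tau> s'. frame init_vars phase_arrays s s' \<and>
     vars s' ''t'' = int (\<Sum>u<n. deg u) \<and>
     (\<forall>u<n. arr s' ''energy'' u = doubled (arr s ''energy'' u)) \<and>
     (\<forall>e<m. arr s' ''bad'' e = 0) \<and>
     (\<forall>u<n. arr s' ''count'' u = int (card {x. x < m \<and> src x = u})) \<and>
     (\<forall>e<m. \<exists>i<(\<Sum>u<n. deg u). arr s' ''queue'' i = int e) \<and>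
     (\<forall>i<(\<Sum>u<n. deg u). \<exists>e<m. arr s' ''queue'' i = int e) \<and>
     \<tau> \<le> 12 * n + 16 * m + 3)"
proof -
  let ?body = "block
       [Cond (Less (Const 0) (Read ''energy'' (Var ''u'')))
          (Write ''energy'' (Var ''u'') (Mul (Const 2) (Read ''energy'' (Var ''u'')))) Skip,
        reset_node,
        increment ''u'']"
  let ?guard = "Less (Var ''u'') (Var ''n'')"
  define d where "d u = (\<Sum>x<u. deg x)" for u
  define I where "I k s' \<longleftrightarrow> (\<exists>u\<le>n. frame init_vars phase_arrays s s' \<and>
      vars s' ''u'' = int u \<and> vars s' ''t'' = int (d u) \<and>
      (\<forall>x<n. arr s' ''energy'' x = (if x < u then doubled (arr s ''energy'' x) else arr s ''energy'' x)) \<and>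
      (\<forall>e<m. src e < u \<longrightarrow> arr s' ''bad'' e = 0) \<and>
      (\<forall>v<u. arr s' ''count'' v = int (card {x. x < m \<and> src x = v})) \<and>
      (\<forall>e<m. src e < u \<longrightarrow> (\<exists>i<d u. arr s' ''queue'' i = int e)) \<and>
      (\<forall>i<d u. \<exists>e<m. arr s' ''queue'' i = int e) \<and>
      k = (\<Sum>x\<in>{u..<n}. 8 * deg x + 12))" for k :: nat and s'
  have loop: "exec B (Loop ?guard ?body) s0 (\<lambda>\<tau> s'. \<exists>k'. I k' s' \<and> \<not> bval ?guard s' \<and> \<tau> + k' \<le> k + 1)"
    if "I k s0" for k s0
  proof (rule exec_Loop[where I = I, OF _ that])
    fix k s' assume "I k s'" and g: "bval ?guard s'"
    then obtain u where un: "u \<le> n" and fr: "frame init_vars phase_arrays s s'" and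
      vi: "vars s' ''u'' = int u" "vars s' ''t'' = int (d u)" and
      en: "\<And>x. x < n \<Longrightarrow> arr s' ''energy'' x = (if x < u then doubled (arr s ''energy'' x) else arr s ''energy'' x)" and
      bad: "\<And>e. e < m \<Longrightarrow> src e < u \<Longrightarrow> arr s' ''bad'' e = 0" and
      cnt: "\<And>v. v < u \<Longrightarrow> arr s' ''count'' v = int (card {x. x < m \<and> src x = v})" and
      Q1: "\<And>e. e < m \<Longrightarrow> src e < u \<Longrightarrow> \<exists>i<d u. arr s' ''queue'' i = int e" and
      Q2: "\<And>i. i < d u \<Longrightarrow> \<exists>e<m. arr s' ''queue'' i = int e" and
      k: "k = (\<Sum>x\<in>{u..<n}. 8 * deg x + 12)" unfolding I_def by blast
    have lay': "layout s'" by (rule layout_frame[OF lay fr]) simp_all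
    have lt: "u < n" using g vi layoutD(1)[OF lay'] by simp
    have "d u \<le> 2 * m"
      using sum_mono2[of "{..<n}" "{..<u}" deg] lt sum_deg_le unfolding d_def by fastforce
    then have tB: "int (d u) + int m \<le> B"
    proof -
      have "int m * 4 \<le> int m * (N + 2 * int n + 4)" by (intro mult_left_mono) auto
      moreover have "0 \<le> int n * int m" "0 \<le> N" by simp_all
      ultimately show ?thesis using \<open>d u \<le> 2 * m\<close> word by linarith
    qed
    let ?s1 = "if 0 < arr s ''energy'' u then set_array ''energy'' (int u) (2 * arr s ''energy'' u) s' else s'"
    have e_u: "arrays s' ''energy'' (int u) = arr s ''energy'' u" using en[OF lt] by (simp add: arr_def)
    have fr1: "frame init_vars phase_arrays s ?s1" using fr by (simp add: frame_set_array)
    have lay1: "layout ?s1" by (rule layout_frame[OF lay fr1]) simp_all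
    have v1: "vars ?s1 ''u'' = int u" "vars ?s1 ''t'' = int (d u)" using vi by (simp_all add: state_simps)
    have arr1: "arr ?s1 ''energy'' = (arr s' ''energy'')(u := doubled (arr s ''energy'' u))"
      "A \<noteq> ''energy'' \<Longrightarrow> arr ?s1 A = arr s' A" for A
      using e_u by (auto simp: doubled_def fun_eq_iff arr_def state_simps)
    have a1: "arr ?s1 ''queue'' = arr s' ''queue''" "arr ?s1 ''bad'' = arr s' ''bad''"
      "arr ?s1 ''count'' = arr s' ''count''"
      by (rule arr1(2), simp)+
    have bnd: "int u \<le> B" "\<bar>2 * arr s ''energy'' u\<bar> \<le> B" "int u + 1 \<le> B" using F[OF lt] lt word_bounds by auto
    show "exec B ?body s' (\<lambda>\<tau> s''. \<exists>k'. I k' s'' \<and> k' + \<tau> + 1 \<le> k)"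
    proof -
      have "exec B reset_node ?s1 (\<lambda>\<tau> s''. exec B (increment ''u'') s''
          (\<lambda>\<tau>' s3. \<exists>k'. I k' s3 \<and> k' + (2 + (\<tau> + \<tau>')) + 1 \<le> k))"
        using exec_reset_node[OF lay1 v1(1) lt v1(2) tB]
      proof (rule exec_mono)
        fix \<tau> :: nat and s2
        assume *: "frame reset_vars {''queue'', ''bad'', ''count''} ?s1 s2 \<and>
          vars s2 ''t'' = int (d u + deg u) \<and>
          arr s2 ''queue'' = push u (arr ?s1 ''queue'') (d u) \<and>
          arr s2 ''bad'' = (\<lambda>x. if x < m \<and> src x = u then 0 else arr ?s1 ''bad'' x) \<and>
          arr s2 ''count'' = (arr ?s1 ''count'')(u := int (card {x. x < m \<and> src x = u})) \<and>
          \<tau> \<le> 8 * deg u + 8"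
        then have fr2: "frame reset_vars {''queue'', ''bad'', ''count''} ?s1 s2" and
          t2: "vars s2 ''t'' = int (d u + deg u)" and
          q2: "arr s2 ''queue'' = push u (arr s' ''queue'') (d u)" and
          b2: "arr s2 ''bad'' = (\<lambda>x. if x < m \<and> src x = u then 0 else arr s' ''bad'' x)" and
          c2: "arr s2 ''count'' = (arr s' ''count'')(u := int (card {x. x < m \<and> src x = u}))" and
          \<tau>: "\<tau> \<le> 8 * deg u + 8"
          unfolding a1 by blast+
        have e2: "arr s2 ''energy'' = (arr s' ''energy'')(u := doubled (arr s ''energy'' u))"
          unfolding arr1(1)[symmetric] by (rule arr_frame[OF fr2]) simp
        have u2: "vars s2 ''u'' = int u" using frame_var[OF fr2, of "''u''"] v1(1) by simp
        have "frame init_vars phase_arrays ?s1 s2" by (rule frame_mono[OF fr2]) auto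
        then have fr': "frame init_vars phase_arrays s s2" by (rule frame_trans[OF fr1])
        have dS: "d (Suc u) = d u + deg u" by (simp add: d_def)
        have "I (\<Sum>x\<in>{Suc u..<n}. 8 * deg x + 12) (set_var ''u'' (int u + 1) s2)"
          unfolding I_def
        proof (rule exI[of _ "Suc u"], intro conjI allI impI)
          show "frame init_vars phase_arrays s (set_var ''u'' (int u + 1) s2)"
            using fr' by (simp add: frame_set_var)
          show "arr (set_var ''u'' (int u + 1) s2) ''energy'' x =
            (if x < Suc u then doubled (arr s ''energy'' x) else arr s ''energy'' x)" if "x < n" for x
            using en[OF that] by (auto simp: e2)
          show "arr (set_var ''u'' (int u + 1) s2) ''bad'' e = 0" if "e < m" "src e < Suc u" for e
            using bad[OF that(1)] that by (auto simp: b2)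
          show "arr (set_var ''u'' (int u + 1) s2) ''count'' v = int (card {x. x < m \<and> src x = v})"
            if "v < Suc u" for v using cnt[of v] that by (auto simp: c2)
          show "\<exists>i<d (Suc u). arr (set_var ''u'' (int u + 1) s2) ''queue'' i = int e"
            if e: "e < m" "src e < Suc u" for e
          proof (cases "src e = u")
            case True
            then have "e \<in> set (incident u)" using e by (simp add: set_incident)
            then obtain i where "i < deg u" "incident u ! i = e" by (auto simp: in_set_conv_nth deg_def)
            then show ?thesis unfolding dS q2 arr_set_var
              by (intro exI[of _ "d u + i"]) (auto simp: push_def)
          next
            case False
            then obtain i where "i < d u" "arr s' ''queue'' i = int e" using Q1[OF e(1)] e(2) by auto
            then show ?thesis unfolding dS q2 arr_set_var by (intro exI[of _ i]) (auto simp: push_def)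
          qed
          show "\<exists>e<m. arr (set_var ''u'' (int u + 1) s2) ''queue'' i = int e" if "i < d (Suc u)" for i
          proof (cases "i < d u")
            case True
            then show ?thesis using Q2[OF True] unfolding q2 arr_set_var by (simp add: push_def)
          next
            case False
            then show ?thesis unfolding q2 arr_set_var using that incident_nth[of "i - d u" u]
              by (auto simp: push_def dS)
          qed
        qed (use lt t2 dS in \<open>auto simp: state_simps\<close>)
        moreover have "k = (\<Sum>x\<in>{Suc u..<n}. 8 * deg x + 12) + (8 * deg u + 12)"
          unfolding k using lt by (subst sum.atLeast_Suc_lessThan) auto
        ultimately show "exec B (increment ''u'') s2
            (\<lambda>\<tau>' s3. \<exists>k'. I k' s3 \<and> k' + (2 + (\<tau> + \<tau>')) + 1 \<le> k)"
          using bnd(3) \<tau> by (auto simp: exec_simps u2)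
      qed
      then show ?thesis using bnd e_u by (simp add: exec_simps vi split: if_split_asm)
    qed
  qed
  let ?s0 = "set_var ''u'' 0 (set_var ''t'' 0 s)"
  let ?k = "\<Sum>x\<in>{0..<n}. 8 * deg x + 12"
  have "I ?k ?s0"
    unfolding I_def by (intro exI[of _ 0]) (auto simp: exec_simps frame_refl d_def)
  note L = loop[OF this]
  have kk: "?k \<le> 16 * m + 12 * n"
  proof -
    have "?k = 8 * (\<Sum>x<n. deg x) + 12 * n"
      by (simp add: sum.distrib sum_distrib_left lessThan_atLeast0)
    then show ?thesis using sum_deg_le by linarith
  qed
  have "exec B (Loop ?guard ?body) ?s0 (\<lambda>\<tau> s'. frame init_vars phase_arrays s s' \<and>
     vars s' ''t'' = int (\<Sum>u<n. deg u) \<and>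
     (\<forall>u<n. arr s' ''energy'' u = doubled (arr s ''energy'' u)) \<and>
     (\<forall>e<m. arr s' ''bad'' e = 0) \<and>
     (\<forall>u<n. arr s' ''count'' u = int (card {x. x < m \<and> src x = u})) \<and>
     (\<forall>e<m. \<exists>i<(\<Sum>u<n. deg u). arr s' ''queue'' i = int e) \<and>
     (\<forall>i<(\<Sum>u<n. deg u). \<exists>e<m. arr s' ''queue'' i = int e) \<and>
     2 + \<tau> \<le> 12 * n + 16 * m + 3)"
    using L
  proof (rule exec_mono)
    fix \<tau> :: nat and s' assume "\<exists>k'. I k' s' \<and> \<not> bval ?guard s' \<and> \<tau> + k' \<le> ?k + 1"
    then obtain k' where Ik: "I k' s'" and g: "\<not> bval ?guard s'" and \<tau>: "\<tau> + k' \<le> ?k + 1" by blast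
    from Ik obtain u where un: "u \<le> n" and fr: "frame init_vars phase_arrays s s'" and
      vi: "vars s' ''u'' = int u" "vars s' ''t'' = int (d u)" and
      en: "\<forall>x<n. arr s' ''energy'' x = (if x < u then doubled (arr s ''energy'' x) else arr s ''energy'' x)" and
      bad: "\<forall>e<m. src e < u \<longrightarrow> arr s' ''bad'' e = 0" and
      cnt: "\<forall>v<u. arr s' ''count'' v = int (card {x. x < m \<and> src x = v})" and
      Q1: "\<forall>e<m. src e < u \<longrightarrow> (\<exists>i<d u. arr s' ''queue'' i = int e)" and
      Q2: "\<forall>i<d u. \<exists>e<m. arr s' ''queue'' i = int e" unfolding I_def by blast
    have lay': "layout s'" by (rule layout_frame[OF lay fr]) simp_all
    have "u = n" using g vi un layoutD(1)[OF lay'] by simp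
    then show "frame init_vars phase_arrays s s' \<and>
     vars s' ''t'' = int (\<Sum>u<n. deg u) \<and>
     (\<forall>u<n. arr s' ''energy'' u = doubled (arr s ''energy'' u)) \<and>
     (\<forall>e<m. arr s' ''bad'' e = 0) \<and>
     (\<forall>u<n. arr s' ''count'' u = int (card {x. x < m \<and> src x = u})) \<and>
     (\<forall>e<m. \<exists>i<(\<Sum>u<n. deg u). arr s' ''queue'' i = int e) \<and>
     (\<forall>i<(\<Sum>u<n. deg u). \<exists>e<m. arr s' ''queue'' i = int e) \<and>
     2 + \<tau> \<le> 12 * n + 16 * m + 3"
      using fr vi(2) en bad cnt Q1 Q2 src_less kk \<tau> unfolding d_def by auto
  qed
  then show ?thesis
    using word_bounds unfolding init_phase_def by (simp add: exec_simps)
qed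

section \<open>One edge, one queue, one phase\<close>

abbreviation "process_vars \<equiv> {''c'', ''i'', ''e'', ''t'', ''u'', ''q'', ''h'', ''v''}"

definition state_worklist :: "int \<Rightarrow> (nat \<Rightarrow> int) \<Rightarrow> nat \<Rightarrow> nat \<Rightarrow> state \<Rightarrow> bool" where
  "state_worklist b F0 h t s \<longleftrightarrow> layout s \<and> 0 < b \<and> vars s ''b'' = b \<and>
     vars s ''h'' = int h \<and> vars s ''t'' = int t \<and>
     worklist b F0 (arr s ''energy'') (arr s ''bad'') (arr s ''count'') (arr s ''queue'') h t"

text \<open>The longest branch costs four assignments, the outer conditional, two writes, the inner
  conditional, two steps for the new energy and 8 for \<open>reset_node\<close>, which makes 18;
  each inserted edge adds 8.\<close>

lemma exec_process_edge:
  assumes wl: "state_worklist b F0 h t s" and h: "h < t" and tB: "int t + int m \<le> B"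
  shows "exec B process_edge s (\<lambda>\<tau> s'. \<exists>t'\<ge>t. t' \<le> t + m \<and>
     frame process_vars phase_arrays s s' \<and> state_worklist b F0 (Suc h) t' s' \<and>
     \<tau> \<le> 18 + 8 * (t' - t))"
proof -
  have lay: "layout s" and b: "0 < b" "vars s ''b'' = b" and v: "vars s ''h'' = int h" "vars s ''t'' = int t"
    and w: "worklist b F0 (arr s ''energy'') (arr s ''bad'') (arr s ''count'') (arr s ''queue'') h t"
    using wl by (auto simp: state_worklist_def)
  note D = worklistD[OF w]
  obtain e where em: "e < m" and q: "arr s ''queue'' h = int e" using D(7)[OF h] by blast
  let ?F = "arr s ''energy''"
  note look = layoutD(3)[OF lay] layoutD(4)[OF lay src_less[OF em]] layoutD(7-9)[OF lay em]
  have q': "arrays s ''queue'' (int h) = int e" using q by (simp add: arr_def)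
  have hB: "int h + 1 \<le> B" "int e \<le> B" "int (src e) \<le> B" "int (tgt e) \<le> B"
    using h tB em src_less[OF em] tgt_less[OF em] word_bounds by linarith+
  define u where "u = src e"
  have un: "u < n" unfolding u_def by (rule src_less[OF em])
  let ?s1 = "set_var ''v'' (int (tgt e)) (set_var ''u'' (int u) (set_var ''h'' (int h + 1) (set_var ''q'' (int e) s)))"
  have viol: "violated b ?F e \<longleftrightarrow> \<not> ?F u < 0 \<and> \<not> (\<not> ?F (tgt e) < 0 \<and>
      \<not> ?F u - (0 - weight \<Gamma> (es ! e)) div b < ?F (tgt e))"
    by (auto simp: violated_def rounded_def u_def)
  have fr1: "frame process_vars phase_arrays s ?s1" by (simp add: frame_set_var frame_refl)
  have cB: "\<bar>arr s ''count'' u - 1\<bar> \<le> B"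
  proof -
    have "card {x. x < m \<and> src x = u \<and> arr s ''bad'' x = 0} \<le> card {..<m}" by (intro card_mono) auto
    then show ?thesis using D(5,6)[OF un] word_bounds(3) by simp
  qed
  let ?cond = "Conj (Less (Read ''bad'' (Var ''q'')) (Const 1))
        (Conj (Neg (Less (Read ''energy'' (Var ''u'')) (Const 0)))
          (Neg (Conj (Neg (Less (Read ''energy'' (Var ''v'')) (Const 0)))
            (Neg (Less
              (Sub (Read ''energy'' (Var ''u''))
                (Quot (Sub (Const 0) (Read ''weight'' (Var ''q''))) (Var ''b'')))
              (Read ''energy'' (Var ''v'')))))))"
  have cond: "bval ?cond ?s1 \<longleftrightarrow> arr s ''bad'' e \<noteq> 1 \<and> violated b ?F e"
    using D(4)[OF em] look(5) b(2) unfolding viol by (auto simp: state_simps arr_def)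
  let ?raise = "block
              [Cond (Less (Read ''energy'' (Var ''u'')) (Quot (Var ''M'') (Var ''b'')))
                 (Write ''energy'' (Var ''u'') (Add (Read ''energy'' (Var ''u'')) (Const 1)))
                 (Write ''energy'' (Var ''u'') (Const (- 1))),
               reset_node]"
  let ?mark = "block
         [Write ''bad'' (Var ''q'') (Const 1),
          Write ''count'' (Var ''u'') (Sub (Read ''count'' (Var ''u'')) (Const 1)),
          Cond (Conj (Less (Const 0) (Read ''count'' (Var ''u'')))
                 (Less (Const 0) (Read ''alice'' (Var ''u''))))
            Skip ?raise]"
  let ?P = "\<lambda>\<tau> s'. \<exists>t'\<ge>t. t' \<le> t + m \<and> frame process_vars phase_arrays s s' \<and>
     state_worklist b F0 (Suc h) t' s' \<and> \<tau> \<le> 18 + 8 * (t' - t)"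
  have "exec B (Cond ?cond ?mark Skip) ?s1 (\<lambda>\<tau>. ?P (4 + \<tau>))"
  proof (cases "bval ?cond ?s1")
    case False
    have "worklist b F0 ?F (arr s ''bad'') (arr s ''count'') (arr s ''queue'') (Suc h) t"
      using False cond by (intro worklist_skip[OF w h q]) auto
    then have "state_worklist b F0 (Suc h) t ?s1"
      using layout_frame[OF lay fr1] b v by (simp add: state_worklist_def state_simps)
    then show ?thesis using False fr1 by (auto simp: exec_Cond exec_Skip simp del: bval.simps)
  next
    case True
    then have e: "violated b ?F e" "arr s ''bad'' e \<noteq> 1" using cond by auto
    let ?s2 = "set_array ''count'' (int u) (arr s ''count'' u - 1) (set_array ''bad'' (int e) 1 ?s1)"
    have fr2: "frame process_vars phase_arrays s ?s2" by (simp add: frame_set_var frame_set_array frame_refl)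
    have lay2: "layout ?s2" by (rule layout_frame[OF lay fr2]) simp_all
    have cnt: "arrays s ''count'' (int u) = arr s ''count'' u" by (simp add: arr_def)
    have al: "arrays s ''alice'' (int u) = of_bool (u \<in> alice \<Gamma>)" using look(2) by (simp add: u_def)
    have "exec B (Cond (Conj (Less (Const 0) (Read ''count'' (Var ''u'')))
                 (Less (Const 0) (Read ''alice'' (Var ''u'')))) Skip ?raise) ?s2 (\<lambda>\<tau>. ?P (4 + Suc (2 + \<tau>)))"
    proof (cases "arr s ''count'' u \<noteq> 1 \<and> u \<in> alice \<Gamma>")
      case c: True
      have "worklist b F0 ?F ((arr s ''bad'')(e := 1)) ((arr s ''count'')(u := arr s ''count'' u - 1))
          (arr s ''queue'') (Suc h) t"
        using worklist_mark[OF w h q e] c by (simp add: u_def)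
      then have "state_worklist b F0 (Suc h) t ?s2"
        using lay2 b v by (simp add: state_worklist_def state_simps)
      moreover have "0 < arr s ''count'' u" by (rule D(6)[OF un])
      ultimately show ?thesis using c fr2 al by (auto simp: exec_simps)
    next
      case c: False
      have guard: "\<not> (0 < arr s ''count'' u - 1 \<and> 0 < (of_bool (u \<in> alice \<Gamma>) :: int))"
        using c D(6)[OF un] by auto
      define x where "x = raised b (?F u)"
      let ?s3 = "set_array ''energy'' (int u) x ?s2"
      have fr3: "frame process_vars phase_arrays s ?s3" using fr2 by (simp add: frame_set_array)
      have lay3: "layout ?s3" by (rule layout_frame[OF lay fr3]) simp_all
      have v3: "vars ?s3 ''u'' = int u" "vars ?s3 ''t'' = int t" using v by (simp_all add: state_simps)
      have Fu: "0 \<le> ?F u" using e(1) by (simp add: violated_def u_def)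
      have NB: "N div b \<le> B" 
      proof -
        have "N div b \<le> N div 1" using b by (intro zdiv_mono2) auto
        then show ?thesis using word_bounds by simp
      qed
      have xB: "\<bar>?F u + 1\<bar> \<le> B" if "?F u < N div b" using that Fu NB by simp
      \<comment> \<open>The invariant is advanced from the arrays before the marking. This fits
        because \<open>reset_node\<close> clears the mark of \<open>e\<close>, which leaves
        \<open>u\<close>, and recomputes the count of \<open>u\<close>.\<close>
      have w': "worklist b F0 (?F(u := x)) (\<lambda>x. if x < m \<and> src x = u then 0 else arr s ''bad'' x)
        ((arr s ''count'')(u := int (card {x. x < m \<and> src x = u}))) (push u (arr s ''queue'') t) (Suc h) (t + deg u)"
        unfolding x_def by (rule worklist_raise[OF b(1) w h q e]) (use c in \<open>auto simp: u_def\<close>)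
      have "exec B reset_node ?s3 (\<lambda>\<tau>. ?P (4 + Suc (2 + Suc (2 + \<tau>))))"
        using exec_reset_node[OF lay3 v3(1) un v3(2) tB]
      proof (rule exec_mono)
        fix \<tau> :: nat and s4
        assume *: "frame reset_vars {''queue'', ''bad'', ''count''} ?s3 s4 \<and>
          vars s4 ''t'' = int (t + deg u) \<and>
          arr s4 ''queue'' = push u (arr ?s3 ''queue'') t \<and>
          arr s4 ''bad'' = (\<lambda>x. if x < m \<and> src x = u then 0 else arr ?s3 ''bad'' x) \<and>
          arr s4 ''count'' = (arr ?s3 ''count'')(u := int (card {x. x < m \<and> src x = u})) \<and>
          \<tau> \<le> 8 * deg u + 8"
        then have fr4: "frame reset_vars {''queue'', ''bad'', ''count''} ?s3 s4" by blast
        have e4: "arr s4 ''energy'' = ?F(u := x)"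
          using arr_frame[OF fr4, of "''energy''"] by simp
        have b4: "arr s4 ''bad'' = (\<lambda>x. if x < m \<and> src x = u then 0 else arr s ''bad'' x)"
          using * em by (auto simp: u_def fun_eq_iff)
        have c4: "arr s4 ''count'' = (arr s ''count'')(u := int (card {x. x < m \<and> src x = u}))"
          using * by simp
        have q4: "arr s4 ''queue'' = push u (arr s ''queue'') t" using * by simp
        have "frame process_vars phase_arrays ?s3 s4" by (rule frame_mono[OF fr4]) auto
        then have fr: "frame process_vars phase_arrays s s4" by (rule frame_trans[OF fr3])
        have lay4: "layout s4" by (rule layout_frame[OF lay fr]) simp_all
        have h4: "vars s4 ''h'' = int (Suc h)" using frame_var[OF fr4, of "''h''"] by (simp add: state_simps)
        have b4': "vars s4 ''b'' = b" using frame_var[OF fr, of "''b''"] b by simp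
        have "state_worklist b F0 (Suc h) (t + deg u) s4"
          unfolding state_worklist_def e4 b4 c4 q4 using lay4 b(1) b4' h4 * w' by simp
        then show "?P (4 + Suc (2 + Suc (2 + \<tau>))) s4"
          using fr * deg_le[of u] by (intro exI[of _ "t + deg u"]) auto
      qed
      moreover have "arrays s ''energy'' (int u) = ?F u" by (simp add: arr_def)
      ultimately show ?thesis using guard al xB word_bounds(1) hB(3) un b(2)
        by (auto simp: exec_simps look x_def raised_def u_def)
    qed
    then show ?thesis
      unfolding exec_Cond[of B ?cond] if_P[OF True]
      using hB cB cnt word_bounds(1) by (simp add: exec_Seq exec_Write state_simps u_def)
  qed
  then show ?thesis using hB v q' look unfolding process_edge_def
    by (simp add: exec_Seq exec_Assign increment_def state_simps u_def)
qed


lemma budget_int: "int (2 * m * (L + 1)) = 2 * int m * (int L + 1)"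
  by (simp add: algebra_simps)

text \<open>Amortization: removing an edge costs 18 steps and a test, paid by
  \<open>19 * (?T - h)\<close>, and inserting one costs 8, paid by \<open>8 * (?T - t)\<close>.
  \<open>?T\<close> exceeds the threshold for giving up by \<open>m\<close>, since the last raise
  before the test can still insert up to \<open>m\<close> edges.\<close>

lemma exec_worklist_loop:
  assumes lay: "layout s" and b: "0 < b" "vars s ''b'' = b" and t: "vars s ''t'' = int t0" "t0 \<le> 2 * m"
    and l: "vars s ''l'' = int L" and T: "int (2 * m * (L + 1) + m) \<le> B"
    and w: "worklist b F0 (arr s ''energy'') (arr s ''bad'') (arr s ''count'') (arr s ''queue'') 0 t0"
  shows "exec B worklist_loop s (\<lambda>\<tau> s'. \<exists>h t. frame process_vars phase_arrays s s' \<and>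
     state_worklist b F0 h t s' \<and> (h = t \<or> 2 * m * (L + 1) < t) \<and> \<tau> \<le> 27 * (2 * m * (L + 1) + m) + 2)"
proof -
  let ?guard = "Conj (Less (Var ''h'') (Var ''t''))
         (Neg (Less (Mul (Mul (Const 2) (Var ''m'')) (Add (Var ''l'') (Const 1))) (Var ''t'')))"
  let ?T = "2 * m * (L + 1) + m"
  define I where "I k s' \<longleftrightarrow> (\<exists>h t. frame process_vars phase_arrays s s' \<and> state_worklist b F0 h t s' \<and>
     t \<le> ?T \<and> k = 19 * (?T - h) + 8 * (?T - t))" for k :: nat and s'
  have guard: "bval ?guard s' \<longleftrightarrow> h < t \<and> t \<le> 2 * m * (L + 1)"
    if fr: "frame process_vars phase_arrays s s'" and wl: "state_worklist b F0 h t s'" for s' h t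
  proof -
    have lay': "layout s'" using wl by (simp add: state_worklist_def)
    have v: "vars s' ''h'' = int h" "vars s' ''t'' = int t" "vars s' ''l'' = int L"
      using wl frame_var[OF fr, of "''l''"] l by (simp_all add: state_worklist_def)
    have "int t \<le> 2 * int m * (int L + 1) \<longleftrightarrow> int t \<le> int (2 * m * (L + 1))"
      by (simp only: budget_int)
    then show ?thesis unfolding of_nat_le_iff by (simp add: v layoutD(2)[OF lay'] not_less)
  qed
  have loop: "exec B (Loop ?guard process_edge) s0 (\<lambda>\<tau> s'. \<exists>k'. I k' s' \<and> \<not> bval ?guard s' \<and> \<tau> + k' \<le> k + 1)"
    if "I k s0" for k s0
  proof (rule exec_Loop[where I = I, OF _ that])
    fix k s' assume "I k s'" and g: "bval ?guard s'"
    then obtain h t where fr: "frame process_vars phase_arrays s s'" and wl: "state_worklist b F0 h t s'"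
      and k: "k = 19 * (?T - h) + 8 * (?T - t)" unfolding I_def by blast
    have ht: "h < t" "t \<le> 2 * m * (L + 1)" using g guard[OF fr wl] by auto
    have "int t + int m \<le> B" using T ht(2) by linarith
    from exec_process_edge[OF wl ht(1) this]
    show "exec B process_edge s' (\<lambda>\<tau> s''. \<exists>k'. I k' s'' \<and> k' + \<tau> + 1 \<le> k)"
    proof (rule exec_mono)
      fix \<tau> :: nat and s''
      assume "\<exists>t'\<ge>t. t' \<le> t + m \<and> frame process_vars phase_arrays s' s'' \<and>
        state_worklist b F0 (Suc h) t' s'' \<and> \<tau> \<le> 18 + 8 * (t' - t)"
      then obtain t' where t': "t \<le> t'" "t' \<le> t + m" and fr': "frame process_vars phase_arrays s' s''" and
        wl': "state_worklist b F0 (Suc h) t' s''" and \<tau>: "\<tau> \<le> 18 + 8 * (t' - t)" by blast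
      have "t' \<le> ?T" using t' ht(2) by linarith
      then have "I (19 * (?T - Suc h) + 8 * (?T - t')) s''"
        unfolding I_def using frame_trans[OF fr fr'] wl' by blast
      moreover have "19 * (?T - Suc h) + 8 * (?T - t') + \<tau> + 1 \<le> k"
        using k \<tau> t' \<open>t' \<le> ?T\<close> ht by linarith
      ultimately show "\<exists>k'. I k' s'' \<and> k' + \<tau> + 1 \<le> k" by blast
    qed
  qed
  let ?s0 = "set_var ''h'' 0 s"
  have "I (19 * ?T + 8 * (?T - t0)) ?s0"
  proof -
    have fr: "frame process_vars phase_arrays s ?s0" by (simp add: frame_set_var frame_refl)
    have "layout ?s0" by (rule layout_frame[OF lay fr]) simp_all
    then have "state_worklist b F0 0 t0 ?s0" using b t w by (simp add: state_worklist_def state_simps)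
    moreover have "t0 \<le> ?T" using t(2) by (simp add: algebra_simps)
    ultimately show ?thesis unfolding I_def using fr by (intro exI[of _ 0] exI[of _ t0]) simp
  qed
  note L = loop[OF this]
  have "exec B (Loop ?guard process_edge) ?s0 (\<lambda>\<tau> s'. \<exists>h t. frame process_vars phase_arrays s s' \<and>
     state_worklist b F0 h t s' \<and> (h = t \<or> 2 * m * (L + 1) < t) \<and> 1 + \<tau> \<le> 27 * ?T + 2)"
    using L
  proof (rule exec_mono)
    fix \<tau> :: nat and s'
    assume "\<exists>k'. I k' s' \<and> \<not> bval ?guard s' \<and> \<tau> + k' \<le> 19 * ?T + 8 * (?T - t0) + 1"
    then obtain k' where I: "I k' s'" and g: "\<not> bval ?guard s'"
      and \<tau>: "\<tau> + k' \<le> 19 * ?T + 8 * (?T - t0) + 1" by blast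
    from I obtain h t where fr: "frame process_vars phase_arrays s s'" and wl: "state_worklist b F0 h t s'"
      unfolding I_def by blast
    have "h \<le> t" using wl worklistD(8) unfolding state_worklist_def by blast
    then have "h = t \<or> 2 * m * (L + 1) < t" using g guard[OF fr wl] by linarith
    moreover have "8 * (?T - t0) \<le> 8 * ?T" by simp
    then have "1 + \<tau> \<le> 27 * ?T + 2" using \<tau> by linarith
    ultimately show "\<exists>h t. frame process_vars phase_arrays s s' \<and> state_worklist b F0 h t s' \<and>
       (h = t \<or> 2 * m * (L + 1) < t) \<and> 1 + \<tau> \<le> 27 * ?T + 2" using fr wl by blast
  qed
  then show ?thesis using word_bounds(1) unfolding worklist_loop_def
    by (simp add: exec_Seq exec_Assign)
qed

lemma ready_cong: "ready g b F l \<Longrightarrow> (\<And>u. u < n \<Longrightarrow> F' u = F u) \<Longrightarrow> ready g b F' l"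
  by (auto simp: ready_def lower_def)

lemma mn_ge: "n \<le> m * n" "m \<le> m * n" "1 \<le> m * n"
  using n_pos m_pos by (auto simp: Suc_le_eq)

lemma budget_bound: "L \<le> nat N + 2 * n + 1 \<Longrightarrow> int (2 * m * (L + 1) + m) \<le> B"
proof -
  assume "L \<le> nat N + 2 * n + 1"
  then have "int L + 1 \<le> N + 2 * int n + 2" by linarith
  then have "2 * int m * (int L + 1) \<le> 2 * int m * (N + 2 * int n + 2)" by (intro mult_left_mono) auto
  moreover have "2 * int m * (N + 2 * int n + 2) + 4 * int m = 2 * int m * (N + 2 * int n + 4)"
    by (simp add: algebra_simps)
  moreover have "0 \<le> int n * int m" "0 \<le> N" by simp_all
  ultimately show ?thesis using word unfolding of_nat_add budget_int by linarith
qed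

abbreviation "phase_vars \<equiv> {''c'', ''i'', ''e'', ''t'', ''u'', ''q'', ''h'', ''v'', ''b'', ''l''}"

text \<open>The second outcome, a fixpoint below the true energies, can occur for good and refutable
  guesses alike; only giving up has to be justified, and that is by
  \<open>worklist_tail\<close>.\<close>

lemma exec_phase:
  assumes lay: "layout s" and b: "vars s ''b'' = b" and "b \<le> B" and l: "vars s ''l'' = int L" "L \<le> nat N + 2 * n + 1"
    and r: "ready g b F (int L)" and F: "\<And>u. u < n \<Longrightarrow> F u = doubled (arr s ''energy'' u)"
  shows "exec B phase s (\<lambda>\<tau> s'. frame phase_vars phase_arrays s s' \<and> \<tau> \<le> 120 * m * (L + n) \<and>
     (vars s' ''b'' = - 1 \<and> \<not> good g \<or>
      vars s' ''b'' = b div 2 \<and> vars s' ''l'' = 2 * int n \<and>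
      lower b (arr s' ''energy'') \<and> fixpoint b (arr s' ''energy'')))"
proof -
  have bpos: "0 < b" and low: "lower b F" using r by (auto simp: ready_def)
  have NB: "N div b \<le> N"
  proof -
    have "N div b \<le> N div 1" using bpos by (intro zdiv_mono2) auto
    then show ?thesis by simp
  qed
  have "\<bar>2 * arr s ''energy'' u\<bar> \<le> B" if "u < n" for u
    using lowerD(1,2)[OF low that] F[OF that] NB word_bounds n_pos
    by (auto simp: doubled_def split: if_split_asm)
  note init = exec_init_phase[OF lay this]
  let ?T = "2 * m * (L + 1) + m"
  \<comment> \<open>Besides \<open>54 * (m * L)\<close> the steps number
    \<open>12 * n + 97 * m + 8\<close>, which is at most \<open>117 * (m * n)\<close>; the factor
    120 covers both.\<close>
  have time: "12 * n + 16 * m + 3 + (27 * ?T + 2) + 3 \<le> 120 * m * (L + n)"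
  proof -
    have "12 * n + 16 * m + 3 + (27 * ?T + 2) + 3 = 54 * (m * L) + 12 * n + 97 * m + 8"
      by (simp add: algebra_simps)
    also have "\<dots> \<le> 120 * (m * L) + 120 * (m * n)" using mn_ge by linarith
    finally show ?thesis by (simp add: algebra_simps)
  qed
  let ?Q = "\<lambda>\<tau> s'. frame phase_vars phase_arrays s s' \<and> \<tau> \<le> 120 * m * (L + n) \<and>
     (vars s' ''b'' = - 1 \<and> \<not> good g \<or>
      vars s' ''b'' = b div 2 \<and> vars s' ''l'' = 2 * int n \<and>
      lower b (arr s' ''energy'') \<and> fixpoint b (arr s' ''energy''))"
  let ?last = "Cond (Less (Var ''h'') (Var ''t''))
       (Assign ''b'' (Const (- 1)))
       (block
         [Assign ''b'' (Quot (Var ''b'') (Const 2)),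
          Assign ''l'' (Mul (Const 2) (Var ''n''))])"
  have "exec B init_phase s (\<lambda>\<tau> s1. exec B worklist_loop s1 (\<lambda>\<tau>1 s2. exec B ?last s2 (\<lambda>\<tau>2. ?Q (\<tau> + (\<tau>1 + \<tau>2)))))"
    using init
  proof (rule exec_mono)
    let ?t0 = "\<Sum>u<n. deg u"
    fix \<tau> :: nat and s1
    assume *: "frame init_vars phase_arrays s s1 \<and>
     vars s1 ''t'' = int ?t0 \<and>
     (\<forall>u<n. arr s1 ''energy'' u = doubled (arr s ''energy'' u)) \<and>
     (\<forall>e<m. arr s1 ''bad'' e = 0) \<and>
     (\<forall>u<n. arr s1 ''count'' u = int (card {x. x < m \<and> src x = u})) \<and>
     (\<forall>e<m. \<exists>i<?t0. arr s1 ''queue'' i = int e) \<and>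
     (\<forall>i<?t0. \<exists>e<m. arr s1 ''queue'' i = int e) \<and>
     \<tau> \<le> 12 * n + 16 * m + 3"
    then have fr1: "frame init_vars phase_arrays s s1" and t1: "vars s1 ''t'' = int ?t0"
      and \<tau>: "\<tau> \<le> 12 * n + 16 * m + 3" by blast+
    have lay1: "layout s1" by (rule layout_frame[OF lay fr1]) simp_all
    have b1: "vars s1 ''b'' = b" and l1: "vars s1 ''l'' = int L"
      using frame_var[OF fr1, of "''b''"] frame_var[OF fr1, of "''l''"] b l by simp_all
    have r1: "ready g b (arr s1 ''energy'') (int L)" by (rule ready_cong[OF r]) (use * F in simp)
    then have low1: "lower b (arr s1 ''energy'')" by (simp add: ready_def)
    have w: "worklist b (arr s1 ''energy'') (arr s1 ''energy'') (arr s1 ''bad'') (arr s1 ''count'')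
        (arr s1 ''queue'') 0 ?t0"
      by (rule worklist_initial[OF low1]) (use * in blast)+
    show "exec B worklist_loop s1 (\<lambda>\<tau>1 s2. exec B ?last s2 (\<lambda>\<tau>2. ?Q (\<tau> + (\<tau>1 + \<tau>2))))"
      using exec_worklist_loop[OF lay1 bpos b1 t1 sum_deg_le l1 budget_bound[OF l(2)] w]
    proof (rule exec_mono)
      fix \<tau>1 :: nat and s2
      assume "\<exists>h t. frame process_vars phase_arrays s1 s2 \<and>
        state_worklist b (arr s1 ''energy'') h t s2 \<and> (h = t \<or> 2 * m * (L + 1) < t) \<and> \<tau>1 \<le> 27 * ?T + 2"
      then obtain h t where fr2: "frame process_vars phase_arrays s1 s2" and
        wl: "state_worklist b (arr s1 ''energy'') h t s2" and ht: "h = t \<or> 2 * m * (L + 1) < t" and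
        \<tau>1: "\<tau>1 \<le> 27 * ?T + 2" by blast
      have "frame phase_vars phase_arrays s s1" by (rule frame_mono[OF fr1]) auto
      moreover have "frame phase_vars phase_arrays s1 s2" by (rule frame_mono[OF fr2]) auto
      ultimately have fr: "frame phase_vars phase_arrays s s2" by (rule frame_trans)
      have lay2: "layout s2" and v2: "vars s2 ''h'' = int h" "vars s2 ''t'' = int t" "vars s2 ''b'' = b"
        and w2: "worklist b (arr s1 ''energy'') (arr s2 ''energy'') (arr s2 ''bad'') (arr s2 ''count'')
          (arr s2 ''queue'') h t" using wl by (auto simp: state_worklist_def)
      have tt: "\<tau> + (\<tau>1 + \<tau>2) \<le> 120 * m * (L + n)" if "\<tau>2 \<le> 3" for \<tau>2
        using \<tau> \<tau>1 that time by linarith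
      show "exec B ?last s2 (\<lambda>\<tau>2. ?Q (\<tau> + (\<tau>1 + \<tau>2)))"
      proof (cases "h < t")
        case True
        then have "2 * m * (L + 1) < t" using ht by simp
        then have "int (2 * m * (L + 1)) < int t" by (simp only: of_nat_less_iff)
        then have "\<not> good g" using worklist_tail[OF w2 r1] unfolding budget_int by linarith
        then show ?thesis using True fr tt[of 2] word_bounds(1) by (simp add: exec_simps v2)
      next
        case False
        then have "h = t" using worklistD(8)[OF w2] by simp
        then have fp: "fixpoint b (arr s2 ''energy'')" using w2 worklist_fixpoint by simp
        have low2: "lower b (arr s2 ''energy'')" by (rule worklistD(1)[OF w2])
        have bB: "\<bar>b div 2\<bar> \<le> B"
          using bpos \<open>b \<le> B\<close> by linarith
        show ?thesis
          using False fr tt[of 3] word_bounds(5) bB fp low2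
          by (simp add: exec_simps v2 layoutD(1)[OF lay2])
      qed
    qed
  qed
  then show ?thesis unfolding phase_def by (simp add: exec_Seq)
qed


section \<open>All phases for one guess, and the search for a guess\<close>

definition finished :: "state \<Rightarrow> bool" where
  "finished s \<longleftrightarrow> (\<forall>u<n. arr s ''energy'' u = encode_energy (minimal_energy \<Gamma> u))"

text \<open>Only the first phase depends on \<open>M\<close> through \<open>L\<close>. Each of the
  \<open>i\<close> later ones has \<open>L = 2 * n\<close> and costs
  \<open>120 * m * (3 * n)\<close>, hence the 360.\<close>

lemma exec_phases:
  assumes lay: "layout s" and b: "vars s ''b'' = 2 ^ i" and gB: "2 ^ i \<le> B"
    and l: "vars s ''l'' = int L" "L \<le> nat N + 2 * n + 1"
    and r: "ready (2 ^ i) (2 ^ i) F (int L)" and F: "\<And>u. u < n \<Longrightarrow> F u = doubled (arr s ''energy'' u)"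
  shows "exec B (Loop (Less (Const 0) (Var ''b'')) phase) s (\<lambda>\<tau> s'.
     frame phase_vars phase_arrays s s' \<and> \<tau> \<le> 120 * m * (L + n) + 2 + i * (360 * m * n + 1) \<and>
     (vars s' ''b'' = 0 \<and> finished s' \<or> vars s' ''b'' = - 1 \<and> \<not> good (2 ^ i)))"
proof -
  let ?guard = "Less (Const 0) (Var ''b'')"
  \<comment> \<open>\<open>ready\<close> refers to the values after the doubling that opens the next
    phase. After the last phase none follows, so the output is not doubled.\<close>
  define I where "I k s' \<longleftrightarrow> frame phase_vars phase_arrays s s' \<and>
    ((\<exists>j\<le>i. \<exists>L F. vars s' ''b'' = 2 ^ j \<and> vars s' ''l'' = int L \<and> L \<le> nat N + 2 * n + 1 \<and>
        ready (2 ^ i) (2 ^ j) F (int L) \<and> (\<forall>u<n. F u = doubled (arr s' ''energy'' u)) \<and>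
        k = 120 * m * (L + n) + 1 + j * (360 * m * n + 1)) \<or>
     vars s' ''b'' = 0 \<and> finished s' \<and> k = 0 \<or>
     vars s' ''b'' = - 1 \<and> \<not> good (2 ^ i) \<and> k = 0)" for k :: nat and s'
  let ?k = "120 * m * (L + n) + 1 + i * (360 * m * n + 1)"
  have "I ?k s" unfolding I_def using frame_refl b l r F by blast
  then have "exec B (Loop ?guard phase) s (\<lambda>\<tau> s'. \<exists>k'. I k' s' \<and> \<not> bval ?guard s' \<and> \<tau> + k' \<le> ?k + 1)"
  proof (rule exec_Loop[where I = I, rotated])
    fix k s1 assume I: "I k s1" and g: "bval ?guard s1"
    have fr1: "frame phase_vars phase_arrays s s1" using I by (simp add: I_def)
    have lay1: "layout s1" by (rule layout_frame[OF lay fr1]) simp_all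
    from I g obtain j L F where j: "j \<le> i" and b1: "vars s1 ''b'' = 2 ^ j" and
      l1: "vars s1 ''l'' = int L" "L \<le> nat N + 2 * n + 1" and
      r1: "ready (2 ^ i) (2 ^ j) F (int L)" and F1: "\<And>u. u < n \<Longrightarrow> F u = doubled (arr s1 ''energy'' u)" and
      k: "k = 120 * m * (L + n) + 1 + j * (360 * m * n + 1)" unfolding I_def by auto
    have jB: "(2::int) ^ j \<le> B" using power_increasing[OF j, of "2::int"] gB by linarith
    show "exec B phase s1 (\<lambda>\<tau> s'. \<exists>k'. I k' s' \<and> k' + \<tau> + 1 \<le> k)"
      using exec_phase[OF lay1 b1 jB l1 r1 F1]
    proof (rule exec_mono)
      fix \<tau> :: nat and s2
      assume *: "frame phase_vars phase_arrays s1 s2 \<and> \<tau> \<le> 120 * m * (L + n) \<and>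
       (vars s2 ''b'' = - 1 \<and> \<not> good (2 ^ i) \<or>
        vars s2 ''b'' = 2 ^ j div 2 \<and> vars s2 ''l'' = 2 * int n \<and>
        lower (2 ^ j) (arr s2 ''energy'') \<and> fixpoint (2 ^ j) (arr s2 ''energy''))"
      have fr2: "frame phase_vars phase_arrays s s2" using frame_trans[OF fr1] * by blast
      consider "vars s2 ''b'' = - 1 \<and> \<not> good (2 ^ i)" |
        "vars s2 ''b'' = 2 ^ j div 2" "vars s2 ''l'' = 2 * int n"
        "lower (2 ^ j) (arr s2 ''energy'')" "fixpoint (2 ^ j) (arr s2 ''energy'')" using * by blast
      then show "\<exists>k'. I k' s2 \<and> k' + \<tau> + 1 \<le> k"
      proof cases
        case 1
        then have "I 0 s2" unfolding I_def using fr2 by blast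
        then show ?thesis using * k by (intro exI[of _ 0]) linarith
      next
        case 2
        show ?thesis
        proof (cases j)
          case 0
          then have "finished s2" using fixpoint_exact 2 by (simp add: finished_def)
          then have "I 0 s2" unfolding I_def using fr2 2(1) 0 by simp
          then show ?thesis using * k by (intro exI[of _ 0]) linarith
        next
          case (Suc j')
          have p: "(2::int) * 2 ^ j' = 2 ^ j" using Suc by simp
          have le: "(2::int) * 2 ^ j' \<le> 2 ^ i" unfolding p using j by (rule power_increasing) simp
          have "ready (2 ^ i) (2 ^ j') (\<lambda>u. doubled (arr s2 ''energy'' u)) (2 * int n)"
            by (rule ready_next[OF _ le]) (use 2 p in \<open>auto simp: doubled_def\<close>)
          then have "I (120 * m * (2 * n + n) + 1 + j' * (360 * m * n + 1)) s2"
            unfolding I_def using fr2 2(1,2) Suc j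
            by (intro conjI disjI1 exI[of _ j'] exI[of _ "2 * n"] exI[of _ "\<lambda>u. doubled (arr s2 ''energy'' u)"]) auto
          moreover have "120 * m * (2 * n + n) + 1 + j' * (360 * m * n + 1) + \<tau> + 1 \<le> k"
            using * k Suc by (simp add: algebra_simps)
          ultimately show ?thesis by blast
        qed
      qed
    qed
  qed
  then show ?thesis
  proof (rule exec_mono)
    fix \<tau> :: nat and s'
    assume "\<exists>k'. I k' s' \<and> \<not> bval ?guard s' \<and> \<tau> + k' \<le> ?k + 1"
    then obtain k' where I: "I k' s'" and g: "\<not> bval ?guard s'" and \<tau>: "\<tau> + k' \<le> ?k + 1" by blast
    from I g have "vars s' ''b'' = 0 \<and> finished s' \<or> vars s' ''b'' = - 1 \<and> \<not> good (2 ^ i)"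
      unfolding I_def by auto
    moreover have "frame phase_vars phase_arrays s s'" using I by (simp add: I_def)
    moreover have "\<tau> \<le> 120 * m * (L + n) + 2 + i * (360 * m * n + 1)" using \<tau> by linarith
    ultimately show "frame phase_vars phase_arrays s s' \<and> \<tau> \<le> 120 * m * (L + n) + 2 + i * (360 * m * n + 1) \<and>
     (vars s' ''b'' = 0 \<and> finished s' \<or> vars s' ''b'' = - 1 \<and> \<not> good (2 ^ i))" by blast
  qed
qed

abbreviation "attempt_vars \<equiv> {''c'', ''i'', ''e'', ''t'', ''u'', ''q'', ''h'', ''v'', ''b'', ''l'', ''g''}"

lemma exec_clear_energy:
  assumes lay: "layout s"
  shows "exec B (block [Assign ''u'' (Const 0),
     Loop (Less (Var ''u'') (Var ''n'')) (block
       [Write ''energy'' (Var ''u'') (Const 0), increment ''u''])]) s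
     (\<lambda>\<tau> s'. frame {''u''} {''energy''} s s' \<and> (\<forall>u<n. arr s' ''energy'' u = 0) \<and> \<tau> \<le> 3 * n + 2)"
proof -
  let ?body = "block [Write ''energy'' (Var ''u'') (Const 0), increment ''u'']"
  let ?guard = "Less (Var ''u'') (Var ''n'')"
  define I where "I k s' \<longleftrightarrow> (\<exists>u\<le>n. frame {''u''} {''energy''} s s' \<and> vars s' ''u'' = int u \<and>
    (\<forall>x<u. arr s' ''energy'' x = 0) \<and> k = 3 * (n - u))" for k :: nat and s'
  let ?s0 = "set_var ''u'' 0 s"
  have "I (3 * n) ?s0" unfolding I_def by (intro exI[of _ 0]) (simp add: state_simps frame_set_var frame_refl)
  then have "exec B (Loop ?guard ?body) ?s0 (\<lambda>\<tau> s'. \<exists>k'. I k' s' \<and> \<not> bval ?guard s' \<and> \<tau> + k' \<le> 3 * n + 1)"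
  proof (rule exec_Loop[where I = I, rotated])
    fix k s' assume "I k s'" and g: "bval ?guard s'"
    then obtain u where fr: "frame {''u''} {''energy''} s s'" and u: "vars s' ''u'' = int u" and
      e: "\<forall>x<u. arr s' ''energy'' x = 0" and k: "k = 3 * (n - u)" unfolding I_def by blast
    have lay': "layout s'" by (rule layout_frame[OF lay fr]) simp_all
    have lt: "u < n" using g u layoutD(1)[OF lay'] by simp
    let ?s2 = "set_var ''u'' (int u + 1) (set_array ''energy'' (int u) 0 s')"
    have "I (3 * (n - Suc u)) ?s2" unfolding I_def
      using lt e fr by (intro exI[of _ "Suc u"]) (auto simp: state_simps frame_set_var frame_set_array less_Suc_eq)
    moreover have "3 * (n - Suc u) + 2 + 1 \<le> k" using k lt by linarith
    ultimately show "exec B ?body s' (\<lambda>\<tau> s''. \<exists>k'. I k' s'' \<and> k' + \<tau> + 1 \<le> k)"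
      using lt word_bounds by (auto simp: exec_simps u)
  qed
  then have "exec B (Loop ?guard ?body) ?s0 (\<lambda>\<tau> s'. frame {''u''} {''energy''} s s' \<and>
      (\<forall>u<n. arr s' ''energy'' u = 0) \<and> 1 + \<tau> \<le> 3 * n + 2)"
  proof (rule exec_mono)
    fix \<tau> :: nat and s'
    assume "\<exists>k'. I k' s' \<and> \<not> bval ?guard s' \<and> \<tau> + k' \<le> 3 * n + 1"
    then obtain k' where "I k' s'" and g: "\<not> bval ?guard s'" and \<tau>: "\<tau> + k' \<le> 3 * n + 1" by blast
    then obtain u where un: "u \<le> n" and fr: "frame {''u''} {''energy''} s s'" and u: "vars s' ''u'' = int u" and
      e: "\<forall>x<u. arr s' ''energy'' x = 0" unfolding I_def by blast
    have lay': "layout s'" by (rule layout_frame[OF lay fr]) simp_all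
    have "u = n" using g un u layoutD(1)[OF lay'] by simp
    then show "frame {''u''} {''energy''} s s' \<and> (\<forall>u<n. arr s' ''energy'' u = 0) \<and> 1 + \<tau> \<le> 3 * n + 2"
      using fr e \<tau> by simp
  qed
  then show ?thesis using word_bounds(1) by (simp add: exec_Seq exec_Assign)
qed

lemma exec_attempt:
  assumes lay: "layout s" and g: "vars s ''g'' = 2 ^ i" "2 ^ i \<le> B"
  shows "exec B attempt s (\<lambda>\<tau> s'. frame attempt_vars phase_arrays s s' \<and>
     \<tau> \<le> 120 * (m * nat (N div 2 ^ i)) + 361 * (m * n * (i + 1)) + 10 \<and>
     (vars s' ''g'' = 0 \<and> finished s' \<or> vars s' ''g'' = 2 ^ i div 2 \<and> \<not> good (2 ^ i)))"
proof -
  let ?clear = "block [Assign ''u'' (Const 0),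
     Loop (Less (Var ''u'') (Var ''n'')) (block
       [Write ''energy'' (Var ''u'') (Const 0), increment ''u''])]"
  let ?phases = "Loop (Less (Const 0) (Var ''b'')) phase"
  let ?last = "Cond (Less (Var ''b'') (Const 0))
       (Assign ''g'' (Quot (Var ''g'') (Const 2))) (Assign ''g'' (Const 0))"
  let ?Q = "\<lambda>\<tau> s'. frame attempt_vars phase_arrays s s' \<and>
     \<tau> \<le> 120 * (m * nat (N div 2 ^ i)) + 361 * (m * n * (i + 1)) + 10 \<and>
     (vars s' ''g'' = 0 \<and> finished s' \<or> vars s' ''g'' = 2 ^ i div 2 \<and> \<not> good (2 ^ i))"
  let ?L = "nat (N div 2 ^ i) + 1"
  have d0: "0 \<le> N div 2 ^ i" by (simp add: pos_imp_zdiv_nonneg_iff)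
  have dN: "N div 2 ^ i \<le> N"
  proof -
    have "N div 2 ^ i \<le> N div 1" by (intro zdiv_mono2) auto
    then show ?thesis by simp
  qed
  have L: "?L \<le> nat N + 2 * n + 1" using dN by linarith
  have iL: "int ?L = N div 2 ^ i + 1" using d0 by simp
  have time: "3 * n + 2 + (2 + (120 * m * (?L + n) + 2 + i * (360 * m * n + 1) + 2))
      \<le> 120 * (m * nat (N div 2 ^ i)) + 361 * (m * n * (i + 1)) + 10"
  proof -
    have i: "i \<le> m * n * i" using mn_ge(3) by simp
    have e: "120 * m * (?L + n) = 120 * (m * nat (N div 2 ^ i)) + 120 * m + 120 * (m * n)"
      "i * (360 * m * n + 1) = 360 * (m * n * i) + i"
      "361 * (m * n * (i + 1)) = 361 * (m * n * i) + 361 * (m * n)"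
      by (simp_all add: algebra_simps)
    have "3 * n + 8 + 120 * m + i \<le> m * n * i + 241 * (m * n) + 10"
      using i mn_ge by linarith
    then show ?thesis unfolding e by linarith
  qed
  have "exec B ?clear s (\<lambda>\<tau> s1. exec B (Assign ''b'' (Var ''g'')) s1 (\<lambda>\<tau>1 s2.
      exec B (Assign ''l'' (Add (Quot (Var ''M'') (Var ''g'')) (Const 1))) s2 (\<lambda>\<tau>2 s3.
      exec B ?phases s3 (\<lambda>\<tau>3 s4. exec B ?last s4 (\<lambda>\<tau>4. ?Q (\<tau> + (\<tau>1 + (\<tau>2 + (\<tau>3 + \<tau>4)))))))))"
    using exec_clear_energy[OF lay]
  proof (rule exec_mono)
    fix \<tau> :: nat and s1
    assume *: "frame {''u''} {''energy''} s s1 \<and> (\<forall>u<n. arr s1 ''energy'' u = 0) \<and> \<tau> \<le> 3 * n + 2"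
    have fr1: "frame attempt_vars phase_arrays s s1"
      by (rule frame_mono[of "{''u''}" "{''energy''}"]) (use * in auto)
    have lay1: "layout s1" by (rule layout_frame[OF lay fr1]) simp_all
    have g1: "vars s1 ''g'' = 2 ^ i" using frame_var[of _ _ s s1 "''g''"] * g(1) by auto
    let ?s3 = "set_var ''l'' (int ?L) (set_var ''b'' (2 ^ i) s1)"
    have fr3: "frame attempt_vars phase_arrays s ?s3" using fr1 by (simp add: frame_set_var)
    have lay3: "layout ?s3" by (rule layout_frame[OF lay fr3]) simp_all
    have r: "ready (2 ^ i) (2 ^ i) (\<lambda>_. 0) (int ?L)" unfolding iL by (rule ready_initial) simp
    have "exec B ?phases ?s3 (\<lambda>\<tau>3 s4. exec B ?last s4 (\<lambda>\<tau>4. ?Q (\<tau> + (1 + (1 + (\<tau>3 + \<tau>4))))))"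
    proof (rule exec_mono)
      show "exec B ?phases ?s3 (\<lambda>\<tau> s'. frame phase_vars phase_arrays ?s3 s' \<and>
         \<tau> \<le> 120 * m * (?L + n) + 2 + i * (360 * m * n + 1) \<and>
         (vars s' ''b'' = 0 \<and> finished s' \<or> vars s' ''b'' = - 1 \<and> \<not> good (2 ^ i)))"
        by (rule exec_phases[OF lay3 _ g(2) _ L r]) (use * in \<open>auto simp: state_simps doubled_def\<close>)
      fix \<tau>3 :: nat and s4
      assume **: "frame phase_vars phase_arrays ?s3 s4 \<and>
         \<tau>3 \<le> 120 * m * (?L + n) + 2 + i * (360 * m * n + 1) \<and>
         (vars s4 ''b'' = 0 \<and> finished s4 \<or> vars s4 ''b'' = - 1 \<and> \<not> good (2 ^ i))"
      then have fr34: "frame phase_vars phase_arrays ?s3 s4" by blast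
      have g4: "vars s4 ''g'' = 2 ^ i" using frame_var[OF fr34, of "''g''"] g1 by (simp add: state_simps)
      have "frame attempt_vars phase_arrays ?s3 s4" by (rule frame_mono[OF fr34]) auto
      then have fr4: "frame attempt_vars phase_arrays s s4" by (rule frame_trans[OF fr3])
      have tt: "\<tau> + (1 + (1 + (\<tau>3 + 2))) \<le> 120 * (m * nat (N div 2 ^ i)) + 361 * (m * n * (i + 1)) + 10"
        using * ** time by linarith
      have gB: "\<bar>(2::int) ^ i div 2\<bar> \<le> B"
      proof -
        have "(0::int) \<le> 2 ^ i" by simp
        then show ?thesis using g(2) by linarith
      qed
      from ** have "vars s4 ''b'' = 0 \<and> finished s4 \<or> vars s4 ''b'' = - 1 \<and> \<not> good (2 ^ i)" by blast
      then show "exec B ?last s4 (\<lambda>\<tau>4. ?Q (\<tau> + (1 + (1 + (\<tau>3 + \<tau>4)))))"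
        using fr4 tt gB word_bounds(1) by (auto simp: exec_simps g4 finished_def)
    qed
    then show "exec B (Assign ''b'' (Var ''g'')) s1 (\<lambda>\<tau>1 s2.
      exec B (Assign ''l'' (Add (Quot (Var ''M'') (Var ''g'')) (Const 1))) s2 (\<lambda>\<tau>2 s3.
      exec B ?phases s3 (\<lambda>\<tau>3 s4. exec B ?last s4 (\<lambda>\<tau>4. ?Q (\<tau> + (\<tau>1 + (\<tau>2 + (\<tau>3 + \<tau>4))))))))"
      using g(2) dN d0 word_bounds(6) unfolding iL
      by (simp add: exec_Assign state_simps g1 layoutD(3)[OF lay1])
  qed
  then show ?thesis unfolding attempt_def by (simp add: exec_Seq add.assoc)
qed

text \<open>The bound for one attempt, plus 1 for the test of the outer loop.\<close>

definition attempt_time :: "nat \<Rightarrow> nat" where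
  "attempt_time i = 120 * (m * nat (N div 2 ^ i)) + 361 * (m * n * (i + 1)) + 11"

text \<open>The level \<open>i0\<close> appears only in the bound. An attempt at a good level cannot
  be refuted, so the search ends there at the latest; ending earlier is equally correct, since any
  attempt that is not given up yields the exact energies.\<close>

lemma exec_search:
  assumes lay: "layout s" and g: "vars s ''g'' = 2 ^ i" "2 ^ i \<le> B" and i0: "i0 \<le> i" "good (2 ^ i0)"
  shows "exec B (Loop (Less (Const 0) (Var ''g'')) attempt) s
     (\<lambda>\<tau> s'. finished s' \<and> \<tau> \<le> (\<Sum>x=i0..i. attempt_time x) + 1)"
proof -
  let ?guard = "Less (Const 0) (Var ''g'')"
  define I where "I k s' \<longleftrightarrow> layout s' \<and>
    ((\<exists>j. i0 \<le> j \<and> j \<le> i \<and> vars s' ''g'' = 2 ^ j \<and> k = (\<Sum>x=i0..j. attempt_time x)) \<or>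
     vars s' ''g'' = 0 \<and> finished s' \<and> k = 0)" for k :: nat and s'
  let ?k = "\<Sum>x=i0..i. attempt_time x"
  have "I ?k s" unfolding I_def using lay g(1) i0(1) by blast
  then have "exec B (Loop ?guard attempt) s (\<lambda>\<tau> s'. \<exists>k'. I k' s' \<and> \<not> bval ?guard s' \<and> \<tau> + k' \<le> ?k + 1)"
  proof (rule exec_Loop[where I = I, rotated])
    fix k s1 assume I: "I k s1" and gd: "bval ?guard s1"
    have lay1: "layout s1" using I by (simp add: I_def)
    from I gd obtain j where j: "i0 \<le> j" "j \<le> i" and g1: "vars s1 ''g'' = 2 ^ j" and
      k: "k = (\<Sum>x=i0..j. attempt_time x)" unfolding I_def by auto
    have jB: "(2::int) ^ j \<le> B" using power_increasing[OF j(2), of "2::int"] g(2) by linarith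
    show "exec B attempt s1 (\<lambda>\<tau> s'. \<exists>k'. I k' s' \<and> k' + \<tau> + 1 \<le> k)"
      using exec_attempt[OF lay1 g1 jB]
    proof (rule exec_mono)
      fix \<tau> :: nat and s2
      assume *: "frame attempt_vars phase_arrays s1 s2 \<and>
       \<tau> \<le> 120 * (m * nat (N div 2 ^ j)) + 361 * (m * n * (j + 1)) + 10 \<and>
       (vars s2 ''g'' = 0 \<and> finished s2 \<or> vars s2 ''g'' = 2 ^ j div 2 \<and> \<not> good (2 ^ j))"
      then have fr: "frame attempt_vars phase_arrays s1 s2" and \<tau>: "\<tau> + 1 \<le> attempt_time j"
        by (simp_all add: attempt_time_def)
      have lay2: "layout s2" by (rule layout_frame[OF lay1 fr]) simp_all
      consider "vars s2 ''g'' = 0" "finished s2" | "vars s2 ''g'' = 2 ^ j div 2" "\<not> good (2 ^ j)"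
        using * by blast
      then show "\<exists>k'. I k' s2 \<and> k' + \<tau> + 1 \<le> k"
      proof cases
        case 1
        then have "I 0 s2" unfolding I_def using lay2 by blast
        moreover have "attempt_time j \<le> k" unfolding k using j(1) by (intro member_le_sum) auto
        ultimately show ?thesis using \<tau> by (intro exI[of _ 0]) linarith
      next
        case 2
        then have "j \<noteq> i0" using i0(2) by blast
        then obtain j' where j': "j = Suc j'" "i0 \<le> j'" using j(1) by (cases j) auto
        then have "I (\<Sum>x=i0..j'. attempt_time x) s2" unfolding I_def using lay2 2(1) j(2) by auto
        moreover have "k = (\<Sum>x=i0..j'. attempt_time x) + attempt_time j" unfolding k j'(1) using j'(2) by simp
        ultimately show ?thesis using \<tau> by (intro exI[of _ "\<Sum>x=i0..j'. attempt_time x"]) linarith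
      qed
    qed
  qed
  then show ?thesis
  proof (rule exec_mono)
    fix \<tau> :: nat and s'
    assume "\<exists>k'. I k' s' \<and> \<not> bval ?guard s' \<and> \<tau> + k' \<le> ?k + 1"
    then show "finished s' \<and> \<tau> \<le> ?k + 1" unfolding I_def by auto
  qed
qed


section \<open>Preprocessing: incidence lists and the first guess\<close>

lemma exec_collect_incident:
  assumes lay: "input_layout s" and u: "vars s ''u'' = int u" "u < n"
  shows "exec B collect_incident s (\<lambda>\<tau> s'. frame {''c'', ''e''} {''adj'', ''deg''} s s' \<and>
     arr s' ''deg'' = (arr s ''deg'')(u := int (deg u)) \<and>
     (\<forall>i<deg u. arrays s' ''adj'' (int u * int m + int i) = int (incident u ! i)) \<and>
     (\<forall>j<int u * int m. arrays s' ''adj'' j = arrays s ''adj'' j) \<and> \<tau> \<le> 5 * m + 4)"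
proof -
  let ?body = "block
       [Cond (Neg (Conj (Neg (Equal (Read ''source'' (Var ''e'')) (Var ''u'')))
              (Neg (Equal (Read ''target'' (Var ''e'')) (Var ''u'')))))
          (block
            [Write ''adj'' (Add (Mul (Var ''u'') (Var ''m'')) (Var ''c'')) (Var ''e''),
             increment ''c''])
          Skip,
        increment ''e'']"
  let ?guard = "Less (Var ''e'') (Var ''m'')"
  define inc where "inc e = filter (\<lambda>e. src e = u \<or> tgt e = u) [0..<e]" for e
  define I where "I k s' \<longleftrightarrow> (\<exists>e\<le>m. frame {''c'', ''e''} {''adj''} s s' \<and> vars s' ''e'' = int e \<and>
     vars s' ''c'' = int (length (inc e)) \<and>
     (\<forall>i<length (inc e). arrays s' ''adj'' (int u * int m + int i) = int (inc e ! i)) \<and>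
     (\<forall>j<int u * int m. arrays s' ''adj'' j = arrays s ''adj'' j) \<and> k = 5 * (m - e))" for k :: nat and s'
  let ?s0 = "set_var ''e'' 0 (set_var ''c'' 0 s)"
  have "I (5 * m) ?s0"
    unfolding I_def by (intro exI[of _ 0]) (simp add: state_simps frame_set_var frame_refl inc_def)
  then have "exec B (Loop ?guard ?body) ?s0 (\<lambda>\<tau> s'. \<exists>k'. I k' s' \<and> \<not> bval ?guard s' \<and> \<tau> + k' \<le> 5 * m + 1)"
  proof (rule exec_Loop[where I = I, rotated])
    fix k s' assume "I k s'" and g: "bval ?guard s'"
    then obtain e where fr: "frame {''c'', ''e''} {''adj''} s s'" and e: "vars s' ''e'' = int e" and
      c: "vars s' ''c'' = int (length (inc e))" and
      adj: "\<forall>i<length (inc e). arrays s' ''adj'' (int u * int m + int i) = int (inc e ! i)" and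
      old: "\<forall>j<int u * int m. arrays s' ''adj'' j = arrays s ''adj'' j" and k: "k = 5 * (m - e)"
      unfolding I_def by blast
    have lay': "input_layout s'" by (rule input_layout_frame[OF lay fr]) simp_all
    have vm: "vars s' ''m'' = int m" using lay' by (simp add: input_layout_def)
    have vu: "vars s' ''u'' = int u" using frame_var[OF fr, of "''u''"] u by simp
    have em: "e < m" using g e vm by simp
    have look: "arrays s' ''source'' (int e) = int (src e)" "arrays s' ''target'' (int e) = int (tgt e)"
      using lay' em by (simp_all add: input_layout_def)
    have inc: "inc (Suc e) = inc e @ (if src e = u \<or> tgt e = u then [e] else [])" by (simp add: inc_def)
    have len: "length (inc e) \<le> e" unfolding inc_def using length_filter_le[of _ "[0..<e]"] by simp
    have aB: "int u * int m + int (length (inc e)) \<le> B"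
    proof -
      have "(int u + 1) * int m \<le> int n * int m" using u(2) by (intro mult_right_mono) auto
      then show ?thesis using len em word_bounds(7) by (simp add: algebra_simps)
    qed
    have bnd: "int e + 1 \<le> B" "int (length (inc e)) + 1 \<le> B" using em len word_bounds(3) by linarith+
    have time: "5 * (m - Suc e) + 4 + 1 \<le> k" using k em by linarith
    show "exec B ?body s' (\<lambda>\<tau> s''. \<exists>k'. I k' s'' \<and> k' + \<tau> + 1 \<le> k)"
    proof (cases "src e = u \<or> tgt e = u")
      case True
      let ?s2 = "set_var ''e'' (int e + 1) (set_var ''c'' (int (length (inc e)) + 1)
        (set_array ''adj'' (int u * int m + int (length (inc e))) (int e) s'))"
      have "I (5 * (m - Suc e)) ?s2" unfolding I_def
        using em fr adj old True
        by (intro exI[of _ "Suc e"]) (auto simp: state_simps frame_set_var frame_set_array inc nth_append less_Suc_eq)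
      then show ?thesis using True bnd aB time
        by (auto simp: exec_simps vu vm look e c intro!: exI[of _ "5 * (m - Suc e)"])
    next
      case False
      let ?s2 = "set_var ''e'' (int e + 1) s'"
      have "I (5 * (m - Suc e)) ?s2" unfolding I_def
        using em fr adj old False c
        by (intro exI[of _ "Suc e"]) (auto simp: state_simps frame_set_var inc)
      then show ?thesis using False bnd time
        by (auto simp: exec_simps vu vm look e intro!: exI[of _ "5 * (m - Suc e)"])
    qed
  qed
  then have "exec B (Loop ?guard ?body) ?s0 (\<lambda>\<tau> s'. exec B (Write ''deg'' (Var ''u'') (Var ''c'')) s' (\<lambda>\<tau>' s''.
     frame {''c'', ''e''} {''adj'', ''deg''} s s'' \<and>
     arr s'' ''deg'' = (arr s ''deg'')(u := int (deg u)) \<and>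
     (\<forall>i<deg u. arrays s'' ''adj'' (int u * int m + int i) = int (incident u ! i)) \<and>
     (\<forall>j<int u * int m. arrays s'' ''adj'' j = arrays s ''adj'' j) \<and> 2 + (\<tau> + \<tau>') \<le> 5 * m + 4))"
  proof (rule exec_mono)
    fix \<tau> :: nat and s'
    assume "\<exists>k'. I k' s' \<and> \<not> bval ?guard s' \<and> \<tau> + k' \<le> 5 * m + 1"
    then obtain k' where "I k' s'" and g: "\<not> bval ?guard s'" and \<tau>: "\<tau> + k' \<le> 5 * m + 1" by blast
    then obtain e where em: "e \<le> m" and fr: "frame {''c'', ''e''} {''adj''} s s'" and e: "vars s' ''e'' = int e" and
      c: "vars s' ''c'' = int (length (inc e))" and
      adj: "\<forall>i<length (inc e). arrays s' ''adj'' (int u * int m + int i) = int (inc e ! i)" and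
      old: "\<forall>j<int u * int m. arrays s' ''adj'' j = arrays s ''adj'' j"
      unfolding I_def by blast
    have lay': "input_layout s'" by (rule input_layout_frame[OF lay fr]) simp_all
    have vm: "vars s' ''m'' = int m" using lay' by (simp add: input_layout_def)
    have vu: "vars s' ''u'' = int u" using frame_var[OF fr, of "''u''"] u by simp
    have "e = m" using g em e vm by simp
    then have inc: "inc e = incident u" by (simp add: inc_def incident_def)
    have d: "arr s' ''deg'' = arr s ''deg''" by (rule arr_frame[OF fr]) simp
    have fr': "frame {''c'', ''e''} {''adj'', ''deg''} s s'" by (rule frame_mono[OF fr]) auto
    have bnd: "int u \<le> B" "int (deg u) \<le> B" using u(2) deg_le[of u] word_bounds by linarith+
    show "exec B (Write ''deg'' (Var ''u'') (Var ''c'')) s' (\<lambda>\<tau>' s''.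
     frame {''c'', ''e''} {''adj'', ''deg''} s s'' \<and>
     arr s'' ''deg'' = (arr s ''deg'')(u := int (deg u)) \<and>
     (\<forall>i<deg u. arrays s'' ''adj'' (int u * int m + int i) = int (incident u ! i)) \<and>
     (\<forall>j<int u * int m. arrays s'' ''adj'' j = arrays s ''adj'' j) \<and> 2 + (\<tau> + \<tau>') \<le> 5 * m + 4)"
      using fr' d adj old \<tau> bnd c unfolding inc deg_def[symmetric]
      by (simp add: exec_Write vu state_simps frame_set_array)
  qed
  then show ?thesis unfolding collect_incident_def
    using word_bounds(1) by (simp add: exec_Seq exec_Assign)
qed

text \<open>The exponent of the first guess. It is of order log(M/n), and bounds both the number of
  attempts and the number of phases in each.\<close>

definition levels :: nat where
  "levels = (LEAST j. N \<le> 2 ^ j * int n)"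

lemma levels_upper: "N \<le> 2 ^ levels * int n"
  unfolding levels_def
proof (rule LeastI)
  have "N \<le> int (2 ^ nat N)"
    using less_exp[of "nat N"] by linarith
  also have "\<dots> \<le> 2 ^ nat N * int n" using n_pos by simp
  finally show "N \<le> 2 ^ nat N * int n" .
qed

lemma levels_lower: "j < levels \<Longrightarrow> 2 ^ j * int n < N"
  using not_less_Least[of j "\<lambda>j. N \<le> 2 ^ j * int n"] by (simp add: levels_def not_le)

lemma levels_power: "(2::int) ^ levels \<le> B"
proof (cases levels)
  case (Suc j)
  then have "2 ^ j * int n < N" by (intro levels_lower) simp
  moreover have "(2::int) ^ j \<le> 2 ^ j * int n" using n_pos by simp
  ultimately have "2 * (2::int) ^ j \<le> B" using word_bounds(4) by linarith
  then show ?thesis by (simp add: Suc)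
qed (use word_bounds in simp)

lemma exec_setup:
  assumes lay: "input_layout s" and M: "vars s ''M'' = M"
  shows "exec B setup_program s (\<lambda>\<tau> s'. layout s' \<and> vars s' ''g'' = 2 ^ levels \<and>
     \<tau> \<le> n * (5 * m + 7) + 2 * levels + 6)"
proof -
  let ?clamp = "Cond (Less (Var ''M'') (Const 0)) (Assign ''M'' (Const 0)) Skip"
  let ?guard = "Less (Var ''u'') (Var ''n'')"
  let ?body = "block [collect_incident, increment ''u'']"
  let ?gguard = "Less (Mul (Var ''g'') (Var ''n'')) (Var ''M'')"
  let ?gbody = "Assign ''g'' (Mul (Const 2) (Var ''g''))"
  let ?X = "{''c'', ''e'', ''u'', ''M''}" and ?Y = "{''adj'', ''deg''}"
  define I where "I k s' \<longleftrightarrow> (\<exists>u\<le>n. frame ?X ?Y s s' \<and> vars s' ''M'' = N \<and> vars s' ''u'' = int u \<and>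
     (\<forall>v<u. arr s' ''deg'' v = int (deg v) \<and>
        (\<forall>i<deg v. arrays s' ''adj'' (int v * int m + int i) = int (incident v ! i))) \<and>
     k = (n - u) * (5 * m + 7))" for k :: nat and s'
  have loop: "exec B (Loop ?guard ?body) s0 (\<lambda>\<tau> s'. layout s' \<and> \<tau> \<le> n * (5 * m + 7) + 1)"
    if s0: "I (n * (5 * m + 7)) s0" for s0
  proof -
    have "exec B (Loop ?guard ?body) s0
      (\<lambda>\<tau> s'. \<exists>k'. I k' s' \<and> \<not> bval ?guard s' \<and> \<tau> + k' \<le> n * (5 * m + 7) + 1)"
    proof (rule exec_Loop[where I = I, OF _ s0])
      fix k s1 assume "I k s1" and g: "bval ?guard s1"
      then obtain u where fr1: "frame ?X ?Y s s1" and M1: "vars s1 ''M'' = N" and u1: "vars s1 ''u'' = int u" and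
        ok: "\<And>v. v < u \<Longrightarrow> arr s1 ''deg'' v = int (deg v)"
        "\<And>v i. v < u \<Longrightarrow> i < deg v \<Longrightarrow> arrays s1 ''adj'' (int v * int m + int i) = int (incident v ! i)" and
        k: "k = (n - u) * (5 * m + 7)" unfolding I_def by blast
      have lay1: "input_layout s1" by (rule input_layout_frame[OF lay fr1]) simp_all
      have un: "u < n" using g u1 lay1 by (simp add: input_layout_def)
      have "exec B collect_incident s1 (\<lambda>\<tau> s2. exec B (increment ''u'') s2
          (\<lambda>\<tau>' s3. \<exists>k'. I k' s3 \<and> k' + (\<tau> + \<tau>') + 1 \<le> k))"
        using exec_collect_incident[OF lay1 u1 un]
      proof (rule exec_mono)
        fix \<tau> :: nat and s2
        assume *: "frame {''c'', ''e''} ?Y s1 s2 \<and>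
          arr s2 ''deg'' = (arr s1 ''deg'')(u := int (deg u)) \<and>
          (\<forall>i<deg u. arrays s2 ''adj'' (int u * int m + int i) = int (incident u ! i)) \<and>
          (\<forall>j<int u * int m. arrays s2 ''adj'' j = arrays s1 ''adj'' j) \<and> \<tau> \<le> 5 * m + 4"
        have fr12: "frame {''c'', ''e''} ?Y s1 s2" and \<tau>: "\<tau> \<le> 5 * m + 4" using * by blast+
        have u2: "vars s2 ''u'' = int u" "vars s2 ''M'' = N"
          using frame_var[OF fr12, of "''u''"] frame_var[OF fr12, of "''M''"] u1 M1 by simp_all
        have "frame ?X ?Y s1 s2" by (rule frame_mono[OF fr12]) auto
        then have fr2: "frame ?X ?Y s s2" by (rule frame_trans[OF fr1])
        \<comment> \<open>Each node owns \<open>m\<close> consecutive addresses and uses at most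
          \<open>deg v\<close>, which is at most \<open>m\<close>, so filling the block of
          \<open>u\<close> leaves earlier blocks intact.\<close>
        have adj: "arrays s2 ''adj'' (int v * int m + int i) = int (incident v ! i)"
          if "v < Suc u" "i < deg v" for v i
        proof (cases "v = u")
          case False
          then have "(int v + 1) * int m \<le> int u * int m" using that by (intro mult_right_mono) auto
          then have "int v * int m + int i < int u * int m"
            using that(2) deg_le[of v] by (simp add: algebra_simps)
          then show ?thesis using * ok(2)[of v i] that False by simp
        qed (use * that in simp)
        have "I ((n - Suc u) * (5 * m + 7)) (set_var ''u'' (int u + 1) s2)"
          unfolding I_def using un fr2 u2 adj * ok(1)
          by (intro exI[of _ "Suc u"]) (auto simp: state_simps frame_set_var less_Suc_eq)
        moreover have "(n - Suc u) * (5 * m + 7) + (\<tau> + 1) + 1 \<le> k"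
        proof -
          have "n - u = Suc (n - Suc u)" using un by simp
          then have "k = (n - Suc u) * (5 * m + 7) + (5 * m + 7)" unfolding k by simp
          then show ?thesis using \<tau> by linarith
        qed
        moreover have "int u + 1 \<le> B" using un word_bounds(2) by linarith
        ultimately show "exec B (increment ''u'') s2
          (\<lambda>\<tau>' s3. \<exists>k'. I k' s3 \<and> k' + (\<tau> + \<tau>') + 1 \<le> k)"
          by (auto simp: exec_simps u2)
      qed
      then show "exec B ?body s1 (\<lambda>\<tau> s'. \<exists>k'. I k' s' \<and> k' + \<tau> + 1 \<le> k)"
        by (simp add: exec_Seq)
    qed
    then show ?thesis
    proof (rule exec_mono)
      fix \<tau> :: nat and s'
      assume "\<exists>k'. I k' s' \<and> \<not> bval ?guard s' \<and> \<tau> + k' \<le> n * (5 * m + 7) + 1"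
      then obtain k' where "I k' s'" and g: "\<not> bval ?guard s'" and \<tau>: "\<tau> + k' \<le> n * (5 * m + 7) + 1" by blast
      then obtain u where un: "u \<le> n" and fr: "frame ?X ?Y s s'" and M': "vars s' ''M'' = N" and u: "vars s' ''u'' = int u" and
        ok: "\<forall>v<u. arr s' ''deg'' v = int (deg v) \<and>
          (\<forall>i<deg v. arrays s' ''adj'' (int v * int m + int i) = int (incident v ! i))"
        unfolding I_def by blast
      have lay': "input_layout s'" by (rule input_layout_frame[OF lay fr]) simp_all
      have "u = n" using g u un lay' by (simp add: input_layout_def)
      then show "layout s' \<and> \<tau> \<le> n * (5 * m + 7) + 1"
        using lay' M' ok \<tau> by (simp add: layout_def arr_def)
    qed
  qed
  have gloop: "exec B (Loop ?gguard ?gbody) s0 (\<lambda>\<tau> s'. layout s' \<and> vars s' ''g'' = 2 ^ levels \<and> \<tau> \<le> 2 * levels + 1)"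
    if s0: "layout s0" "vars s0 ''g'' = 1" for s0
  proof -
    define G where "G k s' \<longleftrightarrow> layout s' \<and> (\<exists>j\<le>levels. vars s' ''g'' = 2 ^ j \<and> k = 2 * (levels - j))"
      for k :: nat and s'
    have "G (2 * levels) s0" unfolding G_def using s0 by (auto intro: exI[of _ 0])
    then have "exec B (Loop ?gguard ?gbody) s0
       (\<lambda>\<tau> s'. \<exists>k'. G k' s' \<and> \<not> bval ?gguard s' \<and> \<tau> + k' \<le> 2 * levels + 1)"
    proof (rule exec_Loop[where I = G, rotated])
      fix k s1 assume "G k s1" and g: "bval ?gguard s1"
      then obtain j where lay1: "layout s1" and j: "j \<le> levels" and g1: "vars s1 ''g'' = 2 ^ j" and
        k: "k = 2 * (levels - j)" unfolding G_def by blast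
      have less: "2 ^ j * int n < N" using g g1 layoutD(1,3)[OF lay1] by simp
      have "j \<noteq> levels"
      proof
        assume "j = levels"
        from less[unfolded this] levels_upper show False by linarith
      qed
      then have jl: "j < levels" using j by simp
      let ?s2 = "set_var ''g'' (2 * 2 ^ j) s1"
      have "layout ?s2" by (rule layout_frame[OF lay1, of "{''g''}" "{}"]) (simp_all add: frame_set_var frame_refl)
      then have "G (2 * (levels - Suc j)) ?s2"
        unfolding G_def using jl by (auto simp: state_simps intro!: exI[of _ "Suc j"])
      moreover have "2 * (levels - Suc j) + 1 + 1 \<le> k" using k jl by linarith
      moreover have "(2::int) * 2 ^ j \<le> B"
        using power_increasing[of "Suc j" levels "2::int"] jl levels_power by simp
      ultimately show "exec B ?gbody s1 (\<lambda>\<tau> s'. \<exists>k'. G k' s' \<and> k' + \<tau> + 1 \<le> k)"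
        by (auto simp: exec_Assign g1)
    qed
    then show ?thesis
    proof (rule exec_mono)
      fix \<tau> :: nat and s'
      assume "\<exists>k'. G k' s' \<and> \<not> bval ?gguard s' \<and> \<tau> + k' \<le> 2 * levels + 1"
      then obtain k' j where lay': "layout s'" and j: "j \<le> levels" and g': "vars s' ''g'' = 2 ^ j" and
        g: "\<not> bval ?gguard s'" and \<tau>: "\<tau> + k' \<le> 2 * levels + 1" unfolding G_def by blast
      have "\<not> 2 ^ j * int n < N" using g g' layoutD(1,3)[OF lay'] by simp
      then have "j = levels" using j levels_lower[of j] by linarith
      then show "layout s' \<and> vars s' ''g'' = 2 ^ levels \<and> \<tau> \<le> 2 * levels + 1" using lay' g' \<tau> by simp
    qed
  qed
  let ?s1 = "set_var ''u'' 0 (if M < 0 then set_var ''M'' 0 s else s)"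
  let ?P = "\<lambda>\<tau> s'. layout s' \<and> vars s' ''g'' = 2 ^ levels \<and> \<tau> \<le> n * (5 * m + 7) + 2 * levels + 6"
  have "I (n * (5 * m + 7)) ?s1"
    unfolding I_def using M by (intro exI[of _ 0]) (auto simp: state_simps frame_set_var frame_refl)
  note L = loop[OF this]
  have "exec B (Loop ?guard ?body) ?s1 (\<lambda>\<tau> s2. exec B (Assign ''g'' (Const 1)) s2 (\<lambda>\<tau>1 s3.
      exec B (Loop ?gguard ?gbody) s3 (\<lambda>\<tau>2. ?P (2 + (1 + (\<tau> + (\<tau>1 + \<tau>2)))))))"
    using L
  proof (rule exec_mono)
    fix \<tau> :: nat and s2
    assume *: "layout s2 \<and> \<tau> \<le> n * (5 * m + 7) + 1"
    let ?s3 = "set_var ''g'' 1 s2"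
    have "layout ?s3" by (rule layout_frame[of s2 "{''g''}" "{}"]) (use * in \<open>simp_all add: frame_set_var frame_refl\<close>)
    moreover have "vars ?s3 ''g'' = 1" by (simp add: state_simps)
    ultimately have "exec B (Loop ?gguard ?gbody) ?s3 (\<lambda>\<tau> s'. layout s' \<and> vars s' ''g'' = 2 ^ levels \<and> \<tau> \<le> 2 * levels + 1)"
      by (rule gloop)
    then have "exec B (Loop ?gguard ?gbody) ?s3 (\<lambda>\<tau>2. ?P (2 + (1 + (\<tau> + (1 + \<tau>2)))))"
      by (rule exec_mono) (use * in auto)
    then show "exec B (Assign ''g'' (Const 1)) s2 (\<lambda>\<tau>1 s3.
      exec B (Loop ?gguard ?gbody) s3 (\<lambda>\<tau>2. ?P (2 + (1 + (\<tau> + (\<tau>1 + \<tau>2))))))"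
      using word_bounds(1) by (simp add: exec_Assign)
  qed
  then show ?thesis unfolding setup_program_def
    using word_bounds(1) M by (cases "M < 0") (simp_all add: exec_Seq exec_Assign exec_Cond exec_Skip)
qed

text \<open>The largest good level is taken; level 0 is always good. Unless it is the top level,
  failure of the next one bounds the penalty by \<open>2 ^ (i + 1)\<close>, which ties the running
  time to the penalty.\<close>

lemma good_level_exists: "\<exists>i\<le>levels. good (2 ^ i) \<and> (i = levels \<or> \<not> good (2 ^ (i + 1)))"
proof -
  let ?S = "{i. i \<le> levels \<and> good (2 ^ i)}"
  have fin: "finite ?S" by simp
  have "0 \<in> ?S" by (simp add: good_def)
  then have "Max ?S \<in> ?S" using fin by (intro Max_in) auto
  moreover have "Max ?S + 1 \<notin> ?S"
  proof
    assume "Max ?S + 1 \<in> ?S"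
    from Max_ge[OF fin this] show False by simp
  qed
  moreover have "i + 1 \<in> ?S" if "i \<in> ?S" "i \<noteq> levels" "good (2 ^ (i + 1))" for i using that by simp
  ultimately show ?thesis by blast
qed

lemma exec_energy_program:
  assumes "input_layout s" "vars s ''M'' = M" "i \<le> levels" "good (2 ^ i)"
  shows "exec B energy_program s (\<lambda>\<tau> s'. finished s' \<and>
     \<tau> \<le> n * (5 * m + 7) + 2 * levels + 7 + (\<Sum>x=i..levels. attempt_time x))"
proof -
  have "exec B setup_program s (\<lambda>\<tau> s1. exec B (Loop (Less (Const 0) (Var ''g'')) attempt) s1 (\<lambda>\<tau>' s'.
     finished s' \<and> \<tau> + \<tau>' \<le> n * (5 * m + 7) + 2 * levels + 7 + (\<Sum>x=i..levels. attempt_time x)))"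
    using exec_setup[OF assms(1,2)]
  proof (rule exec_mono)
    fix \<tau> :: nat and s1
    assume *: "layout s1 \<and> vars s1 ''g'' = 2 ^ levels \<and> \<tau> \<le> n * (5 * m + 7) + 2 * levels + 6"
    have "exec B (Loop (Less (Const 0) (Var ''g'')) attempt) s1
       (\<lambda>\<tau> s'. finished s' \<and> \<tau> \<le> (\<Sum>x=i..levels. attempt_time x) + 1)"
      by (rule exec_search[OF _ _ levels_power assms(3,4)]) (use * in auto)
    then show "exec B (Loop (Less (Const 0) (Var ''g'')) attempt) s1 (\<lambda>\<tau>' s'.
     finished s' \<and> \<tau> + \<tau>' \<le> n * (5 * m + 7) + 2 * levels + 7 + (\<Sum>x=i..levels. attempt_time x))"
      by (rule exec_mono) (use * in auto)
  qed
  then show ?thesis by (simp add: energy_program_def exec_Seq)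
qed

end

section \<open>The running time\<close>

lemma lg_ge_1: "1 \<le> lg x"
  by (auto simp: lg_def le_log_iff)

lemma log_le_lg: "0 < x \<Longrightarrow> log 2 x \<le> lg x"
  by (auto simp: lg_def log_le_one_cancel_iff)

context energy_machine
begin

abbreviation "Q \<equiv> per_penalty (real_of_int N) (penalty \<Gamma>)"

text \<open>Minimality of \<open>levels\<close> gives \<open>levels - 1 <= log 2 (N / n)\<close>;
  the remaining 2 is absorbed because \<open>lg\<close> is at least 1, hence the factor 3.\<close>

lemma levels_le: "real (levels + 1) \<le> 3 * lg (real_of_int N / real n)"
proof (cases levels)
  case 0
  then show ?thesis using lg_ge_1[of "real_of_int N / real n"] by simp
next
  case (Suc j)
  then have "2 ^ j * int n < N" by (intro levels_lower) simp
  then have "real_of_int (2 ^ j * int n) < real_of_int N" by (simp only: of_int_less_iff)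
  then have *: "2 ^ j \<le> real_of_int N / real n" using n_pos by (simp add: field_simps)
  then have "0 < real_of_int N / real n" by (smt (verit) zero_less_power)
  moreover from * this have "real j \<le> log 2 (real_of_int N / real n)"
    by (simp add: le_log_iff powr_realpow)
  ultimately have "real j \<le> lg (real_of_int N / real n)" using log_le_lg by fastforce
  then show ?thesis using Suc lg_ge_1[of "real_of_int N / real n"] by simp
qed

lemma geometric_sum: "(\<Sum>x=i..j. real (nat (N div 2 ^ x))) \<le> 2 * real_of_int N / 2 ^ i"
proof -
  have summand: "real (nat (N div 2 ^ x)) \<le> real_of_int N * (1 / 2) ^ x" for x
  proof -
    have "0 \<le> N div 2 ^ x" by (simp add: pos_imp_zdiv_nonneg_iff)
    then have "real (nat (N div 2 ^ x)) = real_of_int (N div 2 ^ x)" by simp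
    also have "\<dots> \<le> real_of_int N / real_of_int (2 ^ x)" by (rule real_of_int_div4)
    finally show ?thesis by (simp add: power_one_over)
  qed
  have N0: "0 \<le> real_of_int N" by simp
  have "(\<Sum>x=i..j. real_of_int N * (1 / 2) ^ x) \<le> 2 * real_of_int N / 2 ^ i"
  proof (cases "i \<le> j")
    case True
    \<comment> \<open>Adding the remaining tail of the geometric series turns the estimate into an
      identity that passes through the induction.\<close>
    have "(\<Sum>x=i..j. real_of_int N * (1 / 2) ^ x) + 2 * real_of_int N / 2 ^ (j + 1) = 2 * real_of_int N / 2 ^ i"
      using True
    proof (induction j rule: dec_induct)
      case (step k)
      then show ?case by (simp add: power_one_over field_simps)
    qed (simp add: power_one_over field_simps)
    moreover have "0 \<le> 2 * real_of_int N / 2 ^ (j + 1)" using N0 by simp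
    ultimately show ?thesis by linarith
  qed (use N0 in simp)
  then show ?thesis using sum_mono[of "{i..j}" "\<lambda>x. real (nat (N div 2 ^ x))", OF summand] by linarith
qed

text \<open>At the top level the sum has one term, at most \<open>n\<close>; this is the source of
  \<open>real n\<close>. Otherwise the penalty, and hence its ceiling, is at most
  \<open>2 ^ (i + 1)\<close>, so \<open>N / 2 ^ (i + 1) <= Q\<close>, and the geometric sum is at
  most four times that.\<close>

lemma penalty_level:
  assumes i: "i \<le> levels" "i = levels \<or> \<not> good (2 ^ (i + 1))"
  shows "0 \<le> Q" "(\<Sum>x=i..levels. real (nat (N div 2 ^ x))) \<le> real n + 4 * Q"
    "real (levels - i + 1) \<le> 4 * lg (Q / real n)"
proof -
  have N0: "0 \<le> real_of_int N" by simp
  have pos: "0 < penalty \<Gamma>" by (rule penalty_pos)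
  show Q0: "0 \<le> Q"
    using pos N0 by (cases "penalty \<Gamma>") (auto simp: per_penalty_def intro!: divide_nonneg_nonneg)
  have "(\<Sum>x=i..levels. real (nat (N div 2 ^ x))) \<le> real n + 4 * Q \<and>
    real (levels - i + 1) \<le> 4 * lg (Q / real n)"
  proof (cases "i = levels")
    case True
    have "N div 2 ^ levels \<le> int n"
      using levels_upper zdiv_mono1[of N "2 ^ levels * int n" "2 ^ levels"] by simp
    then show ?thesis using True Q0 lg_ge_1[of "Q / real n"] by simp
  next
    case False
    then have "\<not> good (2 ^ (i + 1))" using i by blast
    then have le: "penalty \<Gamma> \<le> ereal (2 ^ (i + 1))" by (simp add: good_def not_less)
    then obtain p where p: "penalty \<Gamma> = ereal p" using pos by (cases "penalty \<Gamma>") auto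
    have "0 < p" "p \<le> 2 ^ (i + 1)" using pos le p by auto
    then have c: "1 \<le> \<lceil>p\<rceil>" "\<lceil>p\<rceil> \<le> 2 ^ (i + 1)" by (auto simp: ceiling_le_iff)
    have Q: "Q = real_of_int N / real_of_int \<lceil>p\<rceil>" using p by (simp add: per_penalty_def)
    have "real_of_int \<lceil>p\<rceil> \<le> real_of_int (2 ^ (i + 1))" using c(2) by (simp only: of_int_le_iff)
    then have QN: "real_of_int N / 2 ^ (i + 1) \<le> Q"
      unfolding Q using c(1) N0 by (intro divide_left_mono) auto
    have "(\<Sum>x=i..levels. real (nat (N div 2 ^ x))) \<le> 2 * real_of_int N / 2 ^ i" by (rule geometric_sum)
    also have "\<dots> = 4 * (real_of_int N / 2 ^ (i + 1))" by simp
    also have "\<dots> \<le> real n + 4 * Q" using QN by simp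
    finally have 1: "(\<Sum>x=i..levels. real (nat (N div 2 ^ x))) \<le> real n + 4 * Q" .
    define d where "d = levels - i"
    have d: "levels - 1 = i + (d - 1)" "1 \<le> d" using False i(1) by (auto simp: d_def)
    have "2 ^ (levels - 1) * int n < N" using False i(1) by (intro levels_lower) auto
    then have "real_of_int (2 ^ (levels - 1) * int n) < real_of_int N" by (simp only: of_int_less_iff)
    then have "2 ^ i * 2 ^ (d - 1) * real n < real_of_int N" unfolding d(1) power_add by simp
    then have "2 ^ (d - 1) / 2 \<le> real_of_int N / 2 ^ (i + 1) / real n" using n_pos by (simp add: field_simps)
    also have "\<dots> \<le> Q / real n" using QN by (intro divide_right_mono) auto
    finally have x: "2 ^ (d - 1) / 2 \<le> Q / real n" .
    \<comment> \<open>One unit is lost because minimality of \<open>levels\<close> is available only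
      at \<open>levels - 1\<close>, the other because the penalty is compared with level
      \<open>i + 1\<close>. With the attempt at level \<open>i\<close> itself this leaves 3 to be
      absorbed by \<open>lg\<close>, hence the factor 4.\<close>
    have "real d - 2 = log 2 (2 ^ (d - 1) / 2)"
      using d(2) by (simp add: log_divide log_nat_power of_nat_diff)
    also have "\<dots> \<le> log 2 (Q / real n)" using x by (intro log_mono) auto
    also have "\<dots> \<le> lg (Q / real n)" 
    proof (rule log_le_lg)
      have "(0::real) < 2 ^ (d - 1) / 2" by simp
      then show "0 < Q / real n" using x by linarith
    qed
    finally show ?thesis using 1 lg_ge_1[of "Q / real n"] by (simp add: d_def)
  qed
  then show "(\<Sum>x=i..levels. real (nat (N div 2 ^ x))) \<le> real n + 4 * Q"
    "real (levels - i + 1) \<le> 4 * lg (Q / real n)" by blast+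
qed

text \<open>The numbers of levels above \<open>i\<close> and of phases per attempt supply the two
  logarithms. In units of \<open>R\<close> preprocessing contributes 25, the first phases 120, the
  later phases 361 * 12 and the loop overhead 44, together 4521; the penalty term has the factor
  480. So 5000 covers both.\<close>

lemma total_time:
  assumes i: "i \<le> levels" "i = levels \<or> \<not> good (2 ^ (i + 1))"
  shows "real (n * (5 * m + 7) + 2 * levels + 7 + (\<Sum>x=i..levels. attempt_time x)) \<le> 5000 * time_bound \<Gamma> M"
proof -
  let ?a = "lg (real_of_int N / real n)" and ?b = "lg (Q / real n)"
  let ?mn = "real m * real n" and ?D = "\<Sum>x=i..levels. real (nat (N div 2 ^ x))"
  note p = penalty_level[OF i]
  have a: "1 \<le> ?a" and b: "1 \<le> ?b" by (rule lg_ge_1)+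
  have mn: "1 \<le> ?mn" "real n \<le> ?mn" "0 \<le> real m"
    using mn_ge by (simp_all flip: of_nat_mult)
  define R where "R = ?mn * ?a * ?b"
  have 1: "?mn * ?a \<le> R" 
  proof -
    have "0 \<le> ?mn * ?a" using a mn by (intro mult_nonneg_nonneg) auto
    then have "?mn * ?a * 1 \<le> ?mn * ?a * ?b" using b by (rule mult_left_mono[rotated])
    then show ?thesis by (simp add: R_def)
  qed
  have 2: "?mn \<le> ?mn * ?a"
  proof -
    have "?mn * 1 \<le> ?mn * ?a" using a mn by (intro mult_left_mono) auto
    then show ?thesis by simp
  qed
  have "(\<Sum>x=i..levels. real (x + 1)) \<le> (\<Sum>x=i..levels. real (levels + 1))" by (intro sum_mono) auto
  also have "\<dots> = real (levels - i + 1) * real (levels + 1)" using i(1) by (simp add: Suc_diff_le)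
  also have "\<dots> \<le> (4 * ?b) * (3 * ?a)" using p(3) levels_le b by (intro mult_mono) auto
  finally have s: "(\<Sum>x=i..levels. real (x + 1)) \<le> 12 * (?a * ?b)" by (simp add: mult_ac)
  have c: "(\<Sum>x=i..levels. 11 :: real) = 11 * real (levels - i + 1)" using i(1) by (simp add: Suc_diff_le)
  have "real (\<Sum>x=i..levels. attempt_time x) =
      (\<Sum>x=i..levels. 120 * (real m * real (nat (N div 2 ^ x))) + 361 * (?mn * real (x + 1)) + 11)"
    by (simp only: of_nat_sum attempt_time_def of_nat_add of_nat_mult of_nat_numeral)
  also have "\<dots> = 120 * (real m * ?D) + 361 * (?mn * (\<Sum>x=i..levels. real (x + 1))) + 11 * real (levels - i + 1)"
    by (simp only: sum.distrib sum_distrib_left[symmetric] c)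
  finally have A: "real (\<Sum>x=i..levels. attempt_time x) =
      120 * (real m * ?D) + 361 * (?mn * (\<Sum>x=i..levels. real (x + 1))) + 11 * real (levels - i + 1)" .
  have D: "real m * ?D \<le> ?mn + 4 * (real m * Q)"
    using mult_left_mono[OF p(2) mn(3)] by (simp add: algebra_simps)
  have S: "?mn * (\<Sum>x=i..levels. real (x + 1)) \<le> 12 * R"
  proof -
    have "?mn * (\<Sum>x=i..levels. real (x + 1)) \<le> ?mn * (12 * (?a * ?b))"
      using s mn by (intro mult_left_mono) auto
    also have "\<dots> = 12 * R" by (simp add: R_def)
    finally show ?thesis .
  qed
  have bR: "?b \<le> R"
  proof -
    have "1 * ?b \<le> (?mn * ?a) * ?b" using 2 mn b by (intro mult_right_mono) auto
    then show ?thesis by (simp add: R_def)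
  qed
  have aR: "?a \<le> R"
  proof -
    have "1 * ?a \<le> ?mn * ?a" using mn a by (intro mult_right_mono) auto
    then show ?thesis using 1 by simp
  qed
  have "real (n * (5 * m + 7) + 2 * levels + 7) = 5 * ?mn + 7 * real n + 2 * real levels + 7"
    by (simp add: algebra_simps)
  moreover have "real levels \<le> 3 * ?a" using levels_le by simp
  ultimately have T: "real (n * (5 * m + 7) + 2 * levels + 7) \<le> 19 * ?mn + 6 * ?a"
    using mn by linarith
  have mQ: "0 \<le> real m * Q" using p(1) by simp
  \<comment> \<open>Stated for variables so that the nonlinear products become atoms and linear
    arithmetic suffices.\<close>
  have sum_up: "t + y \<le> 5000 * r + 5000 * q"
    if "t \<le> 19 * u + 6 * a" "0 \<le> q" "y = 120 * d + 361 * z + 11 * c" "d \<le> u + 4 * q"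
      "z \<le> 12 * r" "1 \<le> b" "b \<le> r" "a \<le> r" "v \<le> r" "u \<le> v" "c \<le> 4 * b"
    for t y r q u a d z c b v :: real
    using that by linarith
  have "real (n * (5 * m + 7) + 2 * levels + 7 + (\<Sum>x=i..levels. attempt_time x))
      \<le> 5000 * R + 5000 * (real m * Q)"
    unfolding of_nat_add[of _ "sum _ _"] by (rule sum_up[OF T mQ A D S b bR aR 1 2 p(3)])
  moreover have "card (edges \<Gamma>) = m"
    using presents distinct_card unfolding presents_def by metis
  ultimately show ?thesis by (simp add: time_bound_def Let_def R_def algebra_simps)
qed

end

section \<open>Word size and conclusion\<close>

text \<open>With \<open>X\<close> the base of \<open>word_bound\<close>, the three products are
  bounded by 4, 1 and a fraction of \<open>X * X\<close>. Since \<open>X\<close> is at least 4, its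
  fourth power is at least \<open>16 * (X * X)\<close>, so the exponent 4 absorbs all
  constants.\<close>

lemma word_bound_large:
  assumes "weighted_game_graph \<Gamma>" "presents es \<Gamma>"
  shows "2 * int (length es) * (max 0 M + 2 * int (card (nodes \<Gamma>)) + 4) +
     int (card (nodes \<Gamma>)) * int (length es) + 2 * max 0 M + 2 * int (card (nodes \<Gamma>)) + 2 \<le> word_bound 4 \<Gamma> M"
proof -
  interpret weighted_game \<Gamma> using assms(1) by unfold_locales
  let ?n = "int (card (nodes \<Gamma>))" and ?m = "int (length es)" and ?W = "MAX e \<in> edges \<Gamma>. \<bar>weight \<Gamma> e\<bar>"
  define X where "X = 2 + ?n + ?m + \<bar>M\<bar> + ?W"
  have m: "card (edges \<Gamma>) = length es"
    using assms(2) distinct_card unfolding presents_def by metis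
  obtain u where "u \<in> nodes \<Gamma>" using nodes_nonempty by blast
  then obtain e where e: "e \<in> edges \<Gamma>" using successor_exists by blast
  have "0 \<le> \<bar>weight \<Gamma> e\<bar>" by simp
  also have "\<dots> \<le> ?W" using e finite_edges by (intro Max_ge) auto
  finally have W: "0 \<le> ?W" .
  have n1: "1 \<le> ?n" using finite_nodes nodes_nonempty by (simp add: card_gt_0_iff Suc_le_eq)
  have m1: "1 \<le> ?m" using e finite_edges m by (metis card_gt_0_iff empty_iff int_one_le_iff_zero_less of_nat_0_less_iff)
  have X: "4 \<le> X" "?n \<le> X" "?m \<le> X" "max 0 M + 2 * ?n + 4 \<le> 2 * X" "2 * max 0 M + 2 * ?n + 2 \<le> 2 * X"
    using W n1 m1 by (auto simp: X_def)
  have "2 * ?m * (max 0 M + 2 * ?n + 4) \<le> 2 * X * (2 * X)" using X by (intro mult_mono) auto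
  moreover have "?n * ?m \<le> X * X" using X by (intro mult_mono) auto
  moreover have "4 * X \<le> X * X" using X by (intro mult_right_mono) auto
  moreover have "16 * (X * X) \<le> (X * X) * (X * X)"
  proof -
    have "4 * 4 \<le> X * X" using X by (intro mult_mono) auto
    then show ?thesis using X by (intro mult_right_mono) auto
  qed
  moreover have "word_bound 4 \<Gamma> M = (X * X) * (X * X)"
    by (simp add: word_bound_def X_def m power4_eq_xxxx mult.assoc)
  ultimately show ?thesis using X(1,5) by linarith
qed

theorem theorem1:
  shows "\<exists>(prog :: com) (k :: nat) (K :: real).
    \<forall>(\<Gamma> :: nat game) (es :: (nat \<times> nat) list) (M :: int).
      weighted_game_graph \<Gamma> \<longrightarrow> presents es \<Gamma> \<longrightarrow> energy_upper_bound \<Gamma> M \<longrightarrow>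
      (\<exists>t s. run (word_bound k \<Gamma> M) prog (input_state \<Gamma> es M) t s \<and>
             outputs_minimal_energies \<Gamma> s \<and>
             real t \<le> K * time_bound \<Gamma> M)"
proof (rule exI[of _ energy_program], rule exI[of _ 4], rule exI[of _ 5000], intro allI impI)
  fix \<Gamma> :: "nat game" and es M
  assume *: "weighted_game_graph \<Gamma>" "presents es \<Gamma>" "energy_upper_bound \<Gamma> M"
  interpret energy_machine \<Gamma> es M "word_bound 4 \<Gamma> M"
    using * word_bound_large[OF *(1,2)] by unfold_locales
  have lay: "input_layout (input_state \<Gamma> es M)" "vars (input_state \<Gamma> es M) ''M'' = M"
    using nodes_less by (auto simp: input_layout_def input_state_def array_of_def)
  \<comment> \<open>The penalty enters here, in the analysis alone: the level \<open>i\<close>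
    depends on it, while the program has been fixed before the game.\<close>
  obtain i where i: "i \<le> levels" "good (2 ^ i)" "i = levels \<or> \<not> good (2 ^ (i + 1))"
    using good_level_exists by blast
  obtain t s where r: "run (word_bound 4 \<Gamma> M) energy_program (input_state \<Gamma> es M) t s" "finished s" and
    t: "t \<le> n * (5 * m + 7) + 2 * levels + 7 + (\<Sum>x=i..levels. attempt_time x)"
    using exec_energy_program[OF lay i(1,2)] unfolding exec_def by blast
  have "outputs_minimal_energies \<Gamma> s"
    using r(2) nodes_less by (simp add: outputs_minimal_energies_def finished_def arr_def)
  moreover have "real t \<le> 5000 * time_bound \<Gamma> M"
    using t total_time[OF i(1,3)] by (meson of_nat_le_iff order_trans)
  ultimately show "\<exists>t s. run (word_bound 4 \<Gamma> M) energy_program (input_state \<Gamma> es M) t s \<and>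
     outputs_minimal_energies \<Gamma> s \<and> real t \<le> 5000 * time_bound \<Gamma> M"
    using r(1) by blast
qed

end
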